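(* For $n\ge0$, let $X(n)$ denote the location at time $n$ of the second-class particle in the Plancherel-TASEP interacting particle system. The limit $$W=\lim_{n\to\infty}\frac{X(n)}{\sqrt n}$$ exists almost surely and is a random variable distributed according to the semicircle distribution on $[-2,2]$, i.e. the distribution with density $\frac1{2\pi}\sqrt{4-w^2}$ for $|w|\le2$.
   Context: A Young diagram $\lambda$ of size $n$ is a partition $\lambda(1)\ge\cdots\ge\lambda(k)>0$ of $n$, identified with the set of boxes $\{(i,j):1\le j\le k,\ 1\le i\le\lambda(j)\}$ (column $i$, row $j$); $\varnothing$ is the empty diagram. Write $\lambda\nearrow\nu$ if $\nu$ is obtained from $\lambda$ by adding one box. $f^\lambda$ is the number of standard Young tableaux of shape $\lambda$. The Plancherel growth process is the Markov chain $\varnothing=\Lambda_0\nearrow\Lambda_1\nearrow\cdots$ with transition probabilities $\mathrm{Prob}(\Lambda_{n+1}=\nu\mid\Lambda_n=\lambda)=\frac{f^\nu}{(n+1)f^\lambda}$ if $\lambda\nearrow\nu$ and $0$ otherwise ($\lambda$ of size $n$). Rost's mapping: in the coordinates $u=x-y$, $v=x+y$, draw the profile $\phi_\lambda$ of $\lambda$: the boundary of the region $\bigcup_{(i,j)\in\lambda}[i-1,i]\times[j-1,j]$ as a graph $v=\phi_\lambda(u)$, extended by $\phi_\lambda(u)=|u|$ outside the diagram. It has slope $\pm1$ on each interval $[m,m+1]$, $m\in\mathbb Z$. To $\lambda$ one associates the particle configuration on $\mathbb Z+\frac12$ in which site $m+\frac12$ holds a particle if $\phi_\lambda$ has slope $-1$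 on $[m,m+1]$ and is a hole if the slope is $+1$. Adding a box to $\lambda$ then corresponds to one particle jumping one site to the right into a hole; specifically, adding a box $(i,j)$ with $i-j=m$ means that the particle at $m-\frac12$ jumps to $m+\frac12$. Second-class particle: consider a path $\varnothing=\lambda_0\nearrow\lambda_1\nearrow\cdots$. Time $n\ge0$ corresponds to the diagram $\lambda_{n+1}$. In addition to the particle configuration one keeps track of a distinguished $*$-pair, consisting of a hole at site $X-\frac12$ immediately followed by a particle at site $X+\frac12$, where $X=X(n)\in\mathbb Z$. At time $0$ (diagram $\lambda_1=(1)$) the $*$-pair is the unique hole–particle adjacent pair, so $X(0)=0$. At each transition: if the particle of the $*$-pair (at $X+\frac12$) jumps to $X+\frac32$, the $*$-pair moves right, $X(n+1)=X(n)+1$; if the particle at $X-\frac32$ jumps onto the hole of the $*$-pair (at $X-\frac12$), the $*$-pair moves left, $X(n+1)=X(n)-1$; otherwise $X(n+1)=X(n)$. The $*$-pair, viewed as contracted to a single site, is called the second-class particle, and $X(n)$ is its location at time $n$. The Plancherel-TASEP is the random system obtained by taking the path $(\lambda_n)$ to be the Plancherel growth process $(\Lambda_n)$. *)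

theory Defs
  imports "HOL-Probability.Probability"
begin

text \<open>A diagram is the list of its row lengths; \<open>\<mu> ! (j - 1)\<close> is the length of row \<open>j\<close>.
  Boxes are pairs (column, row), both counted from 1.\<close>

definition young_diagram :: "nat list \<Rightarrow> bool" where
  "young_diagram \<mu> \<longleftrightarrow> sorted_wrt (\<ge>) \<mu> \<and> (\<forall>r\<in>set \<mu>. r > 0)"

definition boxes :: "nat list \<Rightarrow> (nat \<times> nat) set" where
  "boxes \<mu> = {(i, j). 1 \<le> j \<and> j \<le> length \<mu> \<and> 1 \<le> i \<and> i \<le> \<mu> ! (j - 1)}"

definition adds_box :: "nat list \<Rightarrow> nat list \<Rightarrow> bool" (infix "\<nearrow>" 50) where
  "\<mu> \<nearrow> \<nu> \<longleftrightarrow> young_diagram \<mu> \<and> young_diagram \<nu> \<and>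
     (\<exists>b. b \<notin> boxes \<mu> \<and> boxes \<nu> = insert b (boxes \<mu>))"

definition standard_tableaux :: "nat list \<Rightarrow> (nat \<times> nat \<Rightarrow> nat) set" where
  "standard_tableaux \<mu> = {T \<in> extensional (boxes \<mu>).
     bij_betw T (boxes \<mu>) {1..sum_list \<mu>} \<and>
     (\<forall>i j. (i, j) \<in> boxes \<mu> \<and> (i + 1, j) \<in> boxes \<mu> \<longrightarrow> T (i, j) < T (i + 1, j)) \<and>
     (\<forall>i j. (i, j) \<in> boxes \<mu> \<and> (i, j + 1) \<in> boxes \<mu> \<longrightarrow> T (i, j) < T (i, j + 1))}"

definition num_tableaux :: "nat list \<Rightarrow> nat" where
  "num_tableaux \<mu> = card (standard_tableaux \<mu>)"

definition plancherel_transition :: "nat list \<Rightarrow> nat list \<Rightarrow> real" where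
  "plancherel_transition \<mu> \<nu> =
     (if \<mu> \<nearrow> \<nu> then real (num_tableaux \<nu>) / (real (sum_list \<mu> + 1) * real (num_tableaux \<mu>))
      else 0)"

text \<open>The assumption \<open>transition\<close> expresses both the Markov property and the transition
  probabilities: it conditions on the whole history \<open>p 0, \<dots>, p n\<close>, whenever that
  history has positive probability.\<close>

locale plancherel_growth_process = prob_space M for M :: "'a measure" +
  fixes \<Lambda> :: "nat \<Rightarrow> 'a \<Rightarrow> nat list"
  assumes random_diagram: "\<And>n. random_variable (count_space UNIV) (\<Lambda> n)"
    and start: "AE \<omega> in M. \<Lambda> 0 \<omega> = []"
    and transition: "\<And>n p \<nu>.
      prob {\<omega> \<in> space M. \<forall>k\<le>n. \<Lambda> k \<omega> = p k} > 0 \<Longrightarrow>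
      cond_prob M (\<lambda>\<omega>. \<Lambda> (Suc n) \<omega> = \<nu>) (\<lambda>\<omega>. \<forall>k\<le>n. \<Lambda> k \<omega> = p k)
        = plancherel_transition (p n) \<nu>"

definition region :: "nat list \<Rightarrow> (real \<times> real) set" where
  "region \<mu> = (\<Union>(i, j)\<in>boxes \<mu>. {real i - 1..real i} \<times> {real j - 1..real j})"

text \<open>Over a point \<open>u\<close> that the diagram reaches, the region occupies exactly the
  \<open>v\<close> from \<open>\<bar>u\<bar>\<close> up to its upper boundary; elsewhere only \<open>\<bar>u\<bar>\<close> is left in the set.\<close>

definition profile :: "nat list \<Rightarrow> real \<Rightarrow> real" where
  "profile \<mu> u = Sup (insert \<bar>u\<bar> {x + y | x y. (x, y) \<in> region \<mu> \<and> x - y = u})"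

definition profile_slope :: "nat list \<Rightarrow> int \<Rightarrow> real \<Rightarrow> bool" where
  "profile_slope \<mu> m c \<longleftrightarrow>
     (\<forall>u\<in>{real_of_int m..real_of_int m + 1}.
        profile \<mu> u = profile \<mu> (real_of_int m) + c * (u - real_of_int m))"

definition particles :: "nat list \<Rightarrow> real set" where
  "particles \<mu> = {real_of_int m + 1/2 | m. profile_slope \<mu> m (-1)}"

definition holes :: "nat list \<Rightarrow> real set" where
  "holes \<mu> = {real_of_int m + 1/2 | m. profile_slope \<mu> m 1}"

definition particle_jumps :: "nat list \<Rightarrow> nat list \<Rightarrow> real \<Rightarrow> bool" where
  "particle_jumps \<mu> \<nu> s \<longleftrightarrow> s \<in> particles \<mu> \<and> s + 1 \<in> holes \<mu> \<and>
     particles \<nu> = insert (s + 1) (particles \<mu> - {s}) \<and>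
     holes \<nu> = insert s (holes \<mu> - {s + 1})"

text \<open>Time \<open>n\<close> corresponds to the diagram \<open>p (n + 1)\<close>. The value \<open>X\<close> stands for the
  pair consisting of the hole at \<open>X - 1/2\<close> and the particle at \<open>X + 1/2\<close>; in the
  configuration of the one-box diagram \<open>[1]\<close> at time 0 the only such pair is at 0.\<close>

fun second_class_particle :: "(nat \<Rightarrow> nat list) \<Rightarrow> nat \<Rightarrow> int" where
  "second_class_particle p 0 = 0"
| "second_class_particle p (Suc n) =
     (let X = second_class_particle p n in
      if particle_jumps (p (n + 1)) (p (n + 2)) (real_of_int X + 1/2) then X + 1
      else if particle_jumps (p (n + 1)) (p (n + 2)) (real_of_int X - 3/2) then X - 1
      else X)"

definition semicircle_density :: "real \<Rightarrow> real" where
  "semicircle_density w = (if \<bar>w\<bar> \<le> 2 then 1 / (2 * pi) * sqrt (4 - w\<^sup>2) else 0)"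

end

theory Submission
  imports Defs
begin

text \<open>
  A diagram is encoded by the set of the contents of its row ends (\<open>maya\<close>). Adding a box of
  content \<open>c\<close> moves the element \<open>c\<close> of this set to \<open>c + 1\<close>, which is the particle jump of Rost's
  mapping. The second-class particle sits at the content \<open>X\<close> of a removable box and moves exactly
  when the added box is a neighbour of that box. Let \<open>p(c)\<close> be the Plancherel probability of adding
  a box of content \<open>c\<close> to a diagram.

  The heart of the proof is a martingale. The probability of a two-step growth from \<open>\<mu>\<close> to \<open>\<kappa>\<close>
  depends on \<open>\<mu>\<close> and \<open>\<kappa>\<close> only, so two boxes that can be added in either order can be exchanged, and
  two boxes that cannot be exchanged form a domino, which stays on one side of the second-class
  particle. Hence the mass which the law \<open>p\<close> of the current diagram puts to the right of the
  second-class particle is a martingale (\<open>right_mass_harmonic\<close>). It is bounded, so it converges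
  almost surely.

  On the other hand the law \<open>p\<close> of the \<open>n\<close>-th diagram, rescaled by \<open>sqrt n\<close>, converges almost surely
  to the semicircle law. Frobenius' formula for the number of tableaux turns the generating function
  of the moments of \<open>p\<close> into a product (\<open>gen_eq\<close>), and adding a box multiplies it by an explicit
  factor, so each moment changes by a polynomial in the lower moments and the content of the box
  (\<open>moment_step\<close>). The mean change is a quadratic expression in the lower moments; its fixed point
  is the Catalan recursion, and the noise is a martingale whose contribution vanishes
  (\<open>AE_moments\<close>). The method of moments finishes this part. Together, if \<open>F\<close> is the semicircle
  distribution function, \<open>F (X n / sqrt n)\<close> converges almost surely, and so does \<open>X n / sqrt n\<close>
  unless the limit is \<open>0\<close> or \<open>1\<close>.

  It remains to know the law of \<open>X n\<close> at a fixed time. Given the diagram \<open>\<nu>\<close> at time \<open>n\<close>, the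
  removable box of the second-class particle has the same law as the box added last
  (\<open>X_joint_law\<close>): this is a jeu de taquin bijection reduced to one local rule
  (\<open>slide_preimages\<close>). So \<open>X n\<close> is distributed like the content of the box added to the \<open>n\<close>-th
  diagram, its rescaled law tends to the semicircle law, the values \<open>0\<close> and \<open>1\<close> above have
  probability zero, and the limit is semicircular.
\<close>


section \<open>Young diagrams as particle configurations\<close>

definition row_len :: "nat list \<Rightarrow> nat \<Rightarrow> nat" where
  "row_len \<mu> j = (if j < length \<mu> then \<mu> ! j else 0)"

text \<open>The particle configuration shifted by one half. The empty rows contribute all sufficiently
  negative integers.\<close>

definition maya :: "nat list \<Rightarrow> int set" where
  "maya \<mu> = range (\<lambda>j. int (row_len \<mu> j) - int j)"

text \<open>\<open>c\<close> is the content, column minus row, of the added box.\<close>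

definition step :: "nat list \<Rightarrow> int \<Rightarrow> nat list \<Rightarrow> bool" where
  "step \<mu> c \<nu> \<longleftrightarrow> young_diagram \<mu> \<and> young_diagram \<nu> \<and>
     (\<exists>r. c = int (row_len \<mu> r) - int r \<and> row_len \<nu> = (row_len \<mu>)(r := Suc (row_len \<mu> r)))"

lemma young_Nil: "young_diagram []" by (simp add: young_diagram_def)

lemma maya_Nil: "maya [] = {..0}"
  by (auto simp: maya_def row_len_def image_iff intro!: exI[of _ "nat (- _)"])

lemma boxes_iff: "(i, j) \<in> boxes \<mu> \<longleftrightarrow> 1 \<le> j \<and> 1 \<le> i \<and> i \<le> row_len \<mu> (j - 1)"
  by (auto simp: boxes_def row_len_def split: if_splits)

lemma row_len_antimono:
  assumes "young_diagram \<mu>" "j \<le> k" shows "row_len \<mu> k \<le> row_len \<mu> j"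
  using assms by (cases "j = k") (auto simp: young_diagram_def row_len_def sorted_wrt_iff_nth_less)

lemma row_len_pos_iff: "young_diagram \<mu> \<Longrightarrow> row_len \<mu> j > 0 \<longleftrightarrow> j < length \<mu>"
  by (auto simp: young_diagram_def row_len_def)

lemma row_len_inj:
  assumes "young_diagram \<mu>" "young_diagram \<nu>" "row_len \<mu> = row_len \<nu>" shows "\<mu> = \<nu>"
proof -
  have "j < length \<mu> \<longleftrightarrow> j < length \<nu>" for j
    using assms row_len_pos_iff by metis
  hence l: "length \<mu> = length \<nu>" by (meson linorder_neqE_nat order_less_irrefl)
  show ?thesis
    by (rule nth_equalityI[OF l]) (metis assms(3) l row_len_def)
qed

lemma row_len_surj:
  assumes anti: "\<And>j. f (Suc j) \<le> f j" and z: "f m = 0"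
  shows "\<exists>\<mu>. young_diagram \<mu> \<and> row_len \<mu> = f"
proof -
  define k where "k = (LEAST j. f j = 0)"
  have k0: "f k = 0" unfolding k_def using z by (rule LeastI)
  have kpos: "f j > 0" if "j < k" for j
    using not_less_Least that unfolding k_def by blast
  have mono: "f j' \<le> f j" if "j \<le> j'" for j j'
    using lift_Suc_antimono_le[of f, OF anti that] .
  have "young_diagram (map f [0..<k])"
    unfolding young_diagram_def sorted_wrt_iff_nth_less using kpos mono by auto
  moreover have "row_len (map f [0..<k]) = f"
  proof
    fix j show "row_len (map f [0..<k]) j = f j"
      using mono[of k j] k0 by (auto simp: row_len_def)
  qed
  ultimately show ?thesis by blast
qed

lemma sum_row_len:
  assumes "length \<mu> \<le> k" shows "sum_list \<mu> = (\<Sum>j<k. row_len \<mu> j)"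
proof -
  have "(\<Sum>j<k. row_len \<mu> j) = (\<Sum>j<length \<mu>. row_len \<mu> j)"
    by (rule sum.mono_neutral_right) (use assms in \<open>auto simp: row_len_def\<close>)
  also have "\<dots> = sum_list \<mu>"
    by (simp add: sum_list_sum_nth row_len_def atLeast0LessThan)
  finally show ?thesis by simp
qed

lemma row_content_strict:
  assumes "young_diagram \<mu>" "j < k"
  shows "int (row_len \<mu> k) - int k < int (row_len \<mu> j) - int j"
  using row_len_antimono[OF assms(1), of j k] assms(2) by linarith

lemma row_content_inj:
  assumes "young_diagram \<mu>" "int (row_len \<mu> k) - int k = int (row_len \<mu> j) - int j"
  shows "j = k"
proof (rule linorder_cases[of j k])
  assume "j < k" thus ?thesis using row_content_strict[OF assms(1), of j k] assms(2) by linarith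
next
  assume "k < j" thus ?thesis using row_content_strict[OF assms(1), of k j] assms(2) by linarith
qed

lemma maya_inj:
  assumes y: "young_diagram \<mu>" "young_diagram \<nu>" and eq: "maya \<mu> = maya \<nu>"
  shows "\<mu> = \<nu>"
proof -
  define a where "a j = int (row_len \<mu> j) - int j" for j
  define b where "b j = int (row_len \<nu> j) - int j" for j
  have R: "range a = range b" using eq by (simp add: maya_def a_def b_def)
  have sa: "a k < a j" if "j < k" for j k using row_content_strict[OF y(1) that]
      by (simp add: a_def)
  have sb: "b k < b j" if "j < k" for j k using row_content_strict[OF y(2) that]
      by (simp add: b_def)
  \<comment> \<open>Both sequences decrease strictly, so equal ranges force equal \<open>j\<close>-th largest elements.\<close>
  have "a j = b j" for j
  proof (induction j rule: less_induct)
    case (less j)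
    obtain i where i: "a j = b i" using R by (metis rangeE rangeI)
    obtain i' where i': "b j = a i'" using R by (metis rangeE rangeI)
    have "\<not> i < j" using less[of i] sa[of i j] i by fastforce
    moreover have "\<not> i' < j" using less[of i'] sb[of i' j] i' by fastforce
    ultimately show ?case using i i' sa[of j i'] sb[of j i]
      by (metis linorder_neqE_nat order.asym order_less_irrefl)
  qed
  hence "row_len \<mu> = row_len \<nu>" by (auto simp: a_def b_def fun_eq_iff)
  thus ?thesis using row_len_inj y by blast
qed

lemma step_youngD: "step \<mu> c \<nu> \<Longrightarrow> young_diagram \<mu>" "step \<mu> c \<nu> \<Longrightarrow> young_diagram \<nu>"
  by (auto simp: step_def)

lemma step_boxes:
  assumes "c = int (row_len \<mu> r) - int r" "row_len \<nu> = (row_len \<mu>)(r := Suc (row_len \<mu> r))"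
  shows "boxes \<nu> = insert (Suc (row_len \<mu> r), Suc r) (boxes \<mu>)"
    "(Suc (row_len \<mu> r), Suc r) \<notin> boxes \<mu>"
  using assms(2) by (auto simp: boxes_iff set_eq_iff)

lemma adds_box_iff_step: "\<mu> \<nearrow> \<nu> \<longleftrightarrow> (\<exists>c. step \<mu> c \<nu>)"
proof
  assume "\<exists>c. step \<mu> c \<nu>"
  thus "\<mu> \<nearrow> \<nu>" unfolding step_def adds_box_def using step_boxes by blast
next
  assume "\<mu> \<nearrow> \<nu>"
  then obtain i j where y: "young_diagram \<mu>" "young_diagram \<nu>" and b: "(i, j) \<notin> boxes \<mu>"
    "boxes \<nu> = insert (i, j) (boxes \<mu>)" by (auto simp: adds_box_def)
  have inj: "(i, j) \<in> boxes \<nu>" using b by simp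
  hence ij: "1 \<le> i" "1 \<le> j" by (auto simp: boxes_iff)
  define r where "r = j - 1"
  have jr: "j = Suc r" using ij by (simp add: r_def)
  have other: "row_len \<nu> q = row_len \<mu> q" if "q \<noteq> r" for q
  proof -
    have "x \<le> row_len \<nu> q \<longleftrightarrow> x \<le> row_len \<mu> q" if "x \<ge> 1" for x
    proof -
      have "(x, Suc q) \<in> boxes \<nu> \<longleftrightarrow> (x, Suc q) \<in> boxes \<mu>" using b jr \<open>q \<noteq> r\<close> by auto
      thus ?thesis using that by (simp add: boxes_iff)
    qed
    from this[of "row_len \<nu> q"] this[of "row_len \<mu> q"] show ?thesis
      by (metis One_nat_def Suc_leI le_antisym le_zero_eq linorder_not_less nat_le_linear
          not_gr_zero)
  qed
  have same: "x \<le> row_len \<nu> r \<longleftrightarrow> x = i \<or> x \<le> row_len \<mu> r" if "x \<ge> 1" for x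
  proof -
    have "(x, Suc r) \<in> boxes \<nu> \<longleftrightarrow> x = i \<or> (x, Suc r) \<in> boxes \<mu>" using b jr by auto
    thus ?thesis using that by (simp add: boxes_iff)
  qed
  have ni: "\<not> i \<le> row_len \<mu> r" using b(1) ij jr by (simp add: boxes_iff)
  have i: "i = Suc (row_len \<mu> r)" using same[of "Suc (row_len \<mu> r)"] same[of i] ni ij by fastforce
  have "row_len \<nu> r = i" using same[of "Suc i"] same[of i] ni ij i
    by (metis Suc_n_not_le_n le_SucE le_antisym not_less_eq_eq One_nat_def le_SucI)
  hence "row_len \<nu> = (row_len \<mu>)(r := Suc (row_len \<mu> r))" using other i by auto
  thus "\<exists>c. step \<mu> c \<nu>" unfolding step_def using y by blast
qed

lemma step_maya:
  assumes "step \<mu> c \<nu>"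
  shows "c \<in> maya \<mu>" "c + 1 \<notin> maya \<mu>" "maya \<nu> = insert (c + 1) (maya \<mu> - {c})"
proof -
  obtain r where y: "young_diagram \<mu>" "young_diagram \<nu>" and
    c: "c = int (row_len \<mu> r) - int r" and
    r: "row_len \<nu> = (row_len \<mu>)(r := Suc (row_len \<mu> r))" using assms by (auto simp: step_def)
  show "c \<in> maya \<mu>" using c by (auto simp: maya_def)
  show "c + 1 \<notin> maya \<mu>"
  proof
    assume "c + 1 \<in> maya \<mu>"
    then obtain q where q: "c + 1 = int (row_len \<mu> q) - int q" by (auto simp: maya_def)
    have "q \<noteq> r" using q c by auto
    hence "int (row_len \<nu> q) - int q = int (row_len \<nu> r) - int r" using q c r by auto
    thus False using row_content_inj[OF y(2)] \<open>q \<noteq> r\<close> by blast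
  qed
  have m: "x \<in> maya \<nu> \<longleftrightarrow> x = c + 1 \<or> (\<exists>q. q \<noteq> r \<and> x = int (row_len \<mu> q) - int q)" for x
    unfolding maya_def using c r by (auto simp: image_iff) 
  have m2: "(\<exists>q. q \<noteq> r \<and> x = int (row_len \<mu> q) - int q) \<longleftrightarrow> x \<in> maya \<mu> \<and> x \<noteq> c" for x
    unfolding maya_def using c row_content_inj[OF y(1)] by (auto simp: image_iff) metis
  show "maya \<nu> = insert (c + 1) (maya \<mu> - {c})" using m m2 by blast
qed

lemma step_maya_down:
  assumes "step \<mu> c \<nu>"
  shows "c + 1 \<in> maya \<nu>" "c \<notin> maya \<nu>" "maya \<mu> = insert c (maya \<nu> - {c + 1})"
  using step_maya[OF assms] by auto

lemma step_unique: "step \<mu> c \<nu> \<Longrightarrow> step \<mu> c \<nu>' \<Longrightarrow> \<nu> = \<nu>'"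
  by (rule maya_inj) (auto simp: step_maya dest: step_youngD)

lemma step_unique_content: "step \<mu> c \<nu> \<Longrightarrow> step \<mu> c' \<nu> \<Longrightarrow> c = c'"
  using step_maya_down(2)[of \<mu> c \<nu>] step_maya[of \<mu> c \<nu>] step_maya[of \<mu> c' \<nu>] by auto

lemma step_unique_down: "step \<mu> c \<nu> \<Longrightarrow> step \<mu>' c \<nu> \<Longrightarrow> \<mu> = \<mu>'"
  using step_maya_down(3)[of \<mu> c \<nu>] step_maya_down(3)[of \<mu>' c \<nu>]
  by (intro maya_inj) (auto dest: step_youngD)

text \<open>Row \<open>r\<close> can be extended because the row above it is longer: otherwise its row end would have
  content \<open>c + 1\<close>.\<close>

lemma step_up_ex:
  assumes y: "young_diagram \<mu>" and c: "c \<in> maya \<mu>" "c + 1 \<notin> maya \<mu>"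
  shows "\<exists>\<nu>. step \<mu> c \<nu>"
proof -
  obtain r where r: "c = int (row_len \<mu> r) - int r" using c by (auto simp: maya_def)
  let ?f = "(row_len \<mu>)(r := Suc (row_len \<mu> r))"
  have "?f (Suc j) \<le> ?f j" for j
  proof (cases "Suc j = r")
    case True
    have "row_len \<mu> j \<noteq> row_len \<mu> r"
    proof
      assume "row_len \<mu> j = row_len \<mu> r"
      hence "c + 1 = int (row_len \<mu> j) - int j" using r True by auto
      thus False using c by (auto simp: maya_def)
    qed
    thus ?thesis using True row_len_antimono[OF y, of j r] by auto
  next
    case False thus ?thesis using row_len_antimono[OF y, of j "Suc j"] by auto
  qed
  moreover have "?f (Suc (length \<mu> + r)) = 0" by (simp add: row_len_def)
  ultimately obtain \<nu> where "young_diagram \<nu>" "row_len \<nu> = ?f" using row_len_surj by blast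
  thus ?thesis using y r unfolding step_def by blast
qed

lemma step_down_ex:
  assumes y: "young_diagram \<nu>" and c: "c \<notin> maya \<nu>" "c + 1 \<in> maya \<nu>"
  shows "\<exists>\<mu>. step \<mu> c \<nu>"
proof -
  obtain r where r: "c + 1 = int (row_len \<nu> r) - int r" using c by (auto simp: maya_def)
  have ne: "row_len \<nu> (Suc r) \<noteq> row_len \<nu> r"
  proof
    assume "row_len \<nu> (Suc r) = row_len \<nu> r"
    hence "c = int (row_len \<nu> (Suc r)) - int (Suc r)" using r by auto
    hence "c \<in> maya \<nu>" unfolding maya_def by blast
    thus False using c by blast
  qed
  hence pos: "row_len \<nu> r > row_len \<nu> (Suc r)" using row_len_antimono[OF y, of r "Suc r"] by auto
  let ?f = "(row_len \<nu>)(r := row_len \<nu> r - 1)"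
  have "?f (Suc j) \<le> ?f j" for j
    using row_len_antimono[OF y, of j "Suc j"] pos by auto
  moreover have "?f (Suc (length \<nu> + r)) = 0" by (simp add: row_len_def)
  ultimately obtain \<mu> where \<mu>: "young_diagram \<mu>" "row_len \<mu> = ?f" using row_len_surj by blast
  have "row_len \<nu> = (row_len \<mu>)(r := Suc (row_len \<mu> r))" "c = int (row_len \<mu> r) - int r"
    using \<mu> pos r by auto
  thus ?thesis using \<mu> y unfolding step_def by blast
qed

lemma step_sum: assumes "step \<mu> c \<nu>" shows "sum_list \<nu> = Suc (sum_list \<mu>)"
proof -
  obtain r where r: "row_len \<nu> = (row_len \<mu>)(r := Suc (row_len \<mu> r))" using assms
      by (auto simp: step_def)
  define k where "k = Suc (r + length \<mu> + length \<nu>)"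
  have "sum_list \<nu> = (\<Sum>j<k. row_len \<nu> j)" by (rule sum_row_len) (simp add: k_def)
  also have "\<dots> = row_len \<nu> r + (\<Sum>j\<in>{..<k}-{r}. row_len \<nu> j)"
    by (rule sum.remove) (auto simp: k_def)
  also have "\<dots> = Suc (row_len \<mu> r + (\<Sum>j\<in>{..<k}-{r}. row_len \<mu> j))" by (simp add: r)
  also have "row_len \<mu> r + (\<Sum>j\<in>{..<k}-{r}. row_len \<mu> j) = (\<Sum>j<k. row_len \<mu> j)"
    by (rule sum.remove[symmetric]) (auto simp: k_def)
  also have "\<dots> = sum_list \<mu>" by (rule sum_row_len[symmetric]) (simp add: k_def)
  finally show ?thesis .
qed


section \<open>Standard tableaux and the branching rule\<close>

definition addable :: "nat list \<Rightarrow> int set" where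
  "addable \<mu> = {c. c \<in> maya \<mu> \<and> c + 1 \<notin> maya \<mu>}"

definition removable :: "nat list \<Rightarrow> int set" where
  "removable \<nu> = {c. c \<notin> maya \<nu> \<and> c + 1 \<in> maya \<nu>}"

definition up :: "nat list \<Rightarrow> int \<Rightarrow> nat list" where
  "up \<mu> c = (THE \<nu>. step \<mu> c \<nu>)"

definition down :: "nat list \<Rightarrow> int \<Rightarrow> nat list" where
  "down \<nu> c = (THE \<mu>. step \<mu> c \<nu>)"

lemma step_up: "young_diagram \<mu> \<Longrightarrow> c \<in> addable \<mu> \<Longrightarrow> step \<mu> c (up \<mu> c)"
  unfolding up_def addable_def by (rule theI') (use step_up_ex step_unique in blast)

lemma step_down: "young_diagram \<nu> \<Longrightarrow> c \<in> removable \<nu> \<Longrightarrow> step (down \<nu> c) c \<nu>"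
  unfolding down_def removable_def by (rule theI') (use step_down_ex step_unique_down in blast)

lemma step_iff_up: "step \<mu> c \<nu> \<longleftrightarrow> young_diagram \<mu> \<and> c \<in> addable \<mu> \<and> \<nu> = up \<mu> c"
  using step_up step_unique step_maya(1,2) step_youngD(1) unfolding addable_def by blast

lemma step_iff_down: "step \<mu> c \<nu> \<longleftrightarrow> young_diagram \<nu> \<and> c \<in> removable \<nu> \<and> \<mu> = down \<nu> c"
  using step_down step_unique_down step_maya_down(1,2) step_youngD(2) unfolding removable_def
      by blast

lemma removable_row:
  assumes "c \<in> removable \<nu>"
  shows "\<exists>r<length \<nu>. c + 1 = int (row_len \<nu> r) - int r"
proof -
  obtain r where r: "c + 1 = int (row_len \<nu> r) - int r"
    using assms by (auto simp: removable_def maya_def)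
  have "r < length \<nu>"
  proof (rule ccontr)
    assume "\<not> r < length \<nu>"
    hence "c = int (row_len \<nu> (Suc r)) - int (Suc r)" using r by (auto simp: row_len_def)
    hence "c \<in> maya \<nu>" unfolding maya_def by blast
    thus False using assms by (simp add: removable_def)
  qed
  thus ?thesis using r by blast
qed

lemma addable_row:
  assumes "c \<in> addable \<mu>"
  shows "\<exists>r\<le>length \<mu>. c = int (row_len \<mu> r) - int r"
proof -
  obtain r where r: "c = int (row_len \<mu> r) - int r"
    using assms by (auto simp: addable_def maya_def)
  have "r \<le> length \<mu>"
  proof (rule ccontr)
    assume "\<not> r \<le> length \<mu>"
    hence "c + 1 = int (row_len \<mu> (r - 1)) - int (r - 1)" using r by (auto simp: row_len_def)
    hence "c + 1 \<in> maya \<mu>" unfolding maya_def by blast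
    thus False using assms by (simp add: addable_def)
  qed
  thus ?thesis using r by blast
qed

lemma finite_addable: "finite (addable \<mu>)"
proof (rule finite_subset)
  show "addable \<mu> \<subseteq> (\<lambda>r. int (row_len \<mu> r) - int r) ` {..length \<mu>}" using addable_row by blast
qed simp

lemma finite_removable: "finite (removable \<nu>)"
proof (rule finite_subset)
  show "removable \<nu> \<subseteq> (\<lambda>r. int (row_len \<nu> r) - int r - 1) ` {..length \<nu>}"
  proof
    fix c assume "c \<in> removable \<nu>"
    then obtain r where "r < length \<nu>" "c + 1 = int (row_len \<nu> r) - int r" using removable_row
        by blast
    hence "r \<in> {..length \<nu>}" "c = int (row_len \<nu> r) - int r - 1" by auto
    thus "c \<in> (\<lambda>r. int (row_len \<nu> r) - int r - 1) ` {..length \<nu>}" by blast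
  qed
qed simp

lemma finite_boxes: "finite (boxes \<mu>)"
proof -
  have "boxes \<mu> \<subseteq> (\<Union>j\<in>{..length \<mu>}. {..\<mu> ! (j - 1)} \<times> {j})" by (auto simp: boxes_def)
  thus ?thesis by (rule finite_subset) auto
qed

lemma boxes_left_closed: "(i + 1, j) \<in> boxes \<mu> \<Longrightarrow> i \<ge> 1 \<Longrightarrow> (i, j) \<in> boxes \<mu>"
  by (auto simp: boxes_iff)

lemma boxes_below_closed:
  "young_diagram \<mu> \<Longrightarrow> (i, j + 1) \<in> boxes \<mu> \<Longrightarrow> j \<ge> 1 \<Longrightarrow> (i, j) \<in> boxes \<mu>"
  using row_len_antimono[of \<mu> "j - 1" j] by (auto simp: boxes_iff)

lemma finite_standard_tableaux: "finite (standard_tableaux \<mu>)"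
proof -
  have "standard_tableaux \<mu> \<subseteq> boxes \<mu> \<rightarrow>\<^sub>E {1..sum_list \<mu>}"
    by (auto simp: standard_tableaux_def PiE_def bij_betw_def)
  thus ?thesis by (rule finite_subset) (intro finite_PiE finite_boxes; simp)
qed

lemma step_newbox:
  assumes "step \<mu> c \<nu>"
  shows "\<exists>i j. int i - int j = c \<and> (i, j) \<notin> boxes \<mu> \<and> boxes \<nu> =
      insert (i, j) (boxes \<mu>) \<and> 1 \<le> i \<and> 1 \<le> j"
proof -
  obtain r where c: "c = int (row_len \<mu> r) - int r" and
    r: "row_len \<nu> = (row_len \<mu>)(r := Suc (row_len \<mu> r))" using assms by (auto simp: step_def)
  show ?thesis using step_boxes[OF c r] c
    by (intro exI[of _ "Suc (row_len \<mu> r)"] exI[of _ "Suc r"]) auto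
qed

definition newbox :: "nat list \<Rightarrow> nat list \<Rightarrow> nat \<times> nat" where
  "newbox \<mu> \<nu> = the_elem (boxes \<nu> - boxes \<mu>)"

lemma newbox:
  assumes "step \<mu> c \<nu>" "newbox \<mu> \<nu> = (i, j)"
  shows "int i - int j = c" "(i, j) \<notin> boxes \<mu>" "boxes \<nu> = insert (i, j) (boxes \<mu>)" "1 \<le> i" "1 \<le> j"
proof -
  obtain i' j' where *: "int i' - int j' = c" "(i', j') \<notin> boxes \<mu>" "boxes \<nu> =
      insert (i', j') (boxes \<mu>)"
    "1 \<le> i'" "1 \<le> j'" using step_newbox[OF assms(1)] by blast
  hence "boxes \<nu> - boxes \<mu> = {(i', j')}" by auto
  hence "(i, j) = (i', j')" using assms(2) by (simp add: newbox_def)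
  thus "int i - int j = c" "(i, j) \<notin> boxes \<mu>" "boxes \<nu> = insert (i, j) (boxes \<mu>)" "1 \<le> i" "1 \<le> j"
    using * by auto
qed

text \<open>The largest entry of such a tableau occupies the new box, so restriction to \<open>\<mu>\<close> and putting
  the entry back are mutually inverse.\<close>

lemma tableaux_with_largest_entry_at:
  assumes s: "step \<mu> c \<nu>"
  shows "card {T \<in> standard_tableaux \<nu>. T (newbox \<mu> \<nu>) = sum_list \<nu>} = num_tableaux \<mu>"
proof -
  obtain i0 j0 where b: "newbox \<mu> \<nu> = (i0, j0)" by fastforce
  note nb = newbox[OF s b]
  define N where "N = sum_list \<nu>"
  have N: "N = Suc (sum_list \<mu>)" using step_sum[OF s] N_def by simp
  let ?A = "{T \<in> standard_tableaux \<nu>. T (i0, j0) = N}"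
  have fwd: "restrict T (boxes \<mu>) \<in> standard_tableaux \<mu>" if T: "T \<in> ?A" for T
  proof -
    have bij: "bij_betw T (boxes \<nu>) {1..N}" using T by (simp add: standard_tableaux_def N_def)
    have "bij_betw T (boxes \<nu> - {(i0, j0)}) ({1..N} - {T (i0, j0)})"
      by (rule bij_betw_DiffI) (use bij nb(3) in \<open>auto simp: bij_betw_def\<close>)
    moreover have "boxes \<nu> - {(i0, j0)} = boxes \<mu>" using nb by auto
    moreover have "{1..N} - {T (i0, j0)} = {1..sum_list \<mu>}" using T N by auto
    ultimately have "bij_betw T (boxes \<mu>) {1..sum_list \<mu>}" by simp
    hence "bij_betw (restrict T (boxes \<mu>)) (boxes \<mu>) {1..sum_list \<mu>}"
      by (simp cong: bij_betw_cong)
    thus ?thesis using T nb(3) unfolding standard_tableaux_def by auto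
  qed
  have bwd: "T((i0, j0) := N) \<in> ?A" if T: "T \<in> standard_tableaux \<mu>" for T
  proof -
    have bij: "bij_betw T (boxes \<mu>) {1..sum_list \<mu>}" using T by (simp add: standard_tableaux_def)
    have rng: "T x \<le> sum_list \<mu>" if "x \<in> boxes \<mu>" for x
      using bij that by (auto simp: bij_betw_def)
    have "bij_betw (T((i0, j0) := N)) (boxes \<mu>) {1..sum_list \<mu>}"
      using bij nb(2) by (subst bij_betw_cong[of _ _ T]) auto
    hence "bij_betw (T((i0, j0) := N)) (boxes \<mu> \<union> {(i0, j0)}) ({1..sum_list \<mu>} \<union> {N})"
      by (intro bij_betw_combine) (auto simp: N)
    moreover have "boxes \<mu> \<union> {(i0, j0)} = boxes \<nu>" using nb by auto
    moreover have "{1..sum_list \<mu>} \<union> {N} = {1..sum_list \<nu>}" using N N_def by auto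
    ultimately have "bij_betw (T((i0, j0) := N)) (boxes \<nu>) {1..sum_list \<nu>}" by simp
    moreover have "(T((i0, j0) := N)) (i, j) < (T((i0, j0) := N)) (i + 1, j)"
      if "(i, j) \<in> boxes \<nu>" "(i + 1, j) \<in> boxes \<nu>" for i j
    proof -
      have ne: "(i, j) \<noteq> (i0, j0)" using boxes_left_closed[of i0 j0 \<mu>] that nb by auto
      hence 1: "(i, j) \<in> boxes \<mu>" using that nb by auto
      show ?thesis using T rng[OF 1] ne 1 that nb N by (auto simp: standard_tableaux_def)
    qed
    moreover have "(T((i0, j0) := N)) (i, j) < (T((i0, j0) := N)) (i, j + 1)"
      if "(i, j) \<in> boxes \<nu>" "(i, j + 1) \<in> boxes \<nu>" for i j
    proof -
      have ne: "(i, j) \<noteq> (i0, j0)"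
        using boxes_below_closed[of \<mu> i0 j0] that nb step_youngD(1)[OF s] by auto
      hence 1: "(i, j) \<in> boxes \<mu>" using that nb by auto
      show ?thesis using T rng[OF 1] ne 1 that nb N by (auto simp: standard_tableaux_def)
    qed
    moreover have "T((i0, j0) := N) \<in> extensional (boxes \<nu>)"
      using T nb by (auto simp: standard_tableaux_def extensional_def)
    ultimately show ?thesis by (simp add: standard_tableaux_def)
  qed
  have "bij_betw (\<lambda>T. restrict T (boxes \<mu>)) ?A (standard_tableaux \<mu>)"
  proof (rule bij_betw_byWitness[where f' = "\<lambda>T. T((i0, j0) := N)"])
    show "\<forall>T\<in>?A. (restrict T (boxes \<mu>))((i0, j0) := N) = T"
      using nb by (fastforce simp: standard_tableaux_def extensional_def fun_eq_iff)
    show "\<forall>T\<in>standard_tableaux \<mu>. restrict (T((i0, j0) := N)) (boxes \<mu>) = T"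
      using nb by (fastforce simp: standard_tableaux_def extensional_def fun_eq_iff)
    show "(\<lambda>T. restrict T (boxes \<mu>)) ` ?A \<subseteq> standard_tableaux \<mu>" using fwd by blast
    show "(\<lambda>T. T((i0, j0) := N)) ` standard_tableaux \<mu> \<subseteq> ?A" using bwd by blast
  qed
  thus ?thesis unfolding b N_def num_tableaux_def by (rule bij_betw_same_card)
qed

text \<open>Nothing can lie to the right of or above the largest entry, so its box is a corner.\<close>

lemma largest_entry_removable:
  assumes y: "young_diagram \<nu>" and T: "T \<in> standard_tableaux \<nu>" and pos: "sum_list \<nu> > 0"
  shows "\<exists>c\<in>removable \<nu>. T (newbox (down \<nu> c) \<nu>) = sum_list \<nu>"
proof -
  have bij: "bij_betw T (boxes \<nu>) {1..sum_list \<nu>}" using T by (simp add: standard_tableaux_def)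
  have "sum_list \<nu> \<in> T ` boxes \<nu>" using bij pos by (simp add: bij_betw_def)
  then obtain i j where ij: "(i, j) \<in> boxes \<nu>" "T (i, j) = sum_list \<nu>" by auto
  have rng: "T x \<le> sum_list \<nu>" if "x \<in> boxes \<nu>" for x using bij that by (auto simp: bij_betw_def)
  have r: "(i + 1, j) \<notin> boxes \<nu>"
  proof
    assume a: "(i + 1, j) \<in> boxes \<nu>"
    hence "T (i, j) < T (i + 1, j)" using T ij unfolding standard_tableaux_def by blast
    thus False using rng[OF a] ij by simp
  qed
  have u: "(i, j + 1) \<notin> boxes \<nu>"
  proof
    assume a: "(i, j + 1) \<in> boxes \<nu>"
    hence "T (i, j) < T (i, j + 1)" using T ij unfolding standard_tableaux_def by blast
    thus False using rng[OF a] ij by simp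
  qed
  define r0 where "r0 = j - 1"
  have j: "j = Suc r0" using ij by (auto simp: r0_def boxes_iff)
  have rl: "row_len \<nu> r0 = i" "row_len \<nu> (Suc r0) < i" "i \<ge> 1"
    using ij r u j by (auto simp: boxes_iff)
  define c where "c = int i - int j"
  have "c + 1 = int (row_len \<nu> r0) - int r0" using rl j by (simp add: c_def)
  hence c1: "c + 1 \<in> maya \<nu>" by (auto simp: maya_def)
  have c0: "c \<notin> maya \<nu>"
  proof
    assume "c \<in> maya \<nu>"
    then obtain q where q: "c = int (row_len \<nu> q) - int q" by (auto simp: maya_def)
    show False
    proof (cases "q \<le> r0")
      case True
      thus False using q row_len_antimono[OF y True] rl j by (simp add: c_def)
    next
      case False
      thus False using q row_len_antimono[OF y, of "Suc r0" q] rl j by (simp add: c_def)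
    qed
  qed
  have cr: "c \<in> removable \<nu>" using c0 c1 by (simp add: removable_def)
  have s: "step (down \<nu> c) c \<nu>" by (rule step_down[OF y cr])
  obtain i' j' where b: "newbox (down \<nu> c) \<nu> = (i', j')" by fastforce
  note nb = newbox[OF s b]
  have in': "(i', j') \<in> boxes \<nu>" using nb by auto
  have nr: "(i' + 1, j') \<notin> boxes \<nu>" using nb boxes_left_closed[of i' j' "down \<nu> c"] by auto
  have rl': "row_len \<nu> (j' - 1) = i'" using in' nr by (auto simp: boxes_iff)
  have "int (row_len \<nu> (j' - 1)) - int (j' - 1) = int (row_len \<nu> r0) - int r0"
    using rl rl' nb j by (auto simp: c_def of_nat_diff)
  hence "j' - 1 = r0" using row_content_inj[OF y] by metis
  hence "(i', j') = (i, j)" using rl rl' j nb by auto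
  hence "T (newbox (down \<nu> c) \<nu>) = sum_list \<nu>" using b ij by simp
  thus ?thesis using cr by blast
qed

theorem num_tableaux_branching:
  assumes y: "young_diagram \<nu>" and pos: "sum_list \<nu> > 0"
  shows "num_tableaux \<nu> = (\<Sum>c\<in>removable \<nu>. num_tableaux (down \<nu> c))"
proof -
  let ?S = "\<lambda>c. {T \<in> standard_tableaux \<nu>. T (newbox (down \<nu> c) \<nu>) = sum_list \<nu>}"
  have "standard_tableaux \<nu> = (\<Union>c\<in>removable \<nu>. ?S c)"
    using largest_entry_removable[OF y _ pos] by blast
  hence "num_tableaux \<nu> = card (\<Union>c\<in>removable \<nu>. ?S c)" unfolding num_tableaux_def by simp
  also have "\<dots> = (\<Sum>c\<in>removable \<nu>. card (?S c))"
  proof (rule card_UN_disjoint)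
    show "finite (removable \<nu>)" by (rule finite_removable)
    show "\<forall>c\<in>removable \<nu>. finite (?S c)" using finite_standard_tableaux by auto
    show "\<forall>c\<in>removable \<nu>. \<forall>c'\<in>removable \<nu>. c \<noteq> c' \<longrightarrow> ?S c \<inter> ?S c' = {}"
    proof (intro ballI impI)
      fix c c' assume cc: "c \<in> removable \<nu>" "c' \<in> removable \<nu>" "c \<noteq> c'"
      obtain i j where b: "newbox (down \<nu> c) \<nu> = (i, j)" by fastforce
      obtain i' j' where b': "newbox (down \<nu> c') \<nu> = (i', j')" by fastforce
      note nb = newbox[OF step_down[OF y cc(1)] b]
      note nb' = newbox[OF step_down[OF y cc(2)] b']
      have ne: "(i, j) \<noteq> (i', j')" using nb(1) nb'(1) cc(3) by auto
      have "inj_on T (boxes \<nu>)" if "T \<in> standard_tableaux \<nu>" for T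
        using that by (auto simp: standard_tableaux_def bij_betw_def)
      moreover have "(i, j) \<in> boxes \<nu>" "(i', j') \<in> boxes \<nu>" using nb nb' by auto
      ultimately have ne': "T (i, j) \<noteq> T (i', j')" if "T \<in> standard_tableaux \<nu>" for T
        using that ne by (meson inj_onD)
      show "?S c \<inter> ?S c' = {}"
      proof (rule equals0I)
        fix T assume "T \<in> ?S c \<inter> ?S c'"
        hence "T \<in> standard_tableaux \<nu>" "T (i, j) = sum_list \<nu>" "T (i', j') = sum_list \<nu>"
          unfolding b b' by blast+
        thus False using ne'[of T] by argo
      qed
    qed
  qed
  also have "\<dots> = (\<Sum>c\<in>removable \<nu>. num_tableaux (down \<nu> c))"
    by (intro sum.cong refl tableaux_with_largest_entry_at[OF step_down[OF y]])
  finally show ?thesis .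
qed

lemma num_tableaux_Nil: "num_tableaux [] = 1"
proof -
  have "boxes [] = {}" by (auto simp: boxes_def)
  hence "standard_tableaux [] = {\<lambda>x. undefined}"
    by (auto simp: standard_tableaux_def bij_betw_def)
  thus ?thesis by (simp add: num_tableaux_def)
qed

lemma young_sum_0: "young_diagram \<mu> \<Longrightarrow> sum_list \<mu> = 0 \<Longrightarrow> \<mu> = []"
  by (cases \<mu>) (auto simp: young_diagram_def)

lemma num_tableaux_pos: "young_diagram \<mu> \<Longrightarrow> num_tableaux \<mu> > 0"
proof (induction "sum_list \<mu>" arbitrary: \<mu> rule: less_induct)
  case less
  show ?case
  proof (cases "sum_list \<mu> = 0")
    case True thus ?thesis using young_sum_0[OF less.prems] num_tableaux_Nil by simp
  next
    case False
    define r where "r = length \<mu> - 1"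
    have ne: "\<mu> \<noteq> []" using False by auto
    have "row_len \<mu> r > 0" using row_len_pos_iff[OF less.prems] ne by (simp add: r_def)
    moreover have z: "row_len \<mu> q = 0" if "q > r" for q using that by (simp add: row_len_def r_def)
    ultimately have "int (row_len \<mu> r) - int r - 1 \<notin> maya \<mu>"
      unfolding maya_def
    proof (safe)
      fix q assume h: "row_len \<mu> r > 0" "\<And>q. q > r \<Longrightarrow> row_len \<mu> q = 0"
        "int (row_len \<mu> r) - int r - 1 = int (row_len \<mu> q) - int q"
      show False
      proof (cases "q \<le> r")
        case True thus False using row_len_antimono[OF less.prems True] h by auto
      next
        case False thus False using h(1,3) h(2)[of q] by auto
      qed
    qed
    moreover have "int (row_len \<mu> r) - int r - 1 + 1 \<in> maya \<mu>" unfolding maya_def by simp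
    ultimately have c: "int (row_len \<mu> r) - int r - 1 \<in> removable \<mu>" (is "?c \<in> _")
      unfolding removable_def by blast
    have s: "step (down \<mu> ?c) ?c \<mu>" by (rule step_down[OF less.prems c])
    have "num_tableaux (down \<mu> ?c) > 0"
      by (rule less.hyps) (use step_sum[OF s] step_youngD[OF s] in auto)
    hence "(\<Sum>c\<in>removable \<mu>. num_tableaux (down \<mu> c)) > 0"
      using c by (intro sum_pos2[OF finite_removable, of ?c]) auto
    thus ?thesis using num_tableaux_branching[OF less.prems] False by simp
  qed
qed


section \<open>Partial fractions and a Lagrange-type identity\<close>

definition vandermonde :: "nat \<Rightarrow> (nat \<Rightarrow> real) \<Rightarrow> real" where
  "vandermonde k l = (\<Prod>i<k. \<Prod>j<i. l j - l i)"

lemma vandermonde_nonzero: "inj_on l {..<k} \<Longrightarrow> vandermonde k l \<noteq> 0"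
  by (auto simp: vandermonde_def dest!: inj_onD)

text \<open>Only the factors that contain \<open>l r\<close> change.\<close>

lemma vandermonde_update:
  assumes "inj_on l {..<k}" "r < k"
  shows "vandermonde k (l(r := x)) = vandermonde k l * (\<Prod>j\<in>{..<k}-{r}. (x - l j) / (l r - l j))"
  using assms
proof (induction k)
  case (Suc k)
  have ne: "l i \<noteq> l j" if "i < Suc k" "j < Suc k" "i \<noteq> j" for i j
    using Suc.prems(1) that by (auto dest!: inj_onD)
  show ?case
  proof (cases "r = k")
    case True
    have "vandermonde (Suc k) (l(r := x)) = vandermonde k (l(r := x)) * (\<Prod>j<k. l j - x)"
      using True by (simp add: vandermonde_def)
    also have "vandermonde k (l(r := x)) = vandermonde k l" unfolding vandermonde_def
      by (intro prod.cong refl) (use True in auto)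
    also have "(\<Prod>j<k. l j - x) = (\<Prod>j<k. (l j - l k) * ((x - l j) / (l k - l j)))"
      by (intro prod.cong refl) (use ne in \<open>auto simp: field_simps\<close>)
    also have "vandermonde k l * \<dots> = vandermonde (Suc k) l * (\<Prod>j<k. (x - l j) / (l k - l j))"
      by (simp only: vandermonde_def prod.lessThan_Suc prod.distrib mult.assoc)
    also have "{..<k} = {..<Suc k} - {r}" using True by auto
    finally show ?thesis using True by simp
  next
    case False
    hence r: "r < k" using Suc.prems by simp
    have inj: "inj_on l {..<k}" using Suc.prems(1) by (rule inj_on_subset) auto
    have "vandermonde (Suc k) (l(r := x)) = vandermonde k (l(r := x)) * (\<Prod>j<k. (l(r := x)) j - l k)"
      using False by (simp add: vandermonde_def)
    also have "(\<Prod>j<k. (l(r := x)) j - l k) = (x - l k) * (\<Prod>j\<in>{..<k}-{r}. l j - l k)"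
      using r by (subst prod.remove[of _ r]) auto
    also have "\<dots> = (\<Prod>j<k. l j - l k) * ((x - l k) / (l r - l k))"
      using r ne[of r k] by (subst prod.remove[of "{..<k}" r]) auto
    also have "vandermonde k (l(r := x)) = vandermonde k l * (\<Prod>j\<in>{..<k}-{r}. (x - l j) / (l r -
        l j))"
      by (rule Suc.IH[OF inj r])
    also have "vandermonde k l * (\<Prod>j\<in>{..<k}-{r}. (x - l j) / (l r - l j)) *
        ((\<Prod>j<k. l j - l k) * ((x - l k) / (l r - l k)))
      = vandermonde (Suc k) l * (((x - l k) / (l r - l k)) * (\<Prod>j\<in>{..<k}-{r}. (x - l j) / (l r -
          l j)))"
      by (simp add: vandermonde_def)
    also have "((x - l k) / (l r - l k)) * (\<Prod>j\<in>{..<k}-{r}. (x - l j) / (l r - l j)) =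
        (\<Prod>j\<in>insert k ({..<k}-{r}). (x - l j) / (l r - l j))" by simp
    also have "insert k ({..<k}-{r}) = {..<Suc k} - {r}" using r by auto
    finally show ?thesis .
  qed
qed simp

lemma lagrange_interpolation:
  fixes l :: "nat \<Rightarrow> real"
  assumes inj: "inj_on l {..<k}" and deg: "degree P < k"
  shows "poly P z = (\<Sum>i<k. poly P (l i) / (\<Prod>j\<in>{..<k}-{i}. l i - l j) * (\<Prod>j\<in>{..<k}-{i}. z - l j))"
proof -
  define Q where "Q = (\<Sum>i<k. smult (poly P (l i) / (\<Prod>j\<in>{..<k}-{i}. l i -
      l j)) (\<Prod>j\<in>{..<k}-{i}. [:- l j, 1:]))"
  have ne: "l i \<noteq> l j" if "i < k" "j < k" "i \<noteq> j" for i j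
    using inj that by (auto dest!: inj_onD)
  have pQ: "poly Q z = (\<Sum>i<k. poly P (l i) / (\<Prod>j\<in>{..<k}-{i}. l i - l j) * (\<Prod>j\<in>{..<k}-{i}. z -
      l j))" for z
    by (simp add: Q_def poly_sum poly_prod)
  have "P = Q"
  proof (rule poly_eqI_degree[of "l ` {..<k}"])
    fix x assume "x \<in> l ` {..<k}"
    then obtain m where m: "m < k" "x = l m" by auto
    have z: "(\<Prod>j\<in>{..<k}-{i}. x - l j) = 0" if "i < k" "i \<noteq> m" for i
      using m that by (intro prod_zero) auto
    have "poly Q x = (\<Sum>i\<in>{m}. poly P (l i) / (\<Prod>j\<in>{..<k}-{i}. l i - l j) * (\<Prod>j\<in>{..<k}-{i}. x - l j))"
      unfolding pQ using m z by (intro sum.mono_neutral_right) auto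
    also have "\<dots> = poly P x" using m ne by simp
    finally show "poly P x = poly Q x" by simp
  next
    show "card (l ` {..<k}) > degree P" using deg inj by (simp add: card_image)
    have "degree Q \<le> k - 1" unfolding Q_def
    proof (rule degree_sum_le)
      fix i assume i: "i \<in> {..<k}"
      have "degree (\<Prod>j\<in>{..<k}-{i}. [:- l j, 1:]) \<le> (\<Sum>j\<in>{..<k}-{i}. degree [:- l j, 1:])"
        by (rule degree_prod_sum_le[unfolded o_def]) auto
      also have "\<dots> = k - 1" using i by simp
      finally show "degree (smult (poly P (l i) / (\<Prod>j\<in>{..<k}-{i}. l i -
          l j)) (\<Prod>j\<in>{..<k}-{i}. [:- l j, 1:])) \<le> k - 1"
        using degree_smult_le le_trans by blast
    qed simp
    thus "card (l ` {..<k}) > degree Q" using deg inj by (simp add: card_image)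
  qed
  hence "poly P z = poly Q z" by (rule arg_cong)
  thus ?thesis unfolding pQ .
qed

text \<open>The geometric series, that is, the inverse of \<open>1 - a X\<close>.\<close>

definition geo :: "real \<Rightarrow> real fps" where "geo a = Abs_fps (\<lambda>n. a ^ n)"

lemma geo_nth [simp]: "fps_nth (geo a) n = a ^ n" by (simp add: geo_def)

abbreviation lin :: "real \<Rightarrow> real fps" where "lin a \<equiv> 1 - fps_const a * fps_X"

lemma geo_lin: "geo a * lin a = 1" "lin a * geo a = 1"
proof -
  have "lin a * geo a = 1"
  proof (rule fps_ext)
    fix n show "fps_nth (lin a * geo a) n = fps_nth 1 n"
      by (cases n) (simp_all add: left_diff_distrib mult.assoc)
  qed
  thus "geo a * lin a = 1" "lin a * geo a = 1" by (auto simp: mult.commute)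
qed

text \<open>A polynomial identity in \<open>1 / t\<close>, cleared of denominators, is an identity of power series in
    \<open>t\<close>.\<close>

lemma fps_of_poly_eqI:
  assumes "\<And>t. t \<noteq> 0 \<Longrightarrow> poly p t = poly q (t :: real)"
  shows "fps_of_poly p = fps_of_poly q"
proof -
  have "infinite (UNIV - {0 :: real})" by (simp add: infinite_UNIV_char_0)
  moreover have "UNIV - {0} \<subseteq> {t. poly (p - q) t = 0}" using assms by auto
  ultimately have "infinite {t. poly (p - q) t = 0}" using finite_subset by blast
  hence "p - q = 0" using poly_roots_finite by blast
  thus ?thesis by simp
qed

lemma fps_of_poly_lin: "fps_of_poly [:1, - a:] = lin a"
  by (simp add: fps_of_poly_pCons)

lemma fps_of_poly_prod_lin: "fps_of_poly (\<Prod>j\<in>A. [:1, - b j:]) = (\<Prod>j\<in>A. lin (b j))"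
  by (simp only: fps_of_poly_prod fps_of_poly_lin)

lemma prod_geo_lin:
  fixes l :: "nat \<Rightarrow> real"
  assumes "i < k"
  shows "(\<Prod>j\<in>{..<k}-{i}. lin (l j)) * (\<Prod>j<k. geo (l j)) = geo (l i)"
proof -
  have "(\<Prod>j<k. geo (l j)) = geo (l i) * (\<Prod>j\<in>{..<k}-{i}. geo (l j))"
    using assms by (subst prod.remove[of _ i]) auto
  hence "(\<Prod>j\<in>{..<k}-{i}. lin (l j)) * (\<Prod>j<k. geo (l j)) =
      geo (l i) * (\<Prod>j\<in>{..<k}-{i}. lin (l j) * geo (l j))" by (simp add: prod.distrib mult_ac)
  thus ?thesis by (simp add: geo_lin)
qed

text \<open>Lagrange interpolation of the polynomial with roots \<open>b j\<close> at the nodes \<open>l j\<close>, read in \<open>1 /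
  X\<close>.\<close>

lemma partial_fractions:
  fixes l b :: "nat \<Rightarrow> real"
  assumes inj: "inj_on l {..<k}" and k: "k > 0"
  shows "(\<Sum>i<k. fps_const ((\<Prod>j<k-1. l i - b j) / (\<Prod>j\<in>{..<k}-{i}. l i - l j)) * geo (l i)) =
    (\<Prod>j<k-1. lin (b j)) * (\<Prod>j<k. geo (l j))"
proof -
  define c where "c i = (\<Prod>j<k-1. l i - b j) / (\<Prod>j\<in>{..<k}-{i}. l i - l j)" for i
  define P where "P = (\<Prod>j<k-1. [:- b j, 1:])"
  have "degree P \<le> (\<Sum>j<k-1. degree [:- b j, 1:])"
    unfolding P_def by (rule degree_prod_sum_le[unfolded o_def]) auto
  hence deg: "degree P < k" using k by simp
  have eq: "(\<Prod>j<k-1. z - b j) = (\<Sum>i<k. c i * (\<Prod>j\<in>{..<k}-{i}. z - l j))" for z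
    using lagrange_interpolation[OF inj deg, of z] by (simp add: P_def poly_prod c_def)
  have "fps_of_poly (\<Prod>j<k-1. [:1, - b j:]) =
      fps_of_poly (\<Sum>i<k. [:c i:] * (\<Prod>j\<in>{..<k}-{i}. [:1, - l j:]))"
  proof (rule fps_of_poly_eqI)
    fix t :: real assume t: "t \<noteq> 0"
    have "(\<Prod>j<k-1. 1 - t * b j) = (\<Prod>j<k-1. t * (1 / t - b j))"
      using t by (intro prod.cong refl) (simp add: field_simps)
    also have "\<dots> = t ^ (k - 1) * (\<Prod>j<k-1. 1 / t - b j)" by (simp add: prod.distrib)
    also have "\<dots> = (\<Sum>i<k. c i * (t ^ (k - 1) * (\<Prod>j\<in>{..<k}-{i}. 1 / t - l j)))"
      unfolding eq by (simp add: sum_distrib_left mult_ac)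
    also have "\<dots> = (\<Sum>i<k. c i * (\<Prod>j\<in>{..<k}-{i}. 1 - t * l j))"
    proof (intro sum.cong refl)
      fix i assume i: "i \<in> {..<k}"
      have "(\<Prod>j\<in>{..<k}-{i}. 1 - t * l j) = (\<Prod>j\<in>{..<k}-{i}. t * (1 / t - l j))"
        using t by (intro prod.cong refl) (simp add: field_simps)
      also have "\<dots> = t ^ (k - 1) * (\<Prod>j\<in>{..<k}-{i}. 1 / t - l j)" using i by (simp add: prod.distrib)
      finally show "c i * (t ^ (k - 1) * (\<Prod>j\<in>{..<k}-{i}. 1 / t - l j)) =
        c i * (\<Prod>j\<in>{..<k}-{i}. 1 - t * l j)" by simp
    qed
    finally show "poly (\<Prod>j<k-1. [:1, - b j:]) t = poly (\<Sum>i<k. [:c i:] * (\<Prod>j\<in>{..<k}-{i}. [:1, -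
        l j:])) t"
      by (simp add: poly_prod poly_sum)
  qed
  hence "(\<Prod>j<k-1. lin (b j)) = (\<Sum>i<k. fps_const (c i) * (\<Prod>j\<in>{..<k}-{i}. lin (l j)))"
    by (simp only: fps_of_poly_prod_lin fps_of_poly_sum fps_of_poly_mult fps_of_poly_const)
  hence "(\<Prod>j<k-1. lin (b j)) * (\<Prod>j<k. geo (l j)) =
     (\<Sum>i<k. fps_const (c i) * ((\<Prod>j\<in>{..<k}-{i}. lin (l j)) * (\<Prod>j<k. geo (l j))))"
    by (simp add: sum_distrib_right mult.assoc)
  also have "\<dots> = (\<Sum>i<k. fps_const (c i) * geo (l i))"
    by (intro sum.cong refl) (simp add: prod_geo_lin)
  finally show ?thesis by (simp add: c_def)
qed

lemma lin_geo_shift: "lin (a + 1) * geo a = 1 - fps_X * geo a"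
proof -
  have c: "fps_const (a + 1) = fps_const a + 1" by (metis fps_const_1_eq_1 fps_const_add)
  show ?thesis unfolding c using geo_lin(2)[of a] by (simp add: algebra_simps)
qed

text \<open>The coefficients needed for \<open>hook_identity\<close>: there the product has the partial fraction
  expansion \<open>1 - X * (\<Sum>i. A i / (1 - l i X))\<close>.\<close>

lemma prod_geo_coeffs:
  "fps_nth (\<Prod>j<m. 1 - fps_X * geo (l j)) 0 = 1"
  "fps_nth (\<Prod>j<m. 1 - fps_X * geo (l j)) 1 = - real m"
  "fps_nth (\<Prod>j<m. 1 - fps_X * geo (l j)) 2 = real m * (real m - 1) / 2 - (\<Sum>j<m. l j)"
proof (induction m)
  case (Suc m)
  define B where "B = (\<Prod>j<m. 1 - fps_X * geo (l j))"
  have "(\<Prod>j<Suc m. 1 - fps_X * geo (l j)) = B - fps_X * (B * geo (l m))"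
    by (simp only: B_def prod.lessThan_Suc right_diff_distrib mult_1_right mult.left_commute)
  hence nth: "fps_nth (\<Prod>j<Suc m. 1 - fps_X * geo (l j)) n =
      fps_nth B n - (if n = 0 then 0 else fps_nth (B * geo (l m)) (n - 1))" for n by simp
  have IH: "fps_nth B 0 = 1" "fps_nth B 1 = - real m"
    "fps_nth B 2 = real m * (real m - 1) / 2 - (\<Sum>j<m. l j)" using Suc unfolding B_def by auto
  hence "fps_nth (B * geo (l m)) 0 = 1" "fps_nth (B * geo (l m)) 1 = l m - real m"
    by (simp_all add: fps_mult_nth)
  with IH show "fps_nth (\<Prod>j<Suc m. 1 - fps_X * geo (l j)) 0 = 1"
    "fps_nth (\<Prod>j<Suc m. 1 - fps_X * geo (l j)) 1 = - real (Suc m)"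
    "fps_nth (\<Prod>j<Suc m. 1 - fps_X * geo (l j)) 2 = real (Suc m) * (real (Suc m) - 1) / 2 -
        (\<Sum>j<Suc m. l j)"
    unfolding nth by (simp_all add: field_simps)
qed simp_all

text \<open>This sum makes Frobenius' formula satisfy the branching rule. It is the coefficient of \<open>X^2\<close>
  in the partial fraction expansion of the product of \<open>(1 - (l j + 1) X) / (1 - l j X)\<close>.\<close>

lemma hook_identity:
  fixes l :: "nat \<Rightarrow> real"
  assumes inj: "inj_on l {..<k}"
  shows "(\<Sum>i<k. l i * (\<Prod>j\<in>{..<k}-{i}. (l i - 1 - l j) / (l i - l j))) =
      (\<Sum>i<k. l i) - real k * (real k - 1) / 2"
proof (cases "k = 0")
  case False
  define A where "A i = (\<Prod>j\<in>{..<k}-{i}. (l i - 1 - l j) / (l i - l j))" for i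
  \<comment> \<open>The leading terms cancel, so interpolation at the \<open>k\<close> nodes recovers \<open>P\<close>.\<close>
  define P where "P = (\<Prod>j<k. [:- l j, 1:]) - (\<Prod>j<k. [:- (l j + 1), 1:])"
  have deg0: "degree (\<Prod>j<k. [:- b j, 1:]) = k" "coeff (\<Prod>j<k. [:- b j, 1:]) k =
      1" for b :: "nat \<Rightarrow> real"
  proof -
    show d: "degree (\<Prod>j<k. [:- b j, 1:]) = k" 
      using degree_prod_eq_sum_degree[of "{..<k}" "\<lambda>j. [:- b j, 1:]"] by simp
    have "lead_coeff (\<Prod>j<k. [:- b j, 1:]) = 1" by (subst lead_coeff_prod) simp
    thus "coeff (\<Prod>j<k. [:- b j, 1:]) k = 1" by (simp only: d)
  qed
  have "degree P \<le> k" unfolding P_def by (rule degree_diff_le) (simp_all only: deg0 order_refl)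
  moreover have "coeff P k = 0" unfolding P_def coeff_diff by (simp only: deg0 diff_self)
  ultimately have deg: "degree P < k" using False
    by (metis coeff_0_degree_minus_1 degree_0 le_neq_implies_less leading_coeff_0_iff neq0_conv)
  have PA: "poly P (l i) / (\<Prod>j\<in>{..<k}-{i}. l i - l j) = A i" if "i < k" for i
  proof -
    have "(\<Prod>j<k. l i - l j) = 0" by (rule prod_zero) (use that in auto)
    hence "poly P (l i) = - (\<Prod>j<k. l i - l j - 1)"
      by (simp add: P_def poly_prod algebra_simps)
    also have "(\<Prod>j<k. l i - l j - 1) = - (\<Prod>j\<in>{..<k}-{i}. l i - 1 - l j)"
      using that by (subst prod.remove[of _ i]) (auto simp: algebra_simps)
    finally show ?thesis by (simp add: A_def prod_dividef)
  qed
  have eq: "(\<Prod>j<k. z - l j) - (\<Prod>j<k. z - (l j + 1)) = (\<Sum>i<k. A i * (\<Prod>j\<in>{..<k}-{i}. z - l j))" for z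
  proof -
    have "poly P z = (\<Sum>i<k. A i * (\<Prod>j\<in>{..<k}-{i}. z - l j))"
      unfolding lagrange_interpolation[OF inj deg, of z] by (intro sum.cong refl) (simp add: PA)
    thus ?thesis by (simp add: P_def poly_prod algebra_simps)
  qed
  have "fps_of_poly ((\<Prod>j<k. [:1, - (l j + 1):])) =
      fps_of_poly ((\<Prod>j<k. [:1, - l j:]) - [:0, 1:] * (\<Sum>i<k. [:A i:] * (\<Prod>j\<in>{..<k}-{i}. [:1, -
          l j:])))"
  proof (rule fps_of_poly_eqI)
    fix t :: real assume t: "t \<noteq> 0"
    have m: "(\<Prod>j<k. 1 - t * b j) = t ^ k * (\<Prod>j<k. 1 / t - b j)" for b
    proof -
      have "(\<Prod>j<k. 1 - t * b j) = (\<Prod>j<k. t * (1 / t - b j))"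
        using t by (intro prod.cong refl) (simp add: field_simps)
      thus ?thesis by (simp add: prod.distrib)
    qed
    have m': "t * (\<Prod>j\<in>{..<k}-{i}. 1 - t * l j) = t ^ k * (\<Prod>j\<in>{..<k}-{i}. 1 / t - l j)" if "i <
        k" for i
    proof -
      have "(\<Prod>j\<in>{..<k}-{i}. 1 - t * l j) = (\<Prod>j\<in>{..<k}-{i}. t * (1 / t - l j))"
        using t by (intro prod.cong refl) (simp add: field_simps)
      also have "\<dots> = t ^ (k - 1) * (\<Prod>j\<in>{..<k}-{i}. 1 / t - l j)" using that
          by (simp add: prod.distrib)
      finally show ?thesis using False by (cases k) simp_all
    qed
    have "(\<Prod>j<k. 1 - t * l j) - (\<Prod>j<k. 1 - t * (l j + 1)) =
      t ^ k * ((\<Prod>j<k. 1 / t - l j) - (\<Prod>j<k. 1 / t - (l j + 1)))"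
      unfolding m by (simp add: algebra_simps)
    also have "\<dots> = (\<Sum>i<k. A i * (t ^ k * (\<Prod>j\<in>{..<k}-{i}. 1 / t - l j)))"
      unfolding eq by (simp add: sum_distrib_left mult_ac)
    also have "\<dots> = (\<Sum>i<k. A i * (t * (\<Prod>j\<in>{..<k}-{i}. 1 - t * l j)))"
      by (intro sum.cong refl) (simp add: m')
    also have "\<dots> = t * (\<Sum>i<k. A i * (\<Prod>j\<in>{..<k}-{i}. 1 - t * l j))"
      by (simp add: sum_distrib_left mult_ac)
    finally show "poly (\<Prod>j<k. [:1, - (l j + 1):]) t =
      poly ((\<Prod>j<k. [:1, - l j:]) - [:0, 1:] * (\<Sum>i<k. [:A i:] * (\<Prod>j\<in>{..<k}-{i}. [:1, - l j:]))) t"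
      by (simp add: poly_prod poly_sum algebra_simps)
  qed
  hence "(\<Prod>j<k. lin (l j + 1)) = (\<Prod>j<k. lin (l j)) - fps_X * (\<Sum>i<k. fps_const (A i) *
      (\<Prod>j\<in>{..<k}-{i}. lin (l j)))"
    by (simp only: fps_of_poly_prod_lin fps_of_poly_sum fps_of_poly_diff fps_of_poly_mult
        fps_of_poly_const fps_of_poly_fps_X)
  hence "(\<Prod>j<k. lin (l j + 1)) * (\<Prod>j<k. geo (l j)) =
     (\<Prod>j<k. lin (l j)) * (\<Prod>j<k. geo (l j)) -
     fps_X * (\<Sum>i<k. fps_const (A i) * ((\<Prod>j\<in>{..<k}-{i}. lin (l j)) * (\<Prod>j<k. geo (l j))))"
    by (simp add: left_diff_distrib sum_distrib_right mult.assoc)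
  also have "(\<Prod>j<k. lin (l j)) * (\<Prod>j<k. geo (l j)) = 1"
    by (simp add: geo_lin flip: prod.distrib)
  also have "(\<Sum>i<k. fps_const (A i) * ((\<Prod>j\<in>{..<k}-{i}. lin (l j)) * (\<Prod>j<k. geo (l j)))) =
      (\<Sum>i<k. fps_const (A i) * geo (l i))"
    by (intro sum.cong refl) (simp add: prod_geo_lin)
  finally have main: "(\<Prod>j<k. lin (l j + 1) * geo (l j)) = 1 -
      fps_X * (\<Sum>i<k. fps_const (A i) * geo (l i))"
    by (simp add: prod.distrib)
  have "fps_nth (\<Prod>j<k. 1 - fps_X * geo (l j)) 2 = - (\<Sum>i<k. A i * l i)"
    using main unfolding lin_geo_shift by (simp add: fps_sum_nth)
  hence "(\<Sum>i<k. l i * A i) = (\<Sum>i<k. l i) - real k * (real k - 1) / 2"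
    unfolding prod_geo_coeffs by (simp add: mult.commute)
  thus ?thesis unfolding A_def .
qed simp


section \<open>The transition probabilities and their moments\<close>

definition row_ct :: "nat list \<Rightarrow> nat \<Rightarrow> real" where
  "row_ct \<mu> j = real (row_len \<mu> j) - real j"

lemma row_ct_of_int: "row_ct \<mu> j = real_of_int (int (row_len \<mu> j) - int j)"
  by (simp add: row_ct_def)

lemma row_ct_inj: assumes "young_diagram \<mu>" shows "inj_on (row_ct \<mu>) A"
proof (rule inj_onI)
  fix x y assume "row_ct \<mu> x = row_ct \<mu> y"
  hence "int (row_len \<mu> x) - int x = int (row_len \<mu> y) - int y" unfolding row_ct_of_int by linarith
  thus "x = y" using row_content_inj[OF assms] by metis
qed

lemma row_ct_step:
  assumes "row_len \<nu> = (row_len \<mu>)(r := Suc (row_len \<mu> r))"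
  shows "row_ct \<nu> = (row_ct \<mu>)(r := row_ct \<mu> r + 1)" "row_ct \<mu> = (row_ct \<nu>)(r := row_ct \<nu> r - 1)"
  using assms by (auto simp: row_ct_def fun_eq_iff)

text \<open>Frobenius' formula for the number of standard tableaux. Replacing the usual shifted row
  lengths by contents does not affect the Vandermonde product; dividing by its value at the empty
  diagram normalises the latter to \<open>1\<close>. Here \<open>k\<close> is any bound on the number of rows.\<close>

definition frobenius :: "nat \<Rightarrow> nat list \<Rightarrow> real" where
  "frobenius k \<mu> = fact (sum_list \<mu>) * (vandermonde k (row_ct \<mu>) / vandermonde k (row_ct [])) *
     (\<Prod>j<k. fact (k - 1 - j) / fact (row_len \<mu> j + (k - 1 - j)))"

lemma frobenius_nonzero: "young_diagram \<mu> \<Longrightarrow> frobenius k \<mu> \<noteq> 0"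
  using vandermonde_nonzero[OF row_ct_inj[of \<mu> "{..<k}"]] vandermonde_nonzero[OF row_ct_inj[OF
      young_Nil, of "{..<k}"]]
  by (simp add: frobenius_def)

lemma frobenius_fact_step:
  assumes r: "row_len \<nu> = (row_len \<mu>)(r := Suc (row_len \<mu> r))" and rk: "r < k"
  shows "(\<Prod>j<k. fact (k - 1 - j) / fact (row_len \<mu> j + (k - 1 - j))) =
    (row_ct \<mu> r + real k) * (\<Prod>j<k. fact (k - 1 - j) / fact (row_len \<nu> j + (k - 1 - j)) :: real)"
proof -
  have "(fact (row_len \<nu> r + (k - 1 - r)) :: real) = (row_ct \<mu> r + real k) * fact (row_len \<mu> r +
      (k - 1 - r))"
    using rk by (simp add: r row_ct_def of_nat_diff)
  moreover have "row_ct \<mu> r + real k \<noteq> 0" using rk by (simp add: row_ct_def)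
  moreover have "(\<Prod>j\<in>{..<k}-{r}. fact (k - 1 - j) / fact (row_len \<nu> j + (k - 1 - j)) :: real) =
     (\<Prod>j\<in>{..<k}-{r}. fact (k - 1 - j) / fact (row_len \<mu> j + (k - 1 - j)))"
    by (intro prod.cong refl) (simp add: r)
  ultimately show ?thesis using rk
    by (subst (1 2) prod.remove[of "{..<k}" r]) auto
qed

lemma frobenius_up:
  assumes y: "young_diagram \<mu>" "young_diagram \<nu>"
    and r: "row_len \<nu> = (row_len \<mu>)(r := Suc (row_len \<mu> r))" and rk: "r < k"
    and n: "sum_list \<nu> = Suc (sum_list \<mu>)"
  shows "frobenius k \<nu> = real (Suc (sum_list \<mu>)) * frobenius k \<mu> *
    ((\<Prod>j\<in>{..<k}-{r}. (row_ct \<mu> r + 1 - row_ct \<mu> j) / (row_ct \<mu> r - row_ct \<mu> j)) / (row_ct \<mu> r +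
        real k))"
proof -
  have "vandermonde k (row_ct \<nu>) = vandermonde k (row_ct \<mu>) *
     (\<Prod>j\<in>{..<k}-{r}. (row_ct \<mu> r + 1 - row_ct \<mu> j) / (row_ct \<mu> r - row_ct \<mu> j))"
    unfolding row_ct_step(1)[OF r] by (rule vandermonde_update[OF row_ct_inj[OF y(1)] rk])
  moreover have "row_ct \<mu> r + real k \<noteq> 0" using rk by (simp add: row_ct_def)
  moreover have "(s * f) * (V * P / V0) * F = s * (f * (V / V0) * (x * F)) * (P / x)"
    if "x \<noteq> 0" for s f V P V0 F x :: real using that by simp
  ultimately show ?thesis unfolding frobenius_def frobenius_fact_step[OF r rk] n fact_Suc by simp
qed

lemma frobenius_down:
  assumes y: "young_diagram \<mu>" "young_diagram \<nu>"
    and r: "row_len \<nu> = (row_len \<mu>)(r := Suc (row_len \<mu> r))" and rk: "r < k"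
    and n: "sum_list \<nu> = Suc (sum_list \<mu>)"
  shows "real (sum_list \<nu>) * frobenius k \<mu> = frobenius k \<nu> * ((row_ct \<nu> r - 1 + real k) *
    (\<Prod>j\<in>{..<k}-{r}. (row_ct \<nu> r - 1 - row_ct \<nu> j) / (row_ct \<nu> r - row_ct \<nu> j)))"
proof -
  have "vandermonde k (row_ct \<mu>) = vandermonde k (row_ct \<nu>) *
     (\<Prod>j\<in>{..<k}-{r}. (row_ct \<nu> r - 1 - row_ct \<nu> j) / (row_ct \<nu> r - row_ct \<nu> j))"
    by (subst row_ct_step(2)[OF r]) (rule vandermonde_update[OF row_ct_inj[OF y(2)] rk])
  moreover have "row_ct \<mu> r = row_ct \<nu> r - 1" by (simp add: row_ct_def r)
  moreover have "fact (sum_list \<nu>) = (real (sum_list \<nu>)) * fact (sum_list \<mu>)" by (simp add: n)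
  ultimately show ?thesis unfolding frobenius_def frobenius_fact_step[OF r rk]
    by (simp add: mult_ac)
qed

lemma step_row:
  assumes "step \<mu> c \<nu>" "c = int (row_len \<mu> r) - int r"
  shows "row_len \<nu> = (row_len \<mu>)(r := Suc (row_len \<mu> r))"
  using assms row_content_inj[of \<mu>] unfolding step_def by metis

lemma step_row_down:
  assumes "step \<mu> c \<nu>" "c + 1 = int (row_len \<nu> r) - int r"
  shows "row_len \<nu> = (row_len \<mu>)(r := Suc (row_len \<mu> r))"
proof -
  obtain q where q: "c = int (row_len \<mu> q) - int q" "row_len \<nu> =
      (row_len \<mu>)(q := Suc (row_len \<mu> q))"
    using assms(1) by (auto simp: step_def)
  hence "int (row_len \<nu> q) - int q = int (row_len \<nu> r) - int r" using assms(2) by simp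
  hence "q = r" using row_content_inj[OF step_youngD(2)[OF assms(1)]] by metis
  thus ?thesis using q by simp
qed

lemma step_length: assumes "step \<mu> c \<nu>" shows "length \<mu> \<le> length \<nu>"
proof (rule ccontr)
  assume a: "\<not> length \<mu> \<le> length \<nu>"
  obtain r where r: "row_len \<nu> = (row_len \<mu>)(r := Suc (row_len \<mu> r))" using assms
      by (auto simp: step_def)
  have "row_len \<mu> (length \<nu>) > 0" using a row_len_pos_iff[OF step_youngD(1)[OF assms]] by simp
  moreover have "row_len \<nu> (length \<nu>) = 0" by (simp add: row_len_def)
  ultimately show False unfolding r by (simp split: if_splits)
qed

lemma row_len_sum_le: "young_diagram \<mu> \<Longrightarrow> length \<mu> \<le> k \<Longrightarrow>
   (\<Sum>j<k. row_ct \<mu> j) = real (sum_list \<mu>) - real k * (real k - 1) / 2"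
proof -
  assume a: "length \<mu> \<le> k"
  have "(\<Sum>j<k. real j) = real k * (real k - 1) / 2" by (induction k) (auto simp: field_simps)
  thus ?thesis unfolding row_ct_def by (simp add: sum_subtractf sum_row_len[OF a])
qed

text \<open>Both sides satisfy the branching rule. On the right, summing over all \<open>k\<close> rows instead of
  the removable ones adds only zeros, and \<open>hook_identity\<close> evaluates the sum.\<close>

theorem num_tableaux_eq_frobenius:
  assumes "young_diagram \<nu>" "length \<nu> \<le> k"
  shows "real (num_tableaux \<nu>) = frobenius k \<nu>"
  using assms
proof (induction "sum_list \<nu>" arbitrary: \<nu>)
  case 0
  hence "\<nu> = []" using young_sum_0 by simp
  moreover have "vandermonde k (row_ct []) \<noteq> 0" by (intro vandermonde_nonzero row_ct_inj young_Nil)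
  ultimately show ?case by (simp add: num_tableaux_Nil frobenius_def row_len_def)
next
  case (Suc n)
  note y = Suc.prems(1)
  define l where "l j = row_ct \<nu> j + real k - 1" for j
  define A where "A r = l r * (\<Prod>j\<in>{..<k}-{r}. (l r - 1 - l j) / (l r - l j))" for r
  have A: "A r = (row_ct \<nu> r - 1 + real k) *
    (\<Prod>j\<in>{..<k}-{r}. (row_ct \<nu> r - 1 - row_ct \<nu> j) / (row_ct \<nu> r - row_ct \<nu> j))" for r
    by (simp add: A_def l_def algebra_simps)
  define ct where "ct r = int (row_len \<nu> r) - int r - 1" for r
  define R where "R = {r. r < k \<and> ct r \<in> removable \<nu>}"
  have inj: "inj_on ct R" using row_content_inj[OF y] by (auto simp: inj_on_def ct_def)
  have img: "removable \<nu> = ct ` R"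
  proof (rule set_eqI)
    fix c show "c \<in> removable \<nu> \<longleftrightarrow> c \<in> ct ` R"
    proof
      assume c: "c \<in> removable \<nu>"
      then obtain r where r: "r < length \<nu>" "c + 1 = int (row_len \<nu> r) - int r"
          using removable_row by blast
      hence "c = ct r" by (simp add: ct_def)
      thus "c \<in> ct ` R" using c r(1) Suc.prems(2) by (auto simp: R_def)
    qed (auto simp: R_def)
  qed
  \<comment> \<open>Shortening such a row makes its content collide with that of a later row, or the row is the
    empty last one.\<close>
  have zero: "A r = 0" if r: "r < k" "ct r \<notin> removable \<nu>" for r
  proof -
    have "ct r + 1 \<in> maya \<nu>" by (simp add: ct_def maya_def)
    hence "ct r \<in> maya \<nu>" using r by (simp add: removable_def)
    then obtain q where q: "ct r = int (row_len \<nu> q) - int q" by (auto simp: maya_def)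
    have rq: "r < q"
    proof (rule ccontr)
      assume "\<not> r < q"
      thus False using row_len_antimono[OF y, of q r] q by (simp add: ct_def)
    qed
    show ?thesis
    proof (cases "q < k")
      case True
      have "row_ct \<nu> r - 1 - row_ct \<nu> q = 0" using q by (simp add: ct_def row_ct_def)
      hence "(\<Prod>j\<in>{..<k}-{r}. (row_ct \<nu> r - 1 - row_ct \<nu> j) / (row_ct \<nu> r - row_ct \<nu> j)) = 0"
        using True rq by (intro prod_zero) (auto intro!: bexI[of _ q])
      thus ?thesis by (simp add: A)
    next
      case False
      hence "row_len \<nu> q = 0" using Suc.prems(2) by (simp add: row_len_def)
      hence "row_len \<nu> r = 0" "q = k" "r + 1 = k" using q rq r False by (auto simp: ct_def)
      thus ?thesis by (auto simp: A row_ct_def)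
    qed
  qed
  have summand: "real (Suc n) * real (num_tableaux (down \<nu> (ct r))) =
      frobenius k \<nu> * A r" if r: "r \<in> R" for r
  proof -
    have rm: "ct r \<in> removable \<nu>" "r < k" using r by (auto simp: R_def)
    have s: "step (down \<nu> (ct r)) (ct r) \<nu>" by (rule step_down[OF y rm(1)])
    have IH: "real (num_tableaux (down \<nu> (ct r))) = frobenius k (down \<nu> (ct r))"
      using Suc.hyps step_sum[OF s] step_length[OF s] Suc.prems step_youngD[OF s]
          by (intro Suc.hyps) auto
    show ?thesis unfolding IH A
      using frobenius_down[OF step_youngD[OF s] step_row_down[OF s] rm(2) step_sum[OF s]]
          Suc.hyps(2)
      by (simp add: ct_def)
  qed
  have linj: "inj_on l {..<k}" using row_ct_inj[OF y] by (simp add: l_def inj_on_def)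
  have "real (Suc n) * real (num_tableaux \<nu>) = (\<Sum>r\<in>R. real (Suc n) *
      real (num_tableaux (down \<nu> (ct r))))"
    using num_tableaux_branching[OF y] Suc.hyps(2) unfolding img
    by (simp add: sum.reindex[OF inj] sum_distrib_left)
  also have "\<dots> = (\<Sum>r\<in>R. frobenius k \<nu> * A r)" by (intro sum.cong refl summand)
  also have "\<dots> = (\<Sum>r<k. frobenius k \<nu> * A r)"
    by (intro sum.mono_neutral_left) (auto simp: R_def zero)
  also have "\<dots> = frobenius k \<nu> * ((\<Sum>r<k. l r) - real k * (real k - 1) / 2)"
    using hook_identity[OF linj] by (simp add: A_def flip: sum_distrib_left)
  also have "(\<Sum>r<k. l r) = real (sum_list \<nu>) + real k * (real k - 1) / 2"
    using row_len_sum_le[OF y Suc.prems(2)]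
    by (simp add: l_def sum.distrib sum_subtractf field_simps)
  also have "frobenius k \<nu> * (real (sum_list \<nu>) + real k * (real k - 1) / 2 - real k * (real k -
      1) / 2) =
      real (Suc n) * frobenius k \<nu>" unfolding Suc.hyps(2)[symmetric] by simp
  finally show ?case by (simp del: of_nat_Suc)
qed

definition trans_prob :: "nat list \<Rightarrow> int \<Rightarrow> real" where
  "trans_prob \<mu> c = plancherel_transition \<mu> (up \<mu> c)"

lemma trans_prob_step: "step \<mu> c \<nu> \<Longrightarrow> trans_prob \<mu> c = real (num_tableaux \<nu>) / (real (sum_list \<mu> +
    1) * real (num_tableaux \<mu>))"
  unfolding trans_prob_def plancherel_transition_def using adds_box_iff_step step_iff_up by auto

lemma trans_prob_nonneg: "trans_prob \<mu> c \<ge> 0"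
  by (simp add: trans_prob_def plancherel_transition_def)

text \<open>By Frobenius' formula the probability of extending row \<open>r\<close> is a quotient of products over
  the other rows, and it vanishes by itself when the row cannot be extended. With \<open>k\<close> above the
  number of rows, the sum over \<open>r < k\<close> includes the box that starts a new row.\<close>

lemma trans_prob_sum_rows:
  assumes y: "young_diagram \<mu>" and k: "length \<mu> < k"
  shows "(\<Sum>c\<in>addable \<mu>. trans_prob \<mu> c * g (real_of_int c)) =
    (\<Sum>r<k. (\<Prod>j<k-1. row_ct \<mu> r - (row_ct \<mu> j - 1)) / (\<Prod>j\<in>{..<k}-{r}. row_ct \<mu> r -
        row_ct \<mu> j) * g (row_ct \<mu> r))"
    (is "_ = (\<Sum>r<k. ?w r * _)")
proof -
  define ct where "ct r = int (row_len \<mu> r) - int r" for r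
  define R where "R = {r. r < k \<and> ct r \<in> addable \<mu>}"
  have inj: "inj_on ct R" using row_content_inj[OF y] by (auto simp: inj_on_def ct_def)
  have img: "addable \<mu> = ct ` R"
  proof (rule set_eqI)
    fix c show "c \<in> addable \<mu> \<longleftrightarrow> c \<in> ct ` R"
    proof
      assume c: "c \<in> addable \<mu>"
      then obtain r where "r \<le> length \<mu>" "c = int (row_len \<mu> r) - int r" using addable_row by blast
      thus "c \<in> ct ` R" using c k by (auto simp: R_def ct_def image_iff intro!: exI[of _ r])
    qed (auto simp: R_def)
  qed
  \<comment> \<open>A row that cannot be extended has a row \<open>q < r\<close> whose content is larger by one.\<close>
  have zero: "?w r = 0" if r: "r < k" "ct r \<notin> addable \<mu>" for r
  proof -
    have "ct r \<in> maya \<mu>" by (simp add: ct_def maya_def)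
    hence "ct r + 1 \<in> maya \<mu>" using r by (simp add: addable_def)
    then obtain q where q: "ct r + 1 = int (row_len \<mu> q) - int q" by (auto simp: maya_def)
    have rq: "q < r"
    proof (rule ccontr)
      assume "\<not> q < r"
      thus False using row_len_antimono[OF y, of r q] q by (simp add: ct_def)
    qed
    have "row_ct \<mu> r - (row_ct \<mu> q - 1) = 0" using q by (simp add: ct_def row_ct_def)
    hence "(\<Prod>j<k-1. row_ct \<mu> r - (row_ct \<mu> j - 1)) = 0"
      using rq r by (intro prod_zero) (auto intro!: bexI[of _ q])
    thus ?thesis by simp
  qed
  have summand: "trans_prob \<mu> (ct r) = ?w r" if r: "r \<in> R" for r
  proof -
    have ra: "ct r \<in> addable \<mu>" and rk: "r < k" using r by (auto simp: R_def)
    define \<nu> where "\<nu> = up \<mu> (ct r)"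
    have s: "step \<mu> (ct r) \<nu>" unfolding \<nu>_def by (rule step_up[OF y ra])
    have rl: "row_len \<nu> = (row_len \<mu>)(r := Suc (row_len \<mu> r))"
        by (rule step_row[OF s]) (simp add: ct_def)
    have len: "length \<nu> \<le> k"
    proof (rule ccontr)
      assume "\<not> length \<nu> \<le> k"
      hence "row_len \<nu> k > 0" using row_len_pos_iff[OF step_youngD(2)[OF s]] by simp
      thus False using rl rk k by (simp add: row_len_def)
    qed
    have nz: "row_ct \<mu> r + real k \<noteq> 0" using rk by (simp add: row_ct_def)
    \<comment> \<open>The factor \<open>row_ct \<mu> r + k\<close>, which comes from the factorials, is the one of the empty last
      row.\<close>
    have last: "row_ct \<mu> (k - 1) = 1 - real k" using k by (simp add: row_ct_def row_len_def
        of_nat_diff)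
    have "(\<Prod>j<k. row_ct \<mu> r + 1 - row_ct \<mu> j) = (\<Prod>j<k-1. row_ct \<mu> r +
        1 - row_ct \<mu> j) * (row_ct \<mu> r + real k)"
      using k last by (cases k) auto
    moreover have "(\<Prod>j<k. row_ct \<mu> r + 1 - row_ct \<mu> j) = (\<Prod>j\<in>{..<k}-{r}. row_ct \<mu> r +
        1 - row_ct \<mu> j)"
      using rk by (subst prod.remove[of "{..<k}" r]) auto
    ultimately have p: "(\<Prod>j<k-1. row_ct \<mu> r + 1 - row_ct \<mu> j) =
      (\<Prod>j\<in>{..<k}-{r}. row_ct \<mu> r + 1 - row_ct \<mu> j) / (row_ct \<mu> r + real k)"
      using nz by (simp add: field_simps)
    have "trans_prob \<mu> (ct r) = frobenius k \<nu> / (real (sum_list \<mu> + 1) * frobenius k \<mu>)"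
      unfolding trans_prob_step[OF s] using len k by (simp add: num_tableaux_eq_frobenius
          step_youngD[OF s])
    also have "\<dots> = (\<Prod>j\<in>{..<k}-{r}. (row_ct \<mu> r + 1 - row_ct \<mu> j) / (row_ct \<mu> r -
        row_ct \<mu> j)) / (row_ct \<mu> r + real k)"
      unfolding frobenius_up[OF step_youngD[OF s] rl rk step_sum[OF s]]
          using frobenius_nonzero[OF y, of k]
      by simp
    also have "\<dots> = (\<Prod>j<k-1. row_ct \<mu> r + 1 - row_ct \<mu> j) / (\<Prod>j\<in>{..<k}-{r}. row_ct \<mu> r - row_ct \<mu> j)"
      unfolding p by (simp add: prod_dividef)
    finally show ?thesis by (simp add: algebra_simps)
  qed
  have "(\<Sum>c\<in>addable \<mu>. trans_prob \<mu> c * g (real_of_int c)) = (\<Sum>r\<in>R. ?w r * g (row_ct \<mu> r))"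
    unfolding img sum.reindex[OF inj] o_def
    by (intro sum.cong refl) (simp only: summand, simp add: ct_def row_ct_def)
  also have "\<dots> = (\<Sum>r<k. ?w r * g (row_ct \<mu> r))"
    using zero by (intro sum.mono_neutral_left) (auto simp: R_def)
  finally show ?thesis .
qed

definition moment :: "nat list \<Rightarrow> nat \<Rightarrow> real" where
  "moment \<mu> m = (\<Sum>c\<in>addable \<mu>. trans_prob \<mu> c * real_of_int c ^ m)"

text \<open>The generating function of the moments; in \<open>1 / z\<close> it is the Cauchy transform of the
  transition probabilities up to a factor.\<close>

definition gen :: "nat list \<Rightarrow> real fps" where
  "gen \<mu> = Abs_fps (moment \<mu>)"

lemma gen_eq:
  assumes y: "young_diagram \<mu>" and k: "length \<mu> < k"
  shows "gen \<mu> = (\<Prod>j<k-1. lin (row_ct \<mu> j - 1)) * (\<Prod>j<k. geo (row_ct \<mu> j))"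
proof -
  have "gen \<mu> = (\<Sum>i<k. fps_const ((\<Prod>j<k-1. row_ct \<mu> i - (row_ct \<mu> j - 1)) /
      (\<Prod>j\<in>{..<k}-{i}. row_ct \<mu> i - row_ct \<mu> j)) * geo (row_ct \<mu> i))"
    by (rule fps_ext) (simp add: gen_def moment_def fps_sum_nth trans_prob_sum_rows[OF y k, of
        "\<lambda>x. x ^ _"])
  also have "\<dots> = (\<Prod>j<k-1. lin (row_ct \<mu> j - 1)) * (\<Prod>j<k. geo (row_ct \<mu> j))"
    using k by (intro partial_fractions row_ct_inj[OF y]) auto
  finally show ?thesis .
qed

lemma moment_0: assumes y: "young_diagram \<mu>" shows "moment \<mu> 0 = 1"
proof -
  have p: "fps_nth (\<Prod>j<n. f j) 0 = 1" if "\<And>j. fps_nth (f j) 0 = 1" for n and f :: "nat \<Rightarrow> real fps"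
    using that by (induction n) auto
  have "fps_nth (gen \<mu>) 0 = 1" unfolding gen_eq[OF y lessI] by (simp add: p)
  thus ?thesis by (simp add: gen_def)
qed

lemma trans_prob_sum: "young_diagram \<mu> \<Longrightarrow> (\<Sum>c\<in>addable \<mu>. trans_prob \<mu> c) = 1"
  using moment_0 by (simp add: moment_def)

text \<open>In the product formula only the factors of one row change.\<close>

lemma gen_step:
  assumes s: "step \<mu> b \<nu>"
  shows "gen \<nu> = gen \<mu> * (1 + fps_const (1/2) * fps_X * (geo (real_of_int b +
      1) - geo (real_of_int b - 1)))"
proof -
  obtain r where b: "b = int (row_len \<mu> r) - int r" and
    r: "row_len \<nu> = (row_len \<mu>)(r := Suc (row_len \<mu> r))" using s by (auto simp: step_def)
  define \<beta> where "\<beta> = real_of_int b"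
  have \<beta>: "row_ct \<mu> r = \<beta>" "row_ct \<nu> r = \<beta> + 1" using b r by (simp_all add: row_ct_def \<beta>_def)
  have other: "row_ct \<nu> j = row_ct \<mu> j" if "j \<noteq> r" for j using that r by (simp add: row_ct_def)
  \<comment> \<open>Large enough for row \<open>r\<close> to occur in both products of \<open>gen_eq\<close>, for \<open>\<mu>\<close> and for \<open>\<nu>\<close>.\<close>
  define k where "k = length \<mu> + length \<nu> + r + 2"
  have k: "length \<mu> < k" "length \<nu> < k" "r < k - 1" "r < k" by (auto simp: k_def)
  define G where "G = (\<Prod>j\<in>{..<k-1}-{r}. lin (row_ct \<mu> j - 1)) * (\<Prod>j\<in>{..<k}-{r}. geo (row_ct \<mu> j))"
  have rem: "(\<Prod>j<m. f j) = f r * (\<Prod>j\<in>{..<m}-{r}. f j)" if "r < m" for m and f :: "nat \<Rightarrow> real fps"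
    using that by (subst prod.remove[of _ r]) auto
  have g\<mu>: "gen \<mu> = G * (lin (\<beta> - 1) * geo \<beta>)"
    unfolding gen_eq[OF step_youngD(1)[OF s] k(1)] rem[OF k(3)] rem[OF k(4)]
    by (simp only: G_def \<beta> mult_ac)
  have c1: "(\<Prod>j\<in>{..<k-1}-{r}. lin (row_ct \<nu> j - 1)) = (\<Prod>j\<in>{..<k-1}-{r}. lin (row_ct \<mu> j - 1))"
    by (intro prod.cong refl) (simp add: other)
  have c2: "(\<Prod>j\<in>{..<k}-{r}. geo (row_ct \<nu> j)) = (\<Prod>j\<in>{..<k}-{r}. geo (row_ct \<mu> j))"
    by (intro prod.cong refl) (simp add: other)
  have g\<nu>: "gen \<nu> = G * (lin \<beta> * geo (\<beta> + 1))"
    unfolding gen_eq[OF step_youngD(2)[OF s] k(2)] rem[OF k(3)] rem[OF k(4)] c1 c2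
    by (simp only: G_def \<beta> mult_ac add_diff_cancel_right')
  let ?p = "geo (\<beta> + 1)" and ?m = "geo (\<beta> - 1)" and ?P = "lin (\<beta> + 1)" and ?M = "lin (\<beta> - 1)"
  have P: "?P = lin \<beta> - fps_X" "?M = lin \<beta> + fps_X"
    by (rule fps_ext; simp add: algebra_simps split: nat.splits)+
  have gp: "?p * ?P = 1" "?m * ?M = 1" "geo \<beta> * lin \<beta> = 1" by (simp_all only: geo_lin)
  have half: "fps_const (1/2) * 2 = (1 :: real fps)" 
    by (metis fps_const_1_eq_1 fps_const_mult fps_numeral_fps_const mult.commute
        nonzero_mult_div_cancel_left one_neq_zero times_divide_eq_right zero_neq_numeral)
  have "?p - ?m = ?p * (?m * ?M) - ?m * (?p * ?P)" by (simp only: gp mult_1_right)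
  also have "\<dots> = ?p * ?m * (?M - ?P)" by (simp only: right_diff_distrib mult_ac)
  also have "?M - ?P = 2 * fps_X" unfolding P by simp
  finally have "fps_const (1/2) * fps_X * (?p - ?m) = (fps_const (1/2) * 2) * fps_X * (?p * ?m) *
      fps_X"
    by (simp only: mult_ac)
  hence h: "1 + fps_const (1/2) * fps_X * (?p - ?m) = 1 + fps_X * (?p * ?m) * fps_X"
      by (simp only: half mult_1_left)
  have "1 + fps_X * (?p * ?m) * fps_X = (?p * ?P) * (?m * ?M) + fps_X * (?p * ?m) * fps_X"
    by (simp only: gp mult_1_right)
  also have "\<dots> = ?p * ?m * (?P * ?M + fps_X * fps_X)" by (simp only: distrib_left mult_ac)
  also have "?P * ?M + fps_X * fps_X = lin \<beta> * lin \<beta>" unfolding P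
    by (simp only: distrib_left left_diff_distrib) simp
  finally have e: "1 + fps_const (1/2) * fps_X * (?p - ?m) =
      ?p * ?m * (lin \<beta> * lin \<beta>)" using h by simp
  have "gen \<mu> * (1 + fps_const (1/2) * fps_X * (?p - ?m)) =
      G * (?m * ?M) * (geo \<beta> * lin \<beta>) * lin \<beta> * ?p"
    unfolding e g\<mu> by (simp only: mult_ac)
  also have "\<dots> = gen \<nu>" unfolding g\<nu> gp by (simp only: mult_ac mult_1_right)
  finally show ?thesis by (simp add: \<beta>_def)
qed

text \<open>The coefficients of the power series \<open>(geo (x + 1) - geo (x - 1)) / 2\<close> of \<open>gen_step\<close>.\<close>

definition diffpow :: "nat \<Rightarrow> real \<Rightarrow> real" where
  "diffpow i x = ((x + 1) ^ i - (x - 1) ^ i) / 2"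

theorem moment_step:
  assumes s: "step \<mu> b \<nu>"
  shows "moment \<nu> m = moment \<mu> m + (\<Sum>i<m. moment \<mu> (m - 1 - i) * diffpow i (real_of_int b))"
proof -
  define D where "D = fps_const (1/2) * (geo (real_of_int b + 1) - geo (real_of_int b - 1))"
  have D: "fps_nth D i = diffpow i (real_of_int b)" for i
    by (simp add: D_def diffpow_def diff_divide_distrib)
  have "gen \<nu> = gen \<mu> + fps_X * (gen \<mu> * D)"
    unfolding gen_step[OF s] D_def by (simp only: distrib_left mult_1_right mult_1_left mult_ac)
  hence n: "fps_nth (gen \<nu>) m = fps_nth (gen \<mu>) m + (if m =
      0 then 0 else fps_nth (gen \<mu> * D) (m - 1))"
    by simp
  show ?thesis
  proof (cases m)
    case 0 thus ?thesis using n by (simp add: gen_def)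
  next
    case (Suc q)
    have "fps_nth (D * gen \<mu>) q = (\<Sum>i<Suc q. moment \<mu> (q - i) * diffpow i (real_of_int b))"
      unfolding fps_mult_nth D atLeast0AtMost lessThan_Suc_atMost
          by (simp add: gen_def mult.commute)
    thus ?thesis using n Suc by (simp add: gen_def mult.commute)
  qed
qed


section \<open>Adding a box moves a particle\<close>

lemma region_iff: "(x, y) \<in> region \<mu> \<longleftrightarrow>
    (\<exists>i j. (i, j) \<in> boxes \<mu> \<and> real i - 1 \<le> x \<and> x \<le> real i \<and> real j - 1 \<le> y \<and> y \<le> real j)"
  by (force simp: region_def)

text \<open>Near the new box \<open>(i, j)\<close> the old profile is the lower and the new profile the upper half of
  the square, since every other box lies beyond the line through one of its two lower sides.\<close>

lemma profile_added_box:
  assumes s: "step \<mu> c \<nu>" and b: "newbox \<mu> \<nu> = (i, j)" and u: "\<bar>u - real_of_int c\<bar> \<le> 1"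
  shows "profile \<mu> u = real i + real j - 2 + \<bar>u - real_of_int c\<bar>"
    and "profile \<nu> u = real i + real j - \<bar>u - real_of_int c\<bar>"
proof -
  note nb = newbox[OF s b]
  have c: "real_of_int c = real i - real j" using nb(1) by auto
  have ij: "real i \<ge> 1" "real j \<ge> 1" using nb(4,5) by auto
  have le: "z \<le> real i + real j - 2 + \<bar>u - real_of_int c\<bar>"
    if z: "z \<in> insert \<bar>u\<bar> {x + y | x y. (x, y) \<in> region \<mu> \<and> x - y = u}" for z
  proof (cases "z = \<bar>u\<bar>")
    case True thus ?thesis using ij unfolding c by linarith
  next
    case False
    then obtain x y i' j' where xy: "z = x + y" "x - y = u" "(i', j') \<in> boxes \<mu>"
      "real i' - 1 \<le> x" "x \<le> real i'" "real j' - 1 \<le> y" "y \<le> real j'"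
      using z by (auto simp: region_iff)
    have "i' < i \<or> j' < j"
    proof (rule ccontr)
      assume a: "\<not> (i' < i \<or> j' < j)"
      hence "row_len \<mu> (j' - 1) \<le> row_len \<mu> (j - 1)" by (intro row_len_antimono[OF
          step_youngD(1)[OF s]]) auto
      hence "(i, j) \<in> boxes \<mu>" using a xy(3) nb(4,5) by (auto simp: boxes_iff)
      thus False using nb(2) by simp
    qed
    hence "real i' \<le> real i - 1 \<or> real j' \<le> real j - 1" by linarith
    thus ?thesis using xy unfolding c by (elim disjE) linarith+
  qed
  have att: "real i + real j - 2 + \<bar>u - real_of_int c\<bar> \<in> insert \<bar>u\<bar> {x +
      y | x y. (x, y) \<in> region \<mu> \<and> x - y = u}"
  proof (cases "u \<ge> real_of_int c")
    case True
    show ?thesis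
    proof (cases "j = 1")
      case True thus ?thesis using \<open>u \<ge> real_of_int c\<close> ij c by auto
    next
      case False
      have "1 \<le> j - 1" using nb(5) False by linarith
      hence bx: "(i, j - 1) \<in> boxes \<mu>"
        using boxes_below_closed[OF step_youngD(2)[OF s], of i "j - 1"] nb False by auto
      have "(u + (real j - 1), real j - 1) \<in> region \<mu>"
        unfolding region_iff by (rule exI[of _ i], rule exI[of _ "j -
            1"]) (use bx nb(5) u True in \<open>auto simp: c of_nat_diff\<close>)
      moreover have "real i + real j - 2 + \<bar>u - real_of_int c\<bar> =
          (u + (real j - 1)) + (real j - 1)" using True c by auto
      moreover have "(u + (real j - 1)) - (real j - 1) = u" by simp
      ultimately show ?thesis by blast
    qed
  next
    case neg: False
    show ?thesis
    proof (cases "i = 1")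
      case True thus ?thesis using neg ij c by auto
    next
      case False
      have "1 \<le> i - 1" using nb(4) False by linarith
      hence bx: "(i - 1, j) \<in> boxes \<mu>"
        using boxes_left_closed[of "i - 1" j \<nu>] nb False by auto
      have "(real i - 1, real i - 1 - u) \<in> region \<mu>"
        unfolding region_iff by (rule exI[of _ "i - 1"], rule exI[of _ j]) (use bx nb(4) u neg in
            \<open>auto simp: c of_nat_diff\<close>)
      moreover have "real i + real j - 2 + \<bar>u - real_of_int c\<bar> =
          (real i - 1) + (real i - 1 - u)" using neg c by auto
      moreover have "(real i - 1) - (real i - 1 - u) = u" by simp
      ultimately show ?thesis by blast
    qed
  qed
  show "profile \<mu> u = real i + real j - 2 + \<bar>u - real_of_int c\<bar>"
    unfolding profile_def by (rule cSup_eq_maximum[OF att le])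
  have le': "z \<le> real i + real j - \<bar>u - real_of_int c\<bar>"
    if z: "z \<in> insert \<bar>u\<bar> {x + y | x y. (x, y) \<in> region \<nu> \<and> x - y = u}" for z
  proof (cases "z \<in> insert \<bar>u\<bar> {x + y | x y. (x, y) \<in> region \<mu> \<and> x - y = u}")
    case True thus ?thesis using le[OF True] u by linarith
  next
    case False
    then obtain x y i' j' where xy: "z = x + y" "x - y = u" "(i', j') \<in> boxes \<nu>" "(x, y) \<notin> region \<mu>"
      "real i' - 1 \<le> x" "x \<le> real i'" "real j' - 1 \<le> y" "y \<le> real j'"
      using z by (force simp: region_iff)
    hence "(i', j') \<notin> boxes \<mu>" by (auto simp: region_iff)
    hence "i' = i" "j' = j" using xy(3) nb(3) by auto
    thus ?thesis using xy unfolding c by linarith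
  qed
  have att': "real i + real j - \<bar>u - real_of_int c\<bar> \<in> insert \<bar>u\<bar> {x + y | x y. (x, y) \<in> region \<nu> \<and>
      x - y = u}"
  proof (cases "u \<ge> real_of_int c")
    case True
    have "(real i, real i - u) \<in> region \<nu>"
      unfolding region_iff by (rule exI[of _ i], rule exI[of _ j]) (use nb(3) u True in \<open>auto
          simp: c\<close>)
    moreover have "real i + real j - \<bar>u - real_of_int c\<bar> =
        real i + (real i - u)" "real i - (real i - u) = u"
      using True c by auto
    ultimately show ?thesis by blast
  next
    case False
    have "(u + real j, real j) \<in> region \<nu>"
      unfolding region_iff by (rule exI[of _ i], rule exI[of _ j]) (use nb(3) u False in \<open>auto
          simp: c\<close>)
    moreover have "real i + real j - \<bar>u - real_of_int c\<bar> =
        (u + real j) + real j" "(u + real j) - real j = u"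
      using False c by auto
    ultimately show ?thesis by blast
  qed
  show "profile \<nu> u = real i + real j - \<bar>u - real_of_int c\<bar>"
    unfolding profile_def by (rule cSup_eq_maximum[OF att' le'])
qed

text \<open>The new box covers only values \<open>u\<close> at distance at most one from \<open>c\<close>, and at distance one the
  two formulas of \<open>profile_added_box\<close> agree.\<close>

lemma profile_unchanged:
  assumes s: "step \<mu> c \<nu>" and u: "\<bar>u - real_of_int c\<bar> \<ge> 1"
  shows "profile \<nu> u = profile \<mu> u"
proof -
  obtain i j where b: "newbox \<mu> \<nu> = (i, j)" by fastforce
  note nb = newbox[OF s b]
  have c: "real_of_int c = real i - real j" using nb(1) by auto
  show ?thesis
  proof (cases "\<bar>u - real_of_int c\<bar> = 1")
    case True thus ?thesis using profile_added_box[OF s b, of u] by simp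
  next
    case False
    have "(x, y) \<in> region \<nu> \<longleftrightarrow> (x, y) \<in> region \<mu>" if "x - y = u" for x y
    proof
      assume "(x, y) \<in> region \<nu>"
      then obtain i' j' where xy: "(i', j') \<in> boxes \<nu>"
        "real i' - 1 \<le> x" "x \<le> real i'" "real j' - 1 \<le> y" "y \<le> real j'" by (auto simp: region_iff)
      have "(i', j') \<noteq> (i, j)" using xy that u False unfolding c by auto
      hence "(i', j') \<in> boxes \<mu>" using xy nb(3) by auto
      thus "(x, y) \<in> region \<mu>" using xy by (auto simp: region_iff)
    next
      assume "(x, y) \<in> region \<mu>"
      thus "(x, y) \<in> region \<nu>" using nb(3) by (force simp: region_iff)
    qed
    hence "{x + y | x y. (x, y) \<in> region \<nu> \<and> x - y = u} = {x + y | x y. (x, y) \<in> region \<mu> \<and> x - y =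
        u}" by blast
    thus ?thesis by (simp add: profile_def)
  qed
qed

lemma profile_slope_step:
  assumes s: "step \<mu> c \<nu>"
  shows "profile_slope \<mu> c 1" "\<not> profile_slope \<mu> c (-1)" "profile_slope \<nu> c (-1)" "\<not> profile_slope
      \<nu> c 1"
    "profile_slope \<mu> (c - 1) (-1)" "\<not> profile_slope \<mu> (c - 1) 1" "profile_slope \<nu> (c -
        1) 1" "\<not> profile_slope \<nu> (c - 1) (-1)"
    and "q \<noteq> c \<Longrightarrow> q \<noteq> c - 1 \<Longrightarrow> profile_slope \<nu> q d \<longleftrightarrow> profile_slope \<mu> q d"
proof -
  obtain i j where b: "newbox \<mu> \<nu> = (i, j)" by fastforce
  note pm = profile_added_box(1)[OF s b] and pn = profile_added_box(2)[OF s b]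
  let ?c = "real_of_int c"
  show "profile_slope \<mu> c 1" "profile_slope \<nu> c (-1)"
    unfolding profile_slope_def by (auto simp: pm pn)
  have "?c + 1 \<in> {?c..?c + 1}" by simp
  thus "\<not> profile_slope \<mu> c (-1)" "\<not> profile_slope \<nu> c 1"
    unfolding profile_slope_def using pm[of "?c + 1"] pm[of ?c] pn[of "?c + 1"] pn[of ?c]
        by fastforce+
  show "profile_slope \<mu> (c - 1) (-1)" "profile_slope \<nu> (c - 1) 1"
    unfolding profile_slope_def by (auto simp: pm pn)
  have "?c \<in> {real_of_int (c - 1)..real_of_int (c - 1) + 1}" by simp
  thus "\<not> profile_slope \<mu> (c - 1) 1" "\<not> profile_slope \<nu> (c - 1) (-1)"
    unfolding profile_slope_def using pm[of "?c - 1"] pm[of ?c] pn[of "?c - 1"] pn[of ?c]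
        by fastforce+
  assume q: "q \<noteq> c" "q \<noteq> c - 1"
  have "profile \<nu> u = profile \<mu> u" if "u \<in> {real_of_int q..real_of_int q + 1}" for u
  proof (rule profile_unchanged[OF s])
    have "q \<ge> c + 1 \<or> q \<le> c - 2" using q by linarith
    hence "real_of_int q \<ge> ?c + 1 \<or> real_of_int q \<le> ?c - 2" by linarith
    thus "\<bar>u - ?c\<bar> \<ge> 1" using that by auto
  qed
  thus "profile_slope \<nu> q d \<longleftrightarrow> profile_slope \<mu> q d" unfolding profile_slope_def by auto
qed

text \<open>The site \<open>c - 1/2\<close> is the only one that loses its particle, so the jump determines the
  content.\<close>

theorem particle_jumps_iff:
  assumes s: "step \<mu> c \<nu>"
  shows "particle_jumps \<mu> \<nu> x \<longleftrightarrow> x = real_of_int c - 1/2"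
proof
  have P: "real_of_int q + 1/2 \<in> particles \<kappa> \<longleftrightarrow> profile_slope \<kappa> q (-1)" for q \<kappa>
      by (auto simp: particles_def)
  have H: "real_of_int q + 1/2 \<in> holes \<kappa> \<longleftrightarrow> profile_slope \<kappa> q 1" for q \<kappa> by (auto simp: holes_def)
  note sl = profile_slope_step[OF s]
  {
    assume "particle_jumps \<mu> \<nu> x"
    hence x: "x \<in> particles \<mu>" "x \<notin> particles \<nu>" by (auto simp: particle_jumps_def)
    then obtain q where q: "x = real_of_int q + 1/2" "profile_slope \<mu> q (-1)"
        by (auto simp: particles_def)
    have "\<not> profile_slope \<nu> q (-1)" using x(2) q(1) P by simp
    hence "q = c - 1" using q(2) sl(2) sl(9)[of q "-1"] by blast
    thus "x = real_of_int c - 1/2" using q by simp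
  next
    assume x: "x = real_of_int c - 1/2"
    have xe: "x = real_of_int (c - 1) + 1/2" "x + 1 = real_of_int c + 1/2" using x by auto
    have eq: "z \<in> particles \<nu> \<longleftrightarrow> z \<in> insert (x + 1) (particles \<mu> - {x})" 
      "z \<in> holes \<nu> \<longleftrightarrow> z \<in> insert x (holes \<mu> - {x + 1})" for z
    proof -
      have "(z \<in> particles \<nu> \<longleftrightarrow> z \<in> insert (x + 1) (particles \<mu> - {x})) \<and>
         (z \<in> holes \<nu> \<longleftrightarrow> z \<in> insert x (holes \<mu> - {x + 1}))"
      proof (cases "\<exists>q. z = real_of_int q + 1/2")
        case True
        then obtain q where q: "z = real_of_int q + 1/2" by blast
        have "z = x \<longleftrightarrow> q = c - 1" "z = x + 1 \<longleftrightarrow> q = c" unfolding xe q by auto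
        moreover have "z \<in> particles \<kappa> \<longleftrightarrow> profile_slope \<kappa> q (-1)" "z \<in> holes \<kappa> \<longleftrightarrow>
            profile_slope \<kappa> q 1" for \<kappa>
          unfolding q by (rule P, rule H)
        ultimately show ?thesis using sl by (cases "q = c"; cases "q = c - 1") auto
      next
        case False
        hence "z \<noteq> x" "z \<noteq> x + 1" using xe by metis+
        moreover have "z \<notin> particles \<kappa>" "z \<notin> holes \<kappa>" for \<kappa>
          using False by (auto simp: particles_def holes_def)
        ultimately show ?thesis by simp
      qed
      thus "z \<in> particles \<nu> \<longleftrightarrow> z \<in> insert (x + 1) (particles \<mu> - {x})" 
        "z \<in> holes \<nu> \<longleftrightarrow> z \<in> insert x (holes \<mu> - {x + 1})" by auto
    qed
    have "x \<in> particles \<mu>" unfolding xe(1) P by (rule sl(5))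
    moreover have "x + 1 \<in> holes \<mu>" unfolding xe(2) H by (rule sl(1))
    ultimately show "particle_jumps \<mu> \<nu> x" unfolding particle_jumps_def using eq by blast
  }
qed


section \<open>The second-class particle along a path of diagrams\<close>

text \<open>The location of the second-class particle after a box of content \<open>b\<close> has been added.\<close>

definition move :: "int \<Rightarrow> int \<Rightarrow> int" where
  "move X b = (if \<bar>b - X\<bar> = 1 then b else X)"

lemma second_class_particle_cong: "(\<And>k. k \<le> Suc n \<Longrightarrow> p k = q k) \<Longrightarrow> second_class_particle p n =
    second_class_particle q n"
  by (induction n) (simp_all add: Let_def)

lemma second_class_particle_Suc:
  assumes "step (p (Suc n)) b (p (Suc (Suc n)))"
  shows "second_class_particle p (Suc n) = move (second_class_particle p n) b"
proof -
  have e: "real_of_int X + 1 / 2 = real_of_int b - 1 / 2 \<longleftrightarrow> b = X + 1"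
    "real_of_int X - 3 / 2 = real_of_int b - 1 / 2 \<longleftrightarrow> b = X - 1" for X by linarith+
  show ?thesis using assms
    by (auto simp: Let_def particle_jumps_iff e move_def simp del: of_int_add)
qed

lemma removable_one: assumes "step [] c \<nu>" shows "0 \<in> removable \<nu>"
proof -
  have "c = 0" using step_maya(1,2)[OF assms] maya_Nil by auto
  thus ?thesis using step_maya(3)[OF assms] maya_Nil by (auto simp: removable_def)
qed

lemma move_removable:
  assumes "X \<in> removable \<mu>" "step \<mu> b \<nu>" shows "move X b \<in> removable \<nu>"
proof -
  have P: "maya \<nu> = insert (b + 1) (maya \<mu> - {b})" "b \<in> maya \<mu>" "b + 1 \<notin> maya \<mu>"
    using step_maya[OF assms(2)] by auto
  have X: "X \<notin> maya \<mu>" "X + 1 \<in> maya \<mu>" using assms(1) by (auto simp: removable_def)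
  consider "b = X + 1" | "b = X - 1" | "\<bar>b - X\<bar> \<noteq> 1" by linarith
  thus ?thesis
  proof cases
    case 1 thus ?thesis using P X by (auto simp: move_def removable_def)
  next
    case 2
    hence "b + 1 = X" by simp
    thus ?thesis using P X 2 by (auto simp: move_def removable_def)
  next
    case 3
    hence "b \<noteq> X + 1" "b + 1 \<noteq> X" by auto
    thus ?thesis using P X 3 by (auto simp: move_def removable_def)
  qed
qed

text \<open>The pair of a hole and a particle is a removable box, and stays one: when a neighbour is
  added, the neighbour takes over.\<close>

lemma second_class_particle_removable:
  assumes "p 0 = []" "\<And>k. k \<le> n \<Longrightarrow> p k \<nearrow> p (Suc k)"
  shows "second_class_particle p n \<in> removable (p (Suc n))"
  using assms(2)
proof (induction n)
  case 0
  thus ?case using removable_one assms(1) adds_box_iff_step by fastforce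
next
  case (Suc n)
  hence "second_class_particle p n \<in> removable (p (Suc n))" by simp
  moreover obtain b where "step (p (Suc n)) b (p (Suc (Suc n)))"
    using Suc.prems[of "Suc n"] adds_box_iff_step by auto
  ultimately show ?case using move_removable second_class_particle_Suc by metis
qed

definition right_mass :: "nat list \<Rightarrow> int \<Rightarrow> real" where
  "right_mass \<mu> X = (\<Sum>c\<in>addable \<mu>. trans_prob \<mu> c * of_bool (X < c))"

text \<open>The intermediate diagram cancels.\<close>

lemma trans_prob_two_steps:
  assumes "step \<mu> b \<nu>" "step \<nu> c \<kappa>"
  shows "trans_prob \<mu> b * trans_prob \<nu> c = real (num_tableaux \<kappa>) /
    (real (sum_list \<mu> + 1) * real (sum_list \<mu> + 2) * real (num_tableaux \<mu>))"
  using num_tableaux_pos[OF step_youngD(1)[OF assms(2)]]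
  by (simp add: trans_prob_step[OF assms(1)] trans_prob_step[OF assms(2)] step_sum[OF assms(1)]
      add_ac mult_ac)

text \<open>Two boxes \<open>b\<close>, \<open>c\<close> that can be added in either order lead to the same diagram, so both
  orders are equally likely, and together they contribute equally to the events that the first
  box, respectively the second, lies to the right of the particle. Two boxes that cannot be
  exchanged are neighbours and lie on the same side.\<close>

theorem right_mass_harmonic:
  assumes y: "young_diagram \<mu>" and X: "X \<in> removable \<mu>"
  shows "(\<Sum>b\<in>addable \<mu>. trans_prob \<mu> b * right_mass (up \<mu> b) (move X b)) = right_mass \<mu> X"
proof -
  define S where "S = (SIGMA b:addable \<mu>. addable (up \<mu> b))"
  define w where "w = (\<lambda>(b, c). trans_prob \<mu> b * trans_prob (up \<mu> b) c)"
  \<comment> \<open>The difference of the two sides, box by box: exchanging the order of the boxes changes the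
    sign of \<open>h\<close>.\<close>
  define h where "h = (\<lambda>(b, c). w (b, c) * (of_bool (move X b < c) - of_bool (X < b) :: real))"
  have fin: "finite S" unfolding S_def by (intro finite_SigmaI finite_addable)
  have yu: "young_diagram (up \<mu> b)" if "b \<in> addable \<mu>" for b
    using step_up[OF y that] step_youngD by blast
  have XP: "X \<notin> maya \<mu>" "X + 1 \<in> maya \<mu>" using X by (auto simp: removable_def)
  have S_iff: "(b, c) \<in> S \<longleftrightarrow> b \<in> maya \<mu> \<and> b + 1 \<notin> maya \<mu> \<and>
      (c = b + 1 \<or> c \<in> maya \<mu> \<and> c \<noteq> b) \<and> c \<noteq> b \<and> (c + 1 \<notin> maya \<mu> \<or> c + 1 = b)" for b c
  proof (cases "b \<in> addable \<mu>")
    case True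
    thus ?thesis using step_maya(3)[OF step_up[OF y True]] by (auto simp: S_def addable_def)
  next
    case False thus ?thesis by (auto simp: S_def addable_def)
  qed
  have swapw: "w (b, c) = w (c, b)" if bc: "(b, c) \<in> S" "(c, b) \<in> S" for b c
  proof -
    have a: "b \<in> addable \<mu>" "c \<in> addable \<mu>" "c \<in> addable (up \<mu> b)" "b \<in> addable (up \<mu> c)"
      using bc by (auto simp: S_def)
    note s1 = step_up[OF y a(1)] and s2 = step_up[OF y a(2)]
    note s3 = step_up[OF yu[OF a(1)] a(3)] and s4 = step_up[OF yu[OF a(2)] a(4)]
    have ne: "b \<noteq> c" "b \<noteq> c + 1" "c \<noteq> b + 1" using bc S_iff by auto
    have "up (up \<mu> b) c = up (up \<mu> c) b"
    proof (rule maya_inj)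
      show "maya (up (up \<mu> b) c) = maya (up (up \<mu> c) b)"
        using ne by (auto simp: step_maya(3)[OF s1] step_maya(3)[OF s2] step_maya(3)[OF s3]
            step_maya(3)[OF s4])
    qed (use step_youngD s3 s4 in blast)+
    thus ?thesis using trans_prob_two_steps[OF s1 s3] trans_prob_two_steps[OF s2 s4]
        by (simp add: w_def)
  qed
  define S0 where "S0 = {(b, c) \<in> S. (c, b) \<in> S}"
  \<comment> \<open>Boxes that cannot be exchanged form a domino, which lies on one side of the corner \<open>X\<close>.\<close>
  have h0: "h (b, c) = 0" if bc: "(b, c) \<in> S" "(c, b) \<notin> S" for b c
  proof -
    have bP: "b \<in> maya \<mu>" "b + 1 \<notin> maya \<mu>" using bc S_iff by auto
    have 1: "c = b + 1 \<or> c \<in> maya \<mu>" "c \<noteq> b" "c + 1 \<notin> maya \<mu> \<or> c + 1 = b"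
      using bc(1) S_iff[of b c] by blast+
    have 2: "\<not> (c \<in> maya \<mu> \<and> c + 1 \<notin> maya \<mu>)" using bc(2) bP 1(2) S_iff[of c b] by metis
    consider "c = b + 1" | "c + 1 = b" "c \<in> maya \<mu>" using 1 2 by metis
    thus ?thesis
    proof cases
      case 1
      have "c + 1 \<notin> maya \<mu>" using bc(1) 1 S_iff[of b c] by simp
      have "b \<noteq> X - 1"
      proof
        assume "b = X - 1"
        hence "c = X" using 1 by simp
        thus False using \<open>c + 1 \<notin> maya \<mu>\<close> XP by simp
      qed
      moreover have "b \<noteq> X" using bP XP by auto
      ultimately have "move X b < c \<longleftrightarrow> X < b" using 1 by (auto simp: move_def)
      thus ?thesis by (simp add: h_def)
    next
      case 2
      have "c \<noteq> X" "b \<noteq> X" using 2 bP XP by auto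
      hence "b \<noteq> X + 1" using 2 by auto
      hence "move X b < c \<longleftrightarrow> X < b" using 2 \<open>b \<noteq> X\<close> by (auto simp: move_def)
      thus ?thesis by (simp add: h_def)
    qed
  qed
  have hs: "h (c, b) = - h (b, c)" if bc: "(b, c) \<in> S" "(c, b) \<in> S" for b c
  proof -
    have P: "b \<in> maya \<mu>" "c \<in> maya \<mu>" "b \<noteq> c" using bc S_iff by auto
    have "b \<noteq> X" "c \<noteq> X" using P XP by auto
    hence "move X b < c \<longleftrightarrow> X < c" "move X c < b \<longleftrightarrow> X < b" using P(3) by (auto simp: move_def)
    thus ?thesis using swapw[OF bc] by (simp add: h_def algebra_simps)
  qed
  have "sum h S = sum h S0"
    unfolding S0_def using fin h0 by (intro sum.mono_neutral_right) auto
  moreover have "sum h S0 = sum (\<lambda>s. - h s) S0"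
  proof (rule sum.reindex_bij_witness[where i = prod.swap and j = prod.swap])
    fix s assume "s \<in> S0"
    then obtain b c where s: "s = (b, c)" and bc: "(b, c) \<in> S" "(c, b) \<in> S" by (auto simp: S0_def)
    show "- h (prod.swap s) = h s" using hs[OF bc] by (simp add: s)
  qed (auto simp: S0_def)
  ultimately have "sum h S = 0" unfolding sum_negf by linarith
  have "(\<Sum>b\<in>addable \<mu>. trans_prob \<mu> b * right_mass (up \<mu> b) (move X b)) =
      (\<Sum>(b, c)\<in>S. w (b, c) * of_bool (move X b < c))"
    unfolding S_def w_def prod.case right_mass_def sum_distrib_left mult.assoc
    by (rule sum.Sigma) (auto simp: finite_addable)
  also have "\<dots> = (\<Sum>(b, c)\<in>S. w (b, c) * of_bool (X < b))"
  proof -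
    have "(\<Sum>(b, c)\<in>S. w (b, c) * of_bool (move X b < c)) - (\<Sum>(b, c)\<in>S. w (b, c) * of_bool (X < b)) =
        sum h S"
      unfolding sum_subtractf[symmetric] h_def by (intro sum.cong refl) (auto simp:
          right_diff_distrib)
    thus ?thesis using \<open>sum h S = 0\<close> by simp
  qed
  also have "\<dots> = (\<Sum>b\<in>addable \<mu>. \<Sum>c\<in>addable (up \<mu> b). trans_prob \<mu> b * trans_prob (up \<mu> b) c *
      of_bool (X < b))"
    unfolding S_def w_def prod.case by (rule sum.Sigma[symmetric]) (auto simp: finite_addable)
  also have "\<dots> = (\<Sum>b\<in>addable \<mu>. trans_prob \<mu> b * of_bool (X < b))"
  proof (intro sum.cong refl)
    fix b assume b: "b \<in> addable \<mu>"
    have "(\<Sum>c\<in>addable (up \<mu> b). trans_prob \<mu> b * trans_prob (up \<mu> b) c * of_bool (X < b)) =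
      trans_prob \<mu> b * of_bool (X < b) * (\<Sum>c\<in>addable (up \<mu> b). trans_prob (up \<mu> b) c)"
      by (simp add: sum_distrib_left mult_ac)
    thus "(\<Sum>c\<in>addable (up \<mu> b). trans_prob \<mu> b * trans_prob (up \<mu> b) c * of_bool (X < b)) =
        trans_prob \<mu> b * of_bool (X < b)"
      using trans_prob_sum[OF yu[OF b]] by simp
  qed
  finally show ?thesis by (simp add: right_mass_def)
qed

text \<open>The local rule of jeu de taquin. Let the last box of \<open>\<nu>\<close> have content \<open>b\<close> and take the
  particle from \<open>X\<close> to \<open>d\<close>, where \<open>d = X\<close> unless the boxes are neighbours. Removing \<open>b\<close> and then
  \<open>X\<close> leaves what remains after removing \<open>d\<close> and one further box \<open>x\<close>, and each removable \<open>x\<close>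
  arises exactly once.\<close>

theorem slide_preimages:
  assumes y: "young_diagram \<nu>" and d: "d \<in> removable \<nu>"
  shows "(\<Sum>(b, X)\<in>{(b, X). b \<in> removable \<nu> \<and> X \<in> removable (down \<nu> b) \<and> move X b = d}.
      g (down (down \<nu> b) X)) = (\<Sum>x\<in>removable (down \<nu> d). g (down (down \<nu> d) x) :: real)"
proof -
  have m: "maya (down \<nu> b) = insert b (maya \<nu> - {b + 1})" "young_diagram (down \<nu> b)"
      if "b \<in> removable \<nu>" for b
    using step_maya_down(3)[OF step_down[OF y that]] step_youngD(1)[OF step_down[OF y that]] by auto
  have dP: "d \<notin> maya \<nu>" "d + 1 \<in> maya \<nu>" using d by (auto simp: removable_def)
  have comm: "down (down \<nu> b) c = down (down \<nu> c) b"
    if bc: "b \<in> removable \<nu>" "c \<in> removable \<nu>" "b \<in> removable (down \<nu> c)" "c \<in> removable (down \<nu>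
        b)" for b c
  proof (rule maya_inj)
    note s1 = step_down[OF m(2)[OF bc(2)] bc(3)] and s2 = step_down[OF m(2)[OF bc(1)] bc(4)]
    have "b \<noteq> c" using bc(1,3) m(1)[OF bc(2)] by (auto simp: removable_def)
    moreover have "b \<noteq> c + 1" "c \<noteq> b + 1" using bc(1,2) by (auto simp: removable_def)
    ultimately show "maya (down (down \<nu> b) c) = maya (down (down \<nu> c) b)"
      unfolding step_maya_down(3)[OF s1] step_maya_down(3)[OF s2] m(1)[OF bc(1)] m(1)[OF bc(2)]
          by auto
    show "young_diagram (down (down \<nu> b) c)" "young_diagram (down (down \<nu> c) b)"
      using s1 s2 step_youngD by blast+
  qed
  show ?thesis
  \<comment> \<open>If \<open>x\<close> is removable only after \<open>d\<close>, the pair has just jumped from \<open>x\<close> to \<open>d\<close>; otherwise it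
    rested at \<open>d\<close>.\<close>
  proof (rule sum.reindex_bij_witness[where
        i = "\<lambda>x. if \<bar>x - d\<bar> = 1 then (d, x) else (x, d)" and
        j = "\<lambda>(b, X). if b = d then X else b"])
    fix s assume "s \<in> {(b, X). b \<in> removable \<nu> \<and> X \<in> removable (down \<nu> b) \<and> move X b = d}"
    then obtain b X where s: "s = (b, X)" and b: "b \<in> removable \<nu>" and X: "X \<in> removable (down \<nu> b)"
      and mv: "move X b = d" by auto
    have bP: "b \<notin> maya \<nu>" "b + 1 \<in> maya \<nu>" using b by (auto simp: removable_def)
    have XP: "X \<notin> maya (down \<nu> b)" "X + 1 \<in> maya (down \<nu> b)" using X by (auto simp: removable_def)
    show "(case s of (b, X) \<Rightarrow> if b = d then X else b) \<in> removable (down \<nu> d)"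
      "(if \<bar>(case s of (b, X) \<Rightarrow> if b = d then X else b) - d\<bar> = 1 then (d, case s of (b, X) \<Rightarrow> if b =
          d then X else b)
       else (case s of (b, X) \<Rightarrow> if b = d then X else b, d)) = s"
      "g (down (down \<nu> d) (case s of (b, X) \<Rightarrow> if b = d then X else b)) =
          (case s of (b, X) \<Rightarrow> g (down (down \<nu> b) X))"
    proof -
      have *: "(if b = d then X else b) \<in> removable (down \<nu> d) \<and>
        (if \<bar>(if b = d then X else b) - d\<bar> = 1 then (d, if b = d then X else b) else (if b =
            d then X else b, d)) = (b, X) \<and>
        down (down \<nu> d) (if b = d then X else b) = down (down \<nu> b) X"
      proof (cases "b = d")
        case True
        have "X \<noteq> b" using XP m(1)[OF b] by auto
        hence "\<bar>X - d\<bar> = 1" using mv True by (auto simp: move_def split: if_splits)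
        thus ?thesis using True X by auto
      next
        case False
        hence Xd: "X = d" using mv by (auto simp: move_def split: if_splits)
        have ne: "b \<noteq> d + 1" "d \<noteq> b + 1" using bP dP by auto
        have bd: "b \<in> removable (down \<nu> d)" using bP ne False m(1)[OF d]
            by (auto simp: removable_def)
        thus ?thesis using False Xd ne comm[OF d b X[unfolded Xd] bd] by auto
      qed
      show "(case s of (b, X) \<Rightarrow> if b = d then X else b) \<in> removable (down \<nu> d)"
        unfolding s prod.case by (rule conjunct1[OF *])
      show "(if \<bar>(case s of (b, X) \<Rightarrow> if b = d then X else b) - d\<bar> =
          1 then (d, case s of (b, X) \<Rightarrow> if b = d then X else b)
         else (case s of (b, X) \<Rightarrow> if b = d then X else b, d)) = s"
        unfolding s prod.case by (rule conjunct1[OF conjunct2[OF *]])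
      show "g (down (down \<nu> d) (case s of (b, X) \<Rightarrow> if b = d then X else b)) =
          (case s of (b, X) \<Rightarrow> g (down (down \<nu> b) X))"
        unfolding s prod.case by (rule arg_cong[OF conjunct2[OF conjunct2[OF *]]])
    qed
  next
    fix x assume x: "x \<in> removable (down \<nu> d)"
    have xP: "x \<notin> maya (down \<nu> d)" "x + 1 \<in> maya (down \<nu> d)" using x by (auto simp: removable_def)
    have xd: "x \<noteq> d" using xP m(1)[OF d] by auto
    show "(case (if \<bar>x - d\<bar> = 1 then (d, x) else (x, d)) of (b, X) \<Rightarrow> if b = d then X else b) = x"
      using xd by auto
    show "(if \<bar>x - d\<bar> = 1 then (d, x) else (x, d)) \<in> {(b, X). b \<in> removable \<nu> \<and>
        X \<in> removable (down \<nu> b) \<and> move X b = d}"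
    proof (cases "\<bar>x - d\<bar> = 1")
      case True
      thus ?thesis using x d by (auto simp: move_def)
    next
      case False
      hence ne: "x \<noteq> d + 1" "x + 1 \<noteq> d" by auto
      have xr: "x \<in> removable \<nu>" using xP ne xd m(1)[OF d] by (auto simp: removable_def)
      have "d \<in> removable (down \<nu> x)" using dP ne xd m(1)[OF xr] by (auto simp: removable_def)
      thus ?thesis using False xr by (auto simp: move_def)
    qed
  qed
qed


section \<open>Histories of the growth process and a martingale convergence theorem\<close>

definition paths :: "nat \<Rightarrow> nat list list set" where
  "paths n = {h. length h = Suc n \<and> h ! 0 = [] \<and> (\<forall>k<n. h ! k \<nearrow> h ! Suc k)}"

lemma paths_0: "paths 0 = {[[]]}"
  by (auto simp: paths_def length_Suc_conv)

lemma paths_young: assumes "h \<in> paths n" shows "young_diagram (last h)"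
proof (cases n)
  case 0 thus ?thesis using assms by (simp add: paths_0 young_Nil)
next
  case (Suc m)
  have "h \<noteq> []" "length h = Suc (Suc m)" using assms Suc by (auto simp: paths_def)
  hence "last h = h ! Suc m" by (simp add: last_conv_nth)
  moreover have "h ! m \<nearrow> h ! Suc m" using assms Suc by (auto simp: paths_def)
  ultimately show ?thesis using adds_box_def by simp
qed

lemma paths_last: "h \<in> paths n \<Longrightarrow> last h = h ! n"
  by (auto simp: paths_def last_conv_nth simp flip: length_greater_0_conv)

lemma bij_paths_Suc:
  "bij_betw (\<lambda>(h, c). h @ [up (last h) c]) (SIGMA h:paths n. addable (last h)) (paths (Suc n))"
proof (rule bij_betw_imageI)
  show "inj_on (\<lambda>(h, c). h @ [up (last h) c]) (SIGMA h:paths n. addable (last h))"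
  proof (rule inj_onI)
    fix x y assume x: "x \<in> (SIGMA h:paths n. addable (last h))"
        and y: "y \<in> (SIGMA h:paths n. addable (last h))"
      and eq: "(\<lambda>(h, c). h @ [up (last h) c]) x = (\<lambda>(h, c). h @ [up (last h) c]) y"
    obtain h c h' c' where xy: "x = (h, c)" "y = (h', c')" by fastforce
    have h: "h = h'" "up (last h) c = up (last h) c'" using eq by (auto simp: xy)
    moreover have "step (last h) c (up (last h) c)" "step (last h) c' (up (last h) c')"
      using x y h(1) paths_young by (auto simp: xy intro!: step_up)
    ultimately show "x = y" using step_unique_content xy by metis
  qed
  show "(\<lambda>(h, c). h @ [up (last h) c]) ` (SIGMA h:paths n. addable (last h)) = paths (Suc n)"
  proof safe
    fix h c assume h: "h \<in> paths n" and c: "c \<in> addable (last h)"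
    have "last h \<nearrow> up (last h) c" using step_up[OF paths_young[OF h] c] adds_box_iff_step by blast
    thus "h @ [up (last h) c] \<in> paths (Suc n)"
      using h paths_last[OF h] by (auto simp: paths_def nth_append less_Suc_eq)
  next
    fix g assume g: "g \<in> paths (Suc n)"
    define h where "h = butlast g"
    have len: "length g = Suc (Suc n)" using g by (simp add: paths_def)
    have gh: "g = h @ [g ! Suc n]" using len
      by (metis append_butlast_last_id h_def last_conv_nth length_0_conv nat.distinct(1) diff_Suc_1)
    have nth: "h ! k = g ! k" if "k \<le> n" for k using that len by (simp add: h_def nth_butlast)
    have h: "h \<in> paths n" using g len nth by (auto simp: paths_def h_def[symmetric]) (auto simp:
        h_def)
    have "last h \<nearrow> g ! Suc n" using g nth[of n] paths_last[OF h] by (auto simp: paths_def)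
    then obtain c where "step (last h) c (g ! Suc n)" using adds_box_iff_step by blast
    hence "c \<in> addable (last h)" "g ! Suc n = up (last h) c" using step_iff_up by auto
    thus "g \<in> (\<lambda>(h, c). h @ [up (last h) c]) ` (SIGMA h:paths n. addable (last h))"
      using h gh by (auto intro!: image_eqI[of _ _ "(h, c)"])
  qed
qed

lemma finite_paths: "finite (paths n)"
proof (induction n)
  case (Suc n)
  hence "finite (SIGMA h:paths n. addable (last h))" by (intro finite_SigmaI finite_addable)
  thus ?case using bij_betw_finite[OF bij_paths_Suc] by blast
qed (simp add: paths_0)

lemma sum_paths_Suc:
  "(\<Sum>g\<in>paths (Suc n). F g) = (\<Sum>h\<in>paths n. \<Sum>c\<in>addable (last h). F (h @ [up (last h) c]) :: real)"
proof -
  have "(\<Sum>h\<in>paths n. \<Sum>c\<in>addable (last h). F (h @ [up (last h) c])) =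
    (\<Sum>(h, c)\<in>(SIGMA h:paths n. addable (last h)). F (h @ [up (last h) c]))"
    by (rule sum.Sigma) (auto simp: finite_paths finite_addable)
  also have "\<dots> = (\<Sum>g\<in>paths (Suc n). F g)"
    using sum.reindex_bij_betw[OF bij_paths_Suc, of F] by (simp add: case_prod_beta')
  finally show ?thesis by simp
qed

context plancherel_growth_process
begin

definition hist :: "nat \<Rightarrow> 'a \<Rightarrow> nat list list" where
  "hist n \<omega> = map (\<lambda>k. \<Lambda> k \<omega>) [0..<Suc n]"

lemma length_hist [simp]: "length (hist n \<omega>) = Suc n" by (simp add: hist_def)

lemma nth_hist [simp]: "k \<le> n \<Longrightarrow> hist n \<omega> ! k = \<Lambda> k \<omega>" by (simp add: hist_def del: upt_Suc)

lemma hist_Suc: "hist (Suc n) \<omega> = hist n \<omega> @ [\<Lambda> (Suc n) \<omega>]" by (simp add: hist_def)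

lemma take_hist: "m \<le> n \<Longrightarrow> take (Suc m) (hist n \<omega>) = hist m \<omega>"
  by (simp add: hist_def take_map del: upt_Suc)

lemma hist_eq_iff: "hist n \<omega> = h \<longleftrightarrow> length h = Suc n \<and> (\<forall>k\<le>n. \<Lambda> k \<omega> = h ! k)"
  by (auto simp: list_eq_iff_nth_eq less_Suc_eq_le)

lemma Lambda_sets: "{\<omega> \<in> space M. \<Lambda> k \<omega> = x} \<in> sets M"
proof -
  have "\<Lambda> k -` {x} \<inter> space M \<in> sets M" using random_diagram by (rule measurable_sets) simp
  moreover have "\<Lambda> k -` {x} \<inter> space M = {\<omega> \<in> space M. \<Lambda> k \<omega> = x}" by auto
  ultimately show ?thesis by simp
qed

lemma hist_sets: "{\<omega> \<in> space M. hist n \<omega> = h} \<in> sets M"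
proof (cases "length h = Suc n")
  case True
  have "{\<omega> \<in> space M. \<forall>k\<in>{..n}. \<Lambda> k \<omega> = h ! k} \<in> sets M"
    by (rule sets.sets_Collect_finite_All') (auto intro: Lambda_sets)
  moreover have "{\<omega> \<in> space M. hist n \<omega> = h} = {\<omega> \<in> space M. \<forall>k\<in>{..n}. \<Lambda> k \<omega> = h ! k}"
    using True unfolding hist_eq_iff by blast
  ultimately show ?thesis by argo
next
  case False
  hence "{\<omega> \<in> space M. hist n \<omega> = h} = {}" unfolding hist_eq_iff by blast
  thus ?thesis by (simp only: sets.empty_sets)
qed

lemma measurable_hist: "hist n \<in> measurable M (count_space UNIV)"
proof -
  have "hist n -` {h} \<inter> space M \<in> sets M" for h
  proof -
    have "hist n -` {h} \<inter> space M = {\<omega> \<in> space M. hist n \<omega> = h}" by auto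
    thus ?thesis using hist_sets by simp
  qed
  thus ?thesis by (subst measurable_count_space_eq_countable) auto
qed

lemma borel_hist [measurable]: "(\<lambda>\<omega>. f (hist n \<omega>) :: real) \<in> borel_measurable M"
  by (rule measurable_compose[OF measurable_hist]) simp

definition hist_prob :: "nat list list \<Rightarrow> real" where
  "hist_prob h = prob {\<omega> \<in> space M. hist (length h - 1) \<omega> = h}"

text \<open>The transition hypothesis, extended to histories of probability zero.\<close>

lemma hist_prob_Suc_aux:
  assumes "length h = Suc n"
  shows "prob {\<omega> \<in> space M. hist n \<omega> = h \<and> \<Lambda> (Suc n) \<omega> = \<nu>} =
      hist_prob h * plancherel_transition (h ! n) \<nu>"
proof -
  have e: "{\<omega> \<in> space M. \<forall>k\<le>n. \<Lambda> k \<omega> = h ! k} = {\<omega> \<in> space M. hist n \<omega> = h}"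
    using assms by (auto simp: hist_eq_iff)
  show ?thesis
  proof (cases "hist_prob h = 0")
    case True
    have "prob {\<omega> \<in> space M. hist n \<omega> = h \<and> \<Lambda> (Suc n) \<omega> = \<nu>} \<le> hist_prob h"
      unfolding hist_prob_def using assms hist_sets by (auto intro!: finite_measure_mono)
    thus ?thesis using True by (simp add: measure_le_0_iff)
  next
    case False
    hence "hist_prob h > 0" by (simp add: hist_prob_def zero_less_measure_iff)
    hence "cond_prob M (\<lambda>\<omega>. \<Lambda> (Suc n) \<omega> = \<nu>) (\<lambda>\<omega>. \<forall>k\<le>n. \<Lambda> k \<omega> = h ! k) =
        plancherel_transition (h ! n) \<nu>"
      using transition[of n "\<lambda>k. h ! k" \<nu>] e assms by (simp add: hist_prob_def)
    moreover have "{\<omega> \<in> space M. \<Lambda> (Suc n) \<omega> = \<nu> \<and> (\<forall>k\<le>n. \<Lambda> k \<omega> = h ! k)} =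
       {\<omega> \<in> space M. hist n \<omega> = h \<and> \<Lambda> (Suc n) \<omega> = \<nu>}" using assms by (auto simp: hist_eq_iff)
    ultimately have "prob {\<omega> \<in> space M. hist n \<omega> = h \<and> \<Lambda> (Suc n) \<omega> = \<nu>} / hist_prob h =
        plancherel_transition (h ! n) \<nu>"
      using assms by (simp add: cond_prob_def e hist_prob_def)
    thus ?thesis using False by (simp add: field_simps)
  qed
qed

lemma hist_prob_Suc:
  assumes h: "h \<in> paths n" and c: "c \<in> addable (last h)"
  shows "hist_prob (h @ [up (last h) c]) = hist_prob h * trans_prob (last h) c"
proof -
  have len: "length h = Suc n" using h by (simp add: paths_def)
  have "{\<omega> \<in> space M. hist (Suc n) \<omega> = h @ [up (last h) c]} =
     {\<omega> \<in> space M. hist n \<omega> = h \<and> \<Lambda> (Suc n) \<omega> = up (last h) c}" by (auto simp: hist_Suc)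
  thus ?thesis using hist_prob_Suc_aux[OF len, of "up (last h) c"] len
    by (simp add: hist_prob_def trans_prob_def paths_last[OF h])
qed

lemma AE_growth: "AE \<omega> in M. \<Lambda> n \<omega> \<nearrow> \<Lambda> (Suc n) \<omega>"
proof -
  have "AE \<omega> in M. \<not> (hist n \<omega> = fst x \<and> \<Lambda> (Suc n) \<omega> = snd x \<and> \<not> fst x ! n \<nearrow> snd x)" for x
  proof (cases "length (fst x) = Suc n \<and> \<not> fst x ! n \<nearrow> snd x")
    case True
    have "prob {\<omega> \<in> space M. hist n \<omega> = fst x \<and> \<Lambda> (Suc n) \<omega> = snd x} = 0"
      using True by (subst hist_prob_Suc_aux) (auto simp: plancherel_transition_def)
    moreover have "{\<omega> \<in> space M. hist n \<omega> = fst x \<and> \<Lambda> (Suc n) \<omega> = snd x} \<in> sets M"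
      by (intro sets.sets_Collect_conj hist_sets Lambda_sets)
    ultimately have "AE \<omega> in M. \<not> (hist n \<omega> = fst x \<and> \<Lambda> (Suc n) \<omega> = snd x)"
      by (subst AE_iff_measurable[OF _ refl]) (auto simp: emeasure_eq_measure)
    thus ?thesis by eventually_elim auto
  next
    case False
    thus ?thesis by (auto simp: hist_eq_iff)
  qed
  hence "AE \<omega> in M. \<forall>x. \<not> (hist n \<omega> = fst x \<and> \<Lambda> (Suc n) \<omega> = snd x \<and> \<not> fst x ! n \<nearrow> snd x)"
    by (subst AE_all_countable) blast
  thus ?thesis
  proof eventually_elim
    case (elim \<omega>)
    from elim[rule_format, of "(hist n \<omega>, \<Lambda> (Suc n) \<omega>)"] show ?case by simp
  qed
qed

lemma AE_paths: "AE \<omega> in M. \<forall>n. hist n \<omega> \<in> paths n"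
proof -
  have "AE \<omega> in M. \<forall>n. \<Lambda> n \<omega> \<nearrow> \<Lambda> (Suc n) \<omega>" by (subst AE_all_countable) (use AE_growth in blast)
  thus ?thesis using start by eventually_elim (auto simp: paths_def)
qed

text \<open>Almost surely the history takes one of finitely many values, so every function of it is
  integrable.\<close>

lemma expectation_hist:
  fixes f :: "nat list list \<Rightarrow> real"
  shows "integrable M (\<lambda>\<omega>. f (hist n \<omega>))"
    and "expectation (\<lambda>\<omega>. f (hist n \<omega>)) = (\<Sum>h\<in>paths n. hist_prob h * f h)"
proof -
  let ?g = "\<lambda>\<omega>. \<Sum>h\<in>paths n. f h * indicat_real {\<omega> \<in> space M. hist n \<omega> = h} \<omega>"
  have ae: "AE \<omega> in M. ?g \<omega> = f (hist n \<omega>)"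
    using AE_paths AE_space
  proof eventually_elim
    case (elim \<omega>)
    have "?g \<omega> = (\<Sum>h\<in>paths n. if h = hist n \<omega> then f h else 0)"
      using elim by (intro sum.cong refl) auto
    thus ?case using elim finite_paths by simp
  qed
  have ig: "integrable M ?g"
    by (intro Bochner_Integration.integrable_sum integrable_mult_right integrable_indicator)
      (auto simp: hist_sets emeasure_eq_measure)
  show "integrable M (\<lambda>\<omega>. f (hist n \<omega>))"
    by (rule integrable_cong_AE_imp[OF ig borel_hist]) (use ae in eventually_elim, simp)
  have "expectation (\<lambda>\<omega>. f (hist n \<omega>)) = expectation ?g"
  proof (rule integral_cong_AE[OF borel_hist])
    show "?g \<in> borel_measurable M" using ig by (rule borel_measurable_integrable)
    show "AE \<omega> in M. f (hist n \<omega>) = ?g \<omega>" using ae by eventually_elim simp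
  qed
  also have "\<dots> = (\<Sum>h\<in>paths n. f h * prob {\<omega> \<in> space M. hist n \<omega> = h})"
  proof -
    have sp: "{\<omega> \<in> space M. hist n \<omega> = h} \<inter> space M = {\<omega> \<in> space M. hist n \<omega> = h}" for h by auto
    show ?thesis by (subst Bochner_Integration.integral_sum) (auto simp: hist_sets
        emeasure_eq_measure sp)
  qed
  also have "\<dots> = (\<Sum>h\<in>paths n. hist_prob h * f h)"
    by (intro sum.cong refl) (auto simp: hist_prob_def paths_def)
  finally show "expectation (\<lambda>\<omega>. f (hist n \<omega>)) = (\<Sum>h\<in>paths n. hist_prob h * f h)" .
qed

lemma hist_prob_nonneg: "hist_prob h \<ge> 0" by (simp add: hist_prob_def)

text \<open>One step of the tower property.\<close>

lemma expectation_hist_Suc: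
  fixes f :: "nat list list \<Rightarrow> real"
  shows "expectation (\<lambda>\<omega>. f (hist (Suc n) \<omega>)) =
    expectation (\<lambda>\<omega>. \<Sum>c\<in>addable (last (hist n \<omega>)). trans_prob (last (hist n \<omega>)) c *
        f (hist n \<omega> @ [up (last (hist n \<omega>)) c]))"
  unfolding expectation_hist(2) expectation_hist(2)[where n = n and
      f = "\<lambda>h. \<Sum>c\<in>addable (last h). trans_prob (last h) c * f (h @ [up (last h) c])"] sum_paths_Suc
  by (intro sum.cong refl) (auto simp: sum_distrib_left hist_prob_Suc mult.assoc)

text \<open>The increment \<open>d (Suc n)\<close>, a function of the history, has mean zero given the history up to
  time \<open>n\<close>.\<close>

definition martingale_increments :: "(nat \<Rightarrow> nat list list \<Rightarrow> real) \<Rightarrow> bool" where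
  "martingale_increments d \<longleftrightarrow> (\<forall>n. \<forall>h\<in>paths n.
     (\<Sum>c\<in>addable (last h). trans_prob (last h) c * d (Suc n) (h @ [up (last h) c])) = 0)"

lemma martingale_orthogonal:
  assumes "martingale_increments d"
  shows "expectation (\<lambda>\<omega>. g (hist n \<omega>) * d (Suc n) (hist (Suc n) \<omega>)) = 0"
proof -
  have e: "g (hist n \<omega>) = g (butlast (hist (Suc n) \<omega>))" for \<omega> by (simp add: hist_Suc)
  have "expectation (\<lambda>\<omega>. g (hist n \<omega>) * d (Suc n) (hist (Suc n) \<omega>)) =
     (\<Sum>h\<in>paths n. hist_prob h * (\<Sum>c\<in>addable (last h). trans_prob (last h) c * (g h *
         d (Suc n) (h @ [up (last h) c]))))"
    unfolding e expectation_hist(2)[where n = "Suc n" and f =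
        "\<lambda>h. g (butlast h) * d (Suc n) h"] sum_paths_Suc
    by (intro sum.cong refl) (auto simp: sum_distrib_left hist_prob_Suc mult.assoc)
  also have "\<dots> = 0"
  proof (intro sum.neutral ballI)
    fix h assume h: "h \<in> paths n"
    have "(\<Sum>c\<in>addable (last h). trans_prob (last h) c * (g h * d (Suc n) (h @ [up (last h) c]))) =
       g h * (\<Sum>c\<in>addable (last h). trans_prob (last h) c * d (Suc n) (h @ [up (last h) c]))"
      by (simp add: sum_distrib_left mult_ac)
    thus "hist_prob h * (\<Sum>c\<in>addable (last h). trans_prob (last h) c * (g h *
        d (Suc n) (h @ [up (last h) c]))) = 0"
      using assms h by (simp add: martingale_increments_def)
  qed
  finally show ?thesis .
qed

definition incr :: "(nat \<Rightarrow> nat list list \<Rightarrow> real) \<Rightarrow> nat \<Rightarrow> 'a \<Rightarrow> real" where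
  "incr d k \<omega> = d (Suc k) (hist (Suc k) \<omega>)"

lemma incr_measurable [measurable]: "incr d k \<in> borel_measurable M"
  unfolding incr_def by simp

text \<open>Kolmogorov's inequality: the increments are orthogonal, also after stopping.\<close>

lemma maximal_inequality:
  assumes d: "martingale_increments d" and eps: "\<epsilon> > 0"
  shows "prob {\<omega> \<in> space M. \<exists>n\<in>{m..N}. \<bar>\<Sum>k\<in>{m..<n}. incr d k \<omega>\<bar> \<ge> \<epsilon>}
    \<le> (\<Sum>k\<in>{m..<N}. expectation (\<lambda>\<omega>. (incr d k \<omega>)\<^sup>2)) / \<epsilon>\<^sup>2"
proof -
  \<comment> \<open>\<open>C k = 1\<close> as long as the level \<open>\<epsilon>\<close> has not been reached; then \<open>S\<close> is the sum stopped at that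
    time.\<close>
  define c where "c k h = (if \<forall>n\<in>{m..k}. \<bar>\<Sum>j\<in>{m..<n}. d (Suc j) (take (Suc (Suc j)) h)\<bar> <
      \<epsilon> then 1 else 0 :: real)" for k h
  define C where "C k \<omega> = c k (hist k \<omega>)" for k \<omega>
  have C: "C k \<omega> = (if \<forall>n\<in>{m..k}. \<bar>\<Sum>j\<in>{m..<n}. incr d j \<omega>\<bar> < \<epsilon> then 1 else 0)" for k \<omega>
  proof -
    have "(\<Sum>j\<in>{m..<n}. d (Suc j) (take (Suc (Suc j)) (hist k \<omega>))) =
        (\<Sum>j\<in>{m..<n}. incr d j \<omega>)" if "n \<le> k" for n
      using that by (intro sum.cong refl) (simp add: incr_def take_hist)
    thus ?thesis unfolding C_def c_def by auto
  qed
  define S where "S n \<omega> = (\<Sum>k\<in>{m..<n}. C k \<omega> * incr d k \<omega>)" for n \<omega>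
  define s where "s n h = (\<Sum>k\<in>{m..<n}. c k (take (Suc k) h) *
      d (Suc k) (take (Suc (Suc k)) h))" for n h
  have S: "S n \<omega> = s n (hist n \<omega>)" for n \<omega>
    unfolding S_def s_def by (intro sum.cong refl) (simp add: C_def incr_def take_hist)
  have E: "expectation (\<lambda>\<omega>. (S n \<omega>)\<^sup>2) \<le> (\<Sum>k\<in>{m..<n}. expectation (\<lambda>\<omega>. (incr d k \<omega>)\<^sup>2))" for n
  proof (induction n)
    case (Suc n)
    show ?case
    proof (cases "m \<le> n")
      case True
      have "(S (Suc n) \<omega>)\<^sup>2 = (S n \<omega>)\<^sup>2 + 2 * (s n (hist n \<omega>) * c n (hist n \<omega>)) *
          d (Suc n) (hist (Suc n) \<omega>) +
         (C n \<omega> * incr d n \<omega>)\<^sup>2" for \<omega>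
        using True by (simp add: S_def power2_sum S[symmetric, unfolded S_def] C_def incr_def
            mult_ac)
      hence "expectation (\<lambda>\<omega>. (S (Suc n) \<omega>)\<^sup>2) = expectation (\<lambda>\<omega>. (S n \<omega>)\<^sup>2 +
         2 * (s n (hist n \<omega>) * c n (hist n \<omega>)) * d (Suc n) (hist (Suc n) \<omega>) +
             (C n \<omega> * incr d n \<omega>)\<^sup>2)"
        by presburger
      also have "\<dots> = expectation (\<lambda>\<omega>. (S n \<omega>)\<^sup>2) + expectation (\<lambda>\<omega>. 2 * (s n (hist n \<omega>) *
          c n (hist n \<omega>)) * d (Suc n) (hist (Suc n) \<omega>))
         + expectation (\<lambda>\<omega>. (C n \<omega> * incr d n \<omega>)\<^sup>2)"
      proof -
        have i1: "integrable M (\<lambda>\<omega>. (S n \<omega>)\<^sup>2)"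
          unfolding S by (rule expectation_hist(1)[of "\<lambda>h. (s n h)\<^sup>2"])
        have i2: "integrable M (\<lambda>\<omega>. 2 * (s n (hist n \<omega>) * c n (hist n \<omega>)) *
            d (Suc n) (hist (Suc n) \<omega>))"
          using expectation_hist(1)[of "\<lambda>h. 2 * (s n (butlast h) * c n (butlast h)) *
              d (Suc n) h" "Suc n"]
          by (simp add: hist_Suc)
        have i3: "integrable M (\<lambda>\<omega>. (C n \<omega> * incr d n \<omega>)\<^sup>2)"
          using expectation_hist(1)[of "\<lambda>h. (c n (butlast h) * d (Suc n) h)\<^sup>2" "Suc n"]
          by (simp add: hist_Suc C_def incr_def)
        show ?thesis using i1 i2 i3 by simp
      qed
      also have "expectation (\<lambda>\<omega>. 2 * (s n (hist n \<omega>) * c n (hist n \<omega>)) *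
          d (Suc n) (hist (Suc n) \<omega>)) = 0"
        by (rule martingale_orthogonal[OF d, of "\<lambda>h. 2 * (s n h * c n h)"])
      also have "expectation (\<lambda>\<omega>. (C n \<omega> * incr d n \<omega>)\<^sup>2) \<le> expectation (\<lambda>\<omega>. (incr d n \<omega>)\<^sup>2)"
      proof (rule integral_mono)
        show "integrable M (\<lambda>\<omega>. (C n \<omega> * incr d n \<omega>)\<^sup>2)"
          using expectation_hist(1)[of "\<lambda>h. (c n (butlast h) * d (Suc n) h)\<^sup>2" "Suc n"]
          by (simp add: hist_Suc C_def incr_def)
        show "integrable M (\<lambda>\<omega>. (incr d n \<omega>)\<^sup>2)"
          unfolding incr_def by (rule expectation_hist(1)[of "\<lambda>h. (d (Suc n) h)\<^sup>2"])
      qed (auto simp: C)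
      finally show ?thesis using Suc True by simp
    next
      case False thus ?thesis by (simp add: S_def)
    qed
  qed (simp add: S_def)
  have sub: "{\<omega> \<in> space M. \<exists>n\<in>{m..N}. \<bar>\<Sum>k\<in>{m..<n}. incr d k \<omega>\<bar> \<ge> \<epsilon>} \<subseteq> {\<omega> \<in> space M. (S N \<omega>)\<^sup>2 \<ge>
      \<epsilon>\<^sup>2}"
  proof safe
    fix \<omega> n assume n: "n \<in> {m..N}" "\<bar>\<Sum>k\<in>{m..<n}. incr d k \<omega>\<bar> \<ge> \<epsilon>"
    define P where "P n \<longleftrightarrow> m \<le> n \<and> \<bar>\<Sum>k\<in>{m..<n}. incr d k \<omega>\<bar> \<ge> \<epsilon>" for n
    \<comment> \<open>The sum is stopped at the first time at which it reaches the level.\<close>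
    define T where "T = (LEAST n. P n)"
    have PT: "P T" unfolding T_def using n by (intro LeastI[of P n]) (auto simp: P_def)
    have TN: "T \<le> N" using Least_le[of P n] n by (auto simp: T_def P_def)
    have notP: "\<not> P k" if "k < T" for k using not_less_Least that unfolding T_def by blast
    have C1: "C k \<omega> = 1" if "k < T" for k
    proof -
      have "\<bar>\<Sum>j\<in>{m..<n}. incr d j \<omega>\<bar> < \<epsilon>" if "n \<in> {m..k}" for n
        using notP[of n] that \<open>k < T\<close> by (simp add: P_def not_le)
      thus ?thesis by (simp add: C)
    qed
    have C0: "C k \<omega> = 0" if "T \<le> k" for k
    proof -
      have "T \<in> {m..k}" "\<not> \<bar>\<Sum>j\<in>{m..<T}. incr d j \<omega>\<bar> < \<epsilon>" using PT that by (auto simp: P_def)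
      hence "\<not> (\<forall>n\<in>{m..k}. \<bar>\<Sum>j\<in>{m..<n}. incr d j \<omega>\<bar> < \<epsilon>)" by blast
      thus ?thesis unfolding C by simp
    qed
    have "S N \<omega> = (\<Sum>k\<in>{m..<T}. C k \<omega> * incr d k \<omega>)"
      unfolding S_def using TN C0 by (intro sum.mono_neutral_right) auto
    also have "\<dots> = (\<Sum>k\<in>{m..<T}. incr d k \<omega>)" by (intro sum.cong refl) (simp add: C1)
    finally have "\<bar>S N \<omega>\<bar> \<ge> \<epsilon>" using PT by (simp add: P_def)
    thus "(S N \<omega>)\<^sup>2 \<ge> \<epsilon>\<^sup>2" using eps by (metis abs_le_square_iff abs_of_pos)
  qed
  have iS: "integrable M (\<lambda>\<omega>. (S N \<omega>)\<^sup>2)"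
    unfolding S by (rule expectation_hist(1)[of "\<lambda>h. (s N h)\<^sup>2"])
  have "prob {\<omega> \<in> space M. \<exists>n\<in>{m..N}. \<bar>\<Sum>k\<in>{m..<n}. incr d k \<omega>\<bar> \<ge> \<epsilon>} \<le>
      prob {\<omega> \<in> space M. (S N \<omega>)\<^sup>2 \<ge> \<epsilon>\<^sup>2}"
  proof (rule finite_measure_mono[OF sub])
    have [measurable]: "(\<lambda>\<omega>. (S N \<omega>)\<^sup>2) \<in> borel_measurable M" using iS
        by (rule borel_measurable_integrable)
    show "{\<omega> \<in> space M. (S N \<omega>)\<^sup>2 \<ge> \<epsilon>\<^sup>2} \<in> sets M" by measurable
  qed
  also have "\<dots> \<le> expectation (\<lambda>\<omega>. (S N \<omega>)\<^sup>2) / \<epsilon>\<^sup>2"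
    using integral_Markov_inequality_measure[OF iS, where A = "{}" and c = "\<epsilon>\<^sup>2"] eps by simp
  also have "\<dots> \<le> (\<Sum>k\<in>{m..<N}. expectation (\<lambda>\<omega>. (incr d k \<omega>)\<^sup>2)) / \<epsilon>\<^sup>2"
    by (intro divide_right_mono E) simp
  finally show ?thesis .
qed

text \<open>By the maximal inequality the tails of the sum oscillate by less than any \<open>\<epsilon>\<close>, so the
  partial sums are Cauchy.\<close>

theorem martingale_convergence:
  assumes d: "martingale_increments d" and sm: "summable (\<lambda>k. expectation (\<lambda>\<omega>. (incr d k \<omega>)\<^sup>2))"
  shows "AE \<omega> in M. convergent (\<lambda>n. \<Sum>k<n. incr d k \<omega>)"
proof -
  define v where "v k = expectation (\<lambda>\<omega>. (incr d k \<omega>)\<^sup>2)" for k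
  have v: "v k \<ge> 0" for k unfolding v_def by simp
  have smv: "summable v" using sm unfolding v_def .
  have tail: "(\<Sum>k\<in>{m..<N}. v k) \<le> (\<Sum>i. v (i + m))" for m N
  proof -
    have "(\<Sum>k\<in>{m..<N}. v k) = (\<Sum>i\<in>{..<N-m}. v (i + m))"
      by (rule sum.reindex_bij_witness[where i = "\<lambda>i. i + m" and j = "\<lambda>k. k - m"]) auto
    also have "\<dots> \<le> (\<Sum>i. v (i + m))"
      using smv v by (intro sum_le_suminf) (auto simp: summable_iff_shift)
    finally show ?thesis .
  qed
  have A: "AE \<omega> in M. \<exists>m. \<forall>n\<ge>m. \<bar>\<Sum>k\<in>{m..<n}. incr d k \<omega>\<bar> < \<epsilon>" if eps: "\<epsilon> > 0" for \<epsilon>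
  proof -
    define BN where "BN m N = {\<omega> \<in> space M. \<exists>n\<in>{m..N}. \<bar>\<Sum>k\<in>{m..<n}. incr d k \<omega>\<bar> \<ge> \<epsilon>}" for m N
    define B where "B m = (\<Union>N. BN m N)" for m
    have BNs: "BN m N \<in> sets M" for m N unfolding BN_def by measurable
    have Bs: "B m \<in> sets M" for m unfolding B_def using BNs by auto
    have le: "prob (B m) \<le> (\<Sum>i. v (i + m)) / \<epsilon>\<^sup>2" for m
    proof (rule LIMSEQ_le_const2)
      show "(\<lambda>N. prob (BN m N)) \<longlonglongrightarrow> prob (B m)"
        unfolding B_def using BNs by (intro finite_Lim_measure_incseq) (auto simp: incseq_def
            BN_def)
      have "prob (BN m N) \<le> (\<Sum>i. v (i + m)) / \<epsilon>\<^sup>2" for N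
      proof -
        have "prob (BN m N) \<le> (\<Sum>k\<in>{m..<N}. v k) / \<epsilon>\<^sup>2"
          unfolding BN_def v_def by (rule maximal_inequality[OF d eps])
        also have "\<dots> \<le> (\<Sum>i. v (i + m)) / \<epsilon>\<^sup>2" using tail by (intro divide_right_mono) auto
        finally show ?thesis .
      qed
      thus "\<exists>N. \<forall>n\<ge>N. prob (BN m n) \<le> (\<Sum>i. v (i + m)) / \<epsilon>\<^sup>2" by blast
    qed
    have Is: "(\<Inter>m. B m) \<in> sets M" using Bs by auto
    have "prob (\<Inter>m. B m) \<le> r" if r: "r > 0" for r
    proof -
      obtain m where m: "norm (\<Sum>i. v (i + m)) < r * \<epsilon>\<^sup>2"
        using suminf_exist_split[OF _ smv, of "r * \<epsilon>\<^sup>2"] r eps by auto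
      have "prob (\<Inter>m. B m) \<le> prob (B m)" by (rule finite_measure_mono[OF _ Bs]) auto
      also have "\<dots> \<le> (\<Sum>i. v (i + m)) / \<epsilon>\<^sup>2" by (rule le)
      also have "\<dots> \<le> r" using m eps by (simp add: pos_divide_le_eq)
      finally show ?thesis .
    qed
    hence "prob (\<Inter>m. B m) \<le> 0" by (metis field_le_epsilon add_0)
    hence "prob (\<Inter>m. B m) = 0" by (simp add: measure_le_0_iff)
    hence "AE \<omega> in M. \<omega> \<notin> (\<Inter>m. B m)"
      using Is by (intro AE_not_in) (auto simp: null_sets_def emeasure_eq_measure)
    thus ?thesis using AE_space
    proof eventually_elim
      case (elim \<omega>)
      then obtain m where "\<omega> \<notin> B m" by auto
      hence "\<bar>\<Sum>k\<in>{m..<n}. incr d k \<omega>\<bar> < \<epsilon>" if "n \<ge> m" for n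
        using elim that by (force simp: B_def BN_def)
      thus ?case by blast
    qed
  qed
  have "AE \<omega> in M. \<forall>q. \<exists>m. \<forall>n\<ge>m. \<bar>\<Sum>k\<in>{m..<n}. incr d k \<omega>\<bar> < inverse (real (Suc q))"
    by (subst AE_all_countable) (auto intro!: A)
  thus ?thesis
  proof eventually_elim
    case (elim \<omega>)
    show ?case
    proof (rule Cauchy_convergent, rule metric_CauchyI)
      fix e :: real assume e: "e > 0"
      obtain q where q: "inverse (real (Suc q)) < e / 2" using reals_Archimedean[of "e / 2"] e
          by auto
      obtain m where m: "\<And>n. n \<ge> m \<Longrightarrow> \<bar>\<Sum>k\<in>{m..<n}. incr d k \<omega>\<bar> < inverse (real (Suc q))"
        using elim by blast
      have s: "(\<Sum>k<n. incr d k \<omega>) = (\<Sum>k<m. incr d k \<omega>) + (\<Sum>k\<in>{m..<n}. incr d k \<omega>)" if "n \<ge> m" for n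
        using sum.atLeastLessThan_concat[of 0 m n "\<lambda>k. incr d k \<omega>"] that
            by (simp add: atLeast0LessThan)
      show "\<exists>m. \<forall>n\<ge>m. \<forall>n'\<ge>m. dist (\<Sum>k<n. incr d k \<omega>) (\<Sum>k<n'. incr d k \<omega>) < e"
      proof (intro exI allI impI)
        fix n n' assume n: "m \<le> n" "m \<le> n'"
        show "dist (\<Sum>k<n. incr d k \<omega>) (\<Sum>k<n'. incr d k \<omega>) < e"
          using m[OF n(1)] m[OF n(2)] q s[OF n(1)] s[OF n(2)] unfolding dist_real_def by linarith
      qed
    qed
  qed
qed

end


section \<open>A deterministic recursion for rescaled moments\<close>

lemma stolz_cesaro:
  fixes a b :: "nat \<Rightarrow> real"
  assumes inc: "\<And>n. b n < b (Suc n)" and top: "filterlim b at_top sequentially"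
    and lim: "(\<lambda>n. (a (Suc n) - a n) / (b (Suc n) - b n)) \<longlonglongrightarrow> L"
  shows "(\<lambda>n. a n / b n) \<longlonglongrightarrow> L"
proof -
  define c where "c n = a n - L * b n" for n
  have "(\<lambda>n. c n / b n) \<longlonglongrightarrow> 0"
  proof (rule LIMSEQ_I)
    fix r :: real assume r: "r > 0"
    obtain N where N: "\<And>n. n \<ge> N \<Longrightarrow> \<bar>(a (Suc n) - a n) / (b (Suc n) - b n) - L\<bar> < r / 2"
      using LIMSEQ_D[OF lim, of "r / 2"] r by auto
    have d: "\<bar>c (Suc n) - c n\<bar> \<le> r / 2 * (b (Suc n) - b n)" if "n \<ge> N" for n
    proof -
      have p: "b (Suc n) - b n > 0" using inc[of n] by simp
      have "c (Suc n) - c n = ((a (Suc n) - a n) / (b (Suc n) - b n) - L) * (b (Suc n) - b n)"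
        using p by (simp add: c_def field_simps)
      hence "\<bar>c (Suc n) - c n\<bar> = \<bar>(a (Suc n) - a n) / (b (Suc n) - b n) - L\<bar> * (b (Suc n) - b n)"
        using p by (simp add: abs_mult)
      also have "\<dots> \<le> r / 2 * (b (Suc n) - b n)" using N[OF that] p by (intro mult_right_mono) auto
      finally show ?thesis .
    qed
    have c: "\<bar>c n - c N\<bar> \<le> r / 2 * (b n - b N)" if "n \<ge> N" for n
      using that
    proof (induction n rule: dec_induct)
      case (step n)
      have "\<bar>c (Suc n) - c N\<bar> \<le> \<bar>c (Suc n) - c n\<bar> + \<bar>c n - c N\<bar>" by linarith
      also have "\<dots> \<le> r / 2 * (b (Suc n) - b n) + r / 2 * (b n - b N)" using step d[OF step(1)]
          by linarith
      also have "\<dots> = r / 2 * (b (Suc n) - b N)" by (simp flip: distrib_left)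
      finally show ?case .
    qed simp
    \<comment> \<open>Beyond \<open>K\<close> the constant part of the bound for \<open>c n\<close> is below \<open>r / 2 * b n\<close>.\<close>
    define K where "K = 1 + 2 * (\<bar>c N\<bar> + r / 2 * \<bar>b N\<bar>) / r"
    have "eventually (\<lambda>n. b n > K \<and> n \<ge> N) sequentially"
      using top eventually_ge_at_top by (auto simp: filterlim_at_top_dense intro: eventually_conj)
    then obtain N' where N': "\<And>n. n \<ge> N' \<Longrightarrow> b n > K \<and> n \<ge> N" by (auto simp: eventually_sequentially)
    show "\<exists>no. \<forall>n\<ge>no. norm (c n / b n - 0) < r"
    proof (intro exI allI impI)
      fix n assume "N' \<le> n"
      hence n: "b n > K" "n \<ge> N" using N' by auto
      have "K > 0" using r unfolding K_def by (intro add_pos_nonneg divide_nonneg_pos) auto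
      hence bp: "b n > 0" using n by linarith
      have "\<bar>c n\<bar> \<le> \<bar>c N\<bar> + r / 2 * (b n - b N)" using c[OF n(2)] by linarith
      also have "\<dots> \<le> (\<bar>c N\<bar> + r / 2 * \<bar>b N\<bar>) + r / 2 * b n"
      proof -
        have "r / 2 * (- b N) \<le> r / 2 * \<bar>b N\<bar>" using r by (intro mult_left_mono) auto
        thus ?thesis by (simp add: algebra_simps)
      qed
      also have "\<bar>c N\<bar> + r / 2 * \<bar>b N\<bar> < r / 2 * b n"
      proof -
        have "2 * (\<bar>c N\<bar> + r / 2 * \<bar>b N\<bar>) / r < b n" using n(1) by (simp add: K_def)
        thus ?thesis using r by (simp add: field_simps)
      qed
      finally have "\<bar>c n\<bar> < r * b n" by simp
      thus "norm (c n / b n - 0) < r" using bp by (simp add: field_simps)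
    qed
  qed
  hence l: "(\<lambda>n. c n / b n + L) \<longlonglongrightarrow> 0 + L" by (intro tendsto_intros)
  have "eventually (\<lambda>n. b n > 0) sequentially" using top by (auto simp: filterlim_at_top_dense)
  hence "eventually (\<lambda>n. c n / b n + L = a n / b n) sequentially"
    by eventually_elim (simp add: c_def field_simps)
  from Lim_transform_eventually[OF l this] show ?thesis by simp
qed

lemma kronecker_lemma:
  fixes b y :: "nat \<Rightarrow> real"
  assumes inc: "\<And>n. b n < b (Suc n)" and top: "filterlim b at_top sequentially"
    and conv: "convergent (\<lambda>n. \<Sum>k<n. y k)"
  shows "(\<lambda>n. (\<Sum>k<n. b (Suc k) * y k) / b n) \<longlonglongrightarrow> 0"
proof -
  define T where "T n = (\<Sum>k<n. y k)" for n
  obtain t where t: "T \<longlonglongrightarrow> t" using conv unfolding convergent_def T_def by blast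
  define s where "s n = (\<Sum>k<n. (b (Suc k) - b k) * T k)" for n
  have "(\<lambda>n. s n / b n) \<longlonglongrightarrow> t"
  proof (rule stolz_cesaro[OF inc top])
    have "(s (Suc n) - s n) / (b (Suc n) - b n) = T n" for n using inc[of n] by (simp add: s_def)
    thus "(\<lambda>n. (s (Suc n) - s n) / (b (Suc n) - b n)) \<longlonglongrightarrow> t" using t by simp
  qed
  hence l: "(\<lambda>n. T n - s n / b n) \<longlonglongrightarrow> t - t" using t by (intro tendsto_intros)
  \<comment> \<open>Summation by parts.\<close>
  have parts: "(\<Sum>k<n. b (Suc k) * y k) = b n * T n - s n" for n
    by (induction n) (simp_all add: T_def s_def algebra_simps)
  have "eventually (\<lambda>n. b n > 0) sequentially" using top by (auto simp: filterlim_at_top_dense)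
  hence "eventually (\<lambda>n. T n - s n / b n = (\<Sum>k<n. b (Suc k) * y k) / b n) sequentially"
    unfolding parts by eventually_elim (simp add: field_simps)
  from Lim_transform_eventually[OF l this] show ?thesis by simp
qed

text \<open>The growth of the normalising constants in \<open>moment_limit\<close>, against which the drift is
  compared.\<close>

lemma sqrt_power_quotient:
  assumes m: "m \<ge> 2"
  shows "(\<lambda>n. (sqrt (real (Suc n)) ^ m - sqrt (real n) ^ m) / sqrt (real n) ^ (m - 2)) \<longlonglongrightarrow> real m / 2"
proof -
  define u where "u n = sqrt (real (Suc n)) / sqrt (real n)" for n
  have u1: "u \<longlonglongrightarrow> 1"
  proof -
    have "(\<lambda>n. sqrt (real (Suc n) / real n)) \<longlonglongrightarrow> sqrt 1"
      by (intro tendsto_intros LIMSEQ_Suc_n_over_n)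
    thus ?thesis by (simp add: u_def[abs_def] real_sqrt_divide)
  qed
  have l: "(\<lambda>n. 1 / (u n + 1) * (\<Sum>i<m. u n ^ i)) \<longlonglongrightarrow> 1 / (1 + 1) * (\<Sum>i<m. 1 ^ i)"
    by (intro tendsto_intros u1) simp
  have "eventually (\<lambda>n. 1 / (u n + 1) * (\<Sum>i<m. u n ^ i) =
     (sqrt (real (Suc n)) ^ m - sqrt (real n) ^ m) / sqrt (real n) ^ (m - 2)) sequentially"
    using eventually_gt_at_top[of 0]
  proof eventually_elim
    case (elim n)
    define v where "v = sqrt (real n)"
    have v: "v > 0" using elim by (simp add: v_def)
    have up: "u n > 0" using elim by (simp add: u_def)
    have w: "sqrt (real (Suc n)) = u n * v" using v by (simp add: u_def v_def)
    have "(u n * v)\<^sup>2 = v\<^sup>2 + 1" unfolding w[symmetric] by (simp add: v_def)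
    hence uv: "(u n - 1) * (u n + 1) * v\<^sup>2 = 1" by (simp add: power2_eq_square algebra_simps)
    have vm: "v ^ m = v ^ (m - 2) * v\<^sup>2" by (metis le_add_diff_inverse2 m power_add)
    have "(u n * v) ^ m - v ^ m = v ^ m * (u n ^ m - 1)"
        by (simp add: power_mult_distrib algebra_simps)
    also have "u n ^ m - 1 = (u n - 1) * (\<Sum>i<m. u n ^ i)" by (rule power_diff_1_eq)
    also have "v ^ m * \<dots> = v ^ (m - 2) * (((u n - 1) * (u n + 1) * v\<^sup>2) * (1 / (u n +
        1) * (\<Sum>i<m. u n ^ i)))"
      unfolding vm using up by simp
    finally have "(u n * v) ^ m - v ^ m = v ^ (m - 2) * (1 / (u n + 1) * (\<Sum>i<m. u n ^ i))"
      unfolding uv by simp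
    thus ?case unfolding w v_def[symmetric] using v by simp
  qed
  from Lim_transform_eventually[OF l this] show ?thesis by simp
qed

text \<open>The moments of the semicircle law, as the solution of the Catalan recursion.\<close>

fun catalan_moment :: "nat \<Rightarrow> real" where
  "catalan_moment 0 = 1"
| "catalan_moment (Suc 0) = 0"
| "catalan_moment (Suc (Suc k)) = (\<Sum>i\<le>k. catalan_moment i * catalan_moment (k - i))"

text \<open>Averaging the sum with its reversal replaces the weight by a constant.\<close>

lemma catalan_moment_weighted:
  "(\<Sum>a\<le>k. (real a + 1) * (catalan_moment (k - a) * catalan_moment a)) =
      real (k + 2) / 2 * catalan_moment (k + 2)"
proof -
  let ?S = "\<Sum>a\<le>k. (real a + 1) * (catalan_moment (k - a) * catalan_moment a)"
  have "?S = (\<Sum>a\<le>k. (real (k - a) + 1) * (catalan_moment (k - a) * catalan_moment a))"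
    by (rule sum.reindex_bij_witness[where i = "\<lambda>a. k - a" and j = "\<lambda>a. k - a"]) auto
  hence "2 * ?S = (\<Sum>a\<le>k. (real a + 1) * (catalan_moment (k - a) * catalan_moment a) +
      (real (k - a) + 1) * (catalan_moment (k - a) * catalan_moment a))"
    by (simp add: sum.distrib)
  also have "\<dots> = (\<Sum>a\<le>k. real (k + 2) * (catalan_moment a * catalan_moment (k - a)))"
    by (intro sum.cong refl) (auto simp: of_nat_diff algebra_simps)
  also have "\<dots> = real (k + 2) * catalan_moment (k + 2)" by (simp add: sum_distrib_left)
  finally show ?thesis by simp
qed

definition dcoeff :: "nat \<Rightarrow> nat \<Rightarrow> real" where
  "dcoeff i q = real (i choose q) * (1 - (-1) ^ (i - q)) / 2"

lemma diffpow_expand: "diffpow i x = (\<Sum>q<i. dcoeff i q * x ^ q)"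
proof -
  have "diffpow i x = ((x + 1) ^ i - (x + (-1)) ^ i) / 2" by (simp add: diffpow_def)
  also have "\<dots> = (\<Sum>q\<le>i. dcoeff i q * x ^ q)"
    unfolding binomial_ring sum_subtractf[symmetric] sum_divide_distrib dcoeff_def
    by (intro sum.cong refl) (simp add: field_simps)
  also have "\<dots> = (\<Sum>q<i. dcoeff i q * x ^ q)"
    by (simp add: lessThan_Suc_atMost[symmetric] dcoeff_def)
  finally show ?thesis .
qed

lemma dcoeff_top: "dcoeff (Suc a) a = real a + 1"
  by (simp add: dcoeff_def)

text \<open>The mean change of the \<open>m\<close>-th moment when a box is added.\<close>

definition drift :: "nat list \<Rightarrow> nat \<Rightarrow> real" where
  "drift \<mu> m = (\<Sum>i<m. moment \<mu> (m - 1 - i) * (\<Sum>c\<in>addable \<mu>. trans_prob \<mu> c *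
      diffpow i (real_of_int c)))"

lemma drift_expand: "drift \<mu> m = (\<Sum>i<m. \<Sum>q<i. dcoeff i q * moment \<mu> (m - 1 - i) * moment \<mu> q)"
proof -
  have "(\<Sum>c\<in>addable \<mu>. trans_prob \<mu> c * diffpow i (real_of_int c)) =
      (\<Sum>q<i. dcoeff i q * moment \<mu> q)" for i
    unfolding diffpow_expand moment_def sum_distrib_left by (subst sum.swap) (simp add: mult_ac)
  thus ?thesis unfolding drift_def by (simp add: sum_distrib_left mult_ac)
qed

lemma mean_moment_step:
  assumes y: "young_diagram \<mu>"
  shows "(\<Sum>c\<in>addable \<mu>. trans_prob \<mu> c * moment (up \<mu> c) m) = moment \<mu> m + drift \<mu> m"
proof -
  have "(\<Sum>c\<in>addable \<mu>. trans_prob \<mu> c * moment (up \<mu> c) m) =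
    (\<Sum>c\<in>addable \<mu>. trans_prob \<mu> c * (moment \<mu> m + (\<Sum>i<m. moment \<mu> (m - 1 -
        i) * diffpow i (real_of_int c))))"
    by (intro sum.cong refl) (simp add: moment_step[OF step_up[OF y]])
  also have "\<dots> = moment \<mu> m * (\<Sum>c\<in>addable \<mu>. trans_prob \<mu> c) +
      (\<Sum>c\<in>addable \<mu>. \<Sum>i<m. moment \<mu> (m - 1 - i) * (trans_prob \<mu> c * diffpow i (real_of_int c)))"
    by (simp add: distrib_left sum.distrib sum_distrib_left mult_ac)
  also have "(\<Sum>c\<in>addable \<mu>. \<Sum>i<m. moment \<mu> (m - 1 - i) * (trans_prob \<mu> c *
      diffpow i (real_of_int c))) = drift \<mu> m"
    unfolding drift_def sum_distrib_left by (rule sum.swap)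
  finally show ?thesis by (simp add: trans_prob_sum[OF y])
qed

text \<open>The lower moments determine the drift of the next one.\<close>

lemma drift_limit:
  assumes m: "m \<ge> 2"
    and lim: "\<And>q. q < m \<Longrightarrow> (\<lambda>n. moment (l n) q / sqrt (real n) ^ q) \<longlonglongrightarrow> catalan_moment q"
  shows "(\<lambda>n. drift (l n) m / sqrt (real n) ^ (m - 2)) \<longlonglongrightarrow> real m / 2 * catalan_moment m"
proof -
  define s where "s n = 1 / sqrt (real n)" for n
  have s0: "s \<longlonglongrightarrow> 0"
  proof -
    have "(\<lambda>n. sqrt (1 / real n)) \<longlonglongrightarrow> sqrt 0" by (intro tendsto_real_sqrt lim_1_over_n)
    thus ?thesis by (simp add: s_def[abs_def] real_sqrt_divide)
  qed
  have sp: "(\<lambda>n. s n ^ j) \<longlonglongrightarrow> (if j = 0 then 1 else 0)" for j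
    using tendsto_power[OF s0, of j] by (cases j) auto
  let ?F = "\<lambda>n. \<Sum>i<m. \<Sum>q<i. dcoeff i q * (moment (l n) (m - 1 - i) / sqrt (real n) ^ (m - 1 - i)) *
     (moment (l n) q / sqrt (real n) ^ q) * s n ^ (i - 1 - q)"
  have l: "?F \<longlonglongrightarrow> (\<Sum>i<m. \<Sum>q<i. dcoeff i q * catalan_moment (m - 1 - i) * catalan_moment q * (if i -
      1 - q = 0 then 1 else 0))"
    by (intro tendsto_intros lim sp) auto
  have L: "(\<Sum>i<m. \<Sum>q<i. dcoeff i q * catalan_moment (m - 1 - i) * catalan_moment q * (if i - 1 - q =
      0 then 1 else 0)) = real m / 2 * catalan_moment m"
  proof -
    have "(\<Sum>i<m. \<Sum>q<i. dcoeff i q * catalan_moment (m - 1 - i) * catalan_moment q * (if i - 1 - q =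
        0 then 1 else 0)) =
      (\<Sum>i<m. if i = 0 then 0 else dcoeff i (i - 1) * catalan_moment (m - 1 -
          i) * catalan_moment (i - 1))"
    proof (intro sum.cong refl)
      fix i assume "i \<in> {..<m}"
      have "(\<Sum>q<i. dcoeff i q * catalan_moment (m - 1 - i) * catalan_moment q * (if i - 1 - q =
          0 then 1 else 0)) =
        (\<Sum>q<i. if q = i - 1 then dcoeff i q * catalan_moment (m - 1 - i) * catalan_moment q else 0)"
        by (intro sum.cong refl) auto
      also have "\<dots> = (if i = 0 then 0 else dcoeff i (i - 1) * catalan_moment (m - 1 -
          i) * catalan_moment (i - 1))"
        by (cases i) auto
      finally show "(\<Sum>q<i. dcoeff i q * catalan_moment (m - 1 - i) * catalan_moment q * (if i - 1 -
          q = 0 then 1 else 0)) =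
        (if i = 0 then 0 else dcoeff i (i - 1) * catalan_moment (m - 1 - i) * catalan_moment (i -
            1))" .
    qed
    also obtain k where k: "m = k + 2" using m by (metis add.commute le_Suc_ex)
    have "(\<Sum>i<m. if i = 0 then 0 else dcoeff i (i - 1) * catalan_moment (m - 1 -
        i) * catalan_moment (i - 1)) =
       (\<Sum>a\<le>k. (real a + 1) * (catalan_moment (k - a) * catalan_moment a))"
      unfolding k lessThan_Suc_atMost[symmetric] add_2_eq_Suc' sum.lessThan_Suc_shift
      by (simp add: dcoeff_top mult.assoc)
    also have "\<dots> = real m / 2 * catalan_moment m" unfolding k by (rule catalan_moment_weighted)
    finally show ?thesis .
  qed
  have "eventually (\<lambda>n. ?F n = drift (l n) m / sqrt (real n) ^ (m - 2)) sequentially"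
    using eventually_gt_at_top[of 0]
  proof eventually_elim
    case (elim n)
    define v where "v = sqrt (real n)"
    have v: "v > 0" using elim by (simp add: v_def)
    have "dcoeff i q * (x / v ^ (m - 1 - i)) * (y / v ^ q) * (1 / v) ^ (i - 1 - q) =
        dcoeff i q * x * y / v ^ (m - 2)" if "i < m" "q < i" for i q x y
    proof -
      have "v ^ (m - 2) = v ^ (m - 1 - i) * v ^ q * v ^ (i - 1 - q)"
        using that by (simp flip: power_add)
      thus ?thesis by (simp add: power_divide)
    qed
    thus ?case unfolding drift_expand sum_divide_distrib s_def v_def[symmetric]
      by (intro sum.cong refl) auto
  qed
  from Lim_transform_eventually[OF l this] show ?thesis unfolding L .
qed

text \<open>The sum of the drifts is handled by the Stolz-Cesaro theorem, the sum of the remainders by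
  Kronecker's lemma.\<close>

lemma moment_limit:
  assumes m: "m \<ge> 2"
    and lim: "\<And>q. q < m \<Longrightarrow> (\<lambda>n. moment (l n) q / sqrt (real n) ^ q) \<longlonglongrightarrow> catalan_moment q"
    and conv: "convergent (\<lambda>n. \<Sum>k<n. (moment (l (Suc k)) m - moment (l k) m -
        drift (l k) m) / sqrt (real (Suc k)) ^ m)"
  shows "(\<lambda>n. moment (l n) m / sqrt (real n) ^ m) \<longlonglongrightarrow> catalan_moment m"
proof -
  define b where "b n = sqrt (real n) ^ m" for n
  define y where "y k = (moment (l (Suc k)) m - moment (l k) m - drift (l k) m) / b (Suc k)" for k
  have inc: "b n < b (Suc n)" for n unfolding b_def using m by (intro power_strict_mono) auto
  have top: "filterlim b at_top sequentially"
    unfolding b_def using m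
    by (intro filterlim_pow_at_top filterlim_compose[OF sqrt_at_top] filterlim_real_sequentially)
        auto
  have n0: "(\<lambda>n. (\<Sum>k<n. b (Suc k) * y k) / b n) \<longlonglongrightarrow> 0"
    by (rule kronecker_lemma[OF inc top]) (use conv in \<open>simp add: y_def b_def\<close>)
  have dr: "(\<lambda>n. (\<Sum>k<n. drift (l k) m) / b n) \<longlonglongrightarrow> catalan_moment m"
  proof (rule stolz_cesaro[OF inc top])
    have "(\<lambda>n. (drift (l n) m / sqrt (real n) ^ (m - 2)) / ((b (Suc n) - b n) / sqrt (real n) ^ (m -
        2))) \<longlonglongrightarrow>
       (real m / 2 * catalan_moment m) / (real m / 2)"
      unfolding b_def using m by (intro tendsto_divide drift_limit sqrt_power_quotient lim) auto
    also have "(real m / 2 * catalan_moment m) / (real m / 2) = catalan_moment m" using m by simp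
    finally have l: "(\<lambda>n. (drift (l n) m / sqrt (real n) ^ (m - 2)) / ((b (Suc n) -
        b n) / sqrt (real n) ^ (m - 2))) \<longlonglongrightarrow> catalan_moment m" .
    have "eventually (\<lambda>n. (drift (l n) m / sqrt (real n) ^ (m - 2)) / ((b (Suc n) -
        b n) / sqrt (real n) ^ (m - 2)) =
      ((\<Sum>k<Suc n. drift (l k) m) - (\<Sum>k<n. drift (l k) m)) / (b (Suc n) - b n)) sequentially"
      using eventually_gt_at_top[of 0] by eventually_elim simp
    from Lim_transform_eventually[OF l this]
    show "(\<lambda>n. ((\<Sum>k<Suc n. drift (l k) m) - (\<Sum>k<n. drift (l k) m)) / (b (Suc n) - b n)) \<longlonglongrightarrow>
        catalan_moment m" .
  qed
  have i0: "(\<lambda>n. moment (l 0) m / b n) \<longlonglongrightarrow> 0"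
    using top by (intro real_tendsto_divide_at_top[OF tendsto_const])
  have tele: "moment (l n) m = moment (l 0) m + (\<Sum>k<n. drift (l k) m) +
      (\<Sum>k<n. b (Suc k) * y k)" for n
  proof (induction n)
    case (Suc n)
    have "b (Suc n) \<noteq> 0" by (simp add: b_def)
    hence "b (Suc n) * y n = moment (l (Suc n)) m - moment (l n) m - drift (l n) m"
        by (simp add: y_def)
    thus ?case using Suc by simp
  qed simp
  have "(\<lambda>n. moment (l 0) m / b n + (\<Sum>k<n. drift (l k) m) / b n + (\<Sum>k<n. b (Suc k) * y k) / b n) \<longlonglongrightarrow>
      0 + catalan_moment m + 0"
    by (intro tendsto_add i0 dr n0)
  moreover have "moment (l 0) m / b n + (\<Sum>k<n. drift (l k) m) / b n +
      (\<Sum>k<n. b (Suc k) * y k) / b n = moment (l n) m / b n" for n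
    unfolding tele[of n] by (simp add: add_divide_distrib)
  ultimately show ?thesis by (simp add: b_def)
qed


section \<open>Almost sure convergence of the moments\<close>

text \<open>Absolute moments of \<open>1 + \<bar>c\<bar>\<close> instead of \<open>\<bar>c\<bar>\<close>: this base is at least \<open>1\<close>, which absorbs the
  lower-order terms of \<open>diffpow\<close>.\<close>

definition absmoment :: "nat list \<Rightarrow> nat \<Rightarrow> real" where
  "absmoment \<mu> j = (\<Sum>c\<in>addable \<mu>. trans_prob \<mu> c * (1 + \<bar>real_of_int c\<bar>) ^ j)"

lemma absmoment_nonneg: "absmoment \<mu> j \<ge> 0"
  unfolding absmoment_def by (intro sum_nonneg mult_nonneg_nonneg trans_prob_nonneg) auto

text \<open>A product of two powers is at most the sum of the powers of the total degree.\<close>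

lemma absmoment_mult:
  assumes y: "young_diagram \<mu>"
  shows "absmoment \<mu> a * absmoment \<mu> b \<le> 2 * absmoment \<mu> (a + b)"
proof -
  let ?x = "\<lambda>c. 1 + \<bar>real_of_int c\<bar>"
  have pw: "u ^ a * v ^ b \<le> u ^ (a + b) + v ^ (a + b)" if "u \<ge> 0" "v \<ge> 0" for u v :: real
  proof (cases "u \<le> v")
    case True
    hence "u ^ a * v ^ b \<le> v ^ a * v ^ b" using that by (intro mult_right_mono power_mono) auto
    thus ?thesis using that by (simp add: power_add add_increasing)
  next
    case False
    hence "u ^ a * v ^ b \<le> u ^ a * u ^ b" using that by (intro mult_left_mono power_mono) auto
    thus ?thesis using that by (simp add: power_add add_increasing2)
  qed
  have "absmoment \<mu> a * absmoment \<mu> b = (\<Sum>c\<in>addable \<mu>. \<Sum>d\<in>addable \<mu>. trans_prob \<mu> c *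
      trans_prob \<mu> d * (?x c ^ a * ?x d ^ b))"
    unfolding absmoment_def sum_product by (simp add: mult_ac)
  also have "\<dots> \<le> (\<Sum>c\<in>addable \<mu>. \<Sum>d\<in>addable \<mu>. trans_prob \<mu> c * trans_prob \<mu> d * (?x c ^ (a + b) +
      ?x d ^ (a + b)))"
    by (intro sum_mono mult_left_mono pw mult_nonneg_nonneg trans_prob_nonneg) auto
  also have "\<dots> = (\<Sum>c\<in>addable \<mu>. trans_prob \<mu> c * ?x c ^ (a + b) * (\<Sum>d\<in>addable \<mu>. trans_prob \<mu> d)) +
      (\<Sum>c\<in>addable \<mu>. trans_prob \<mu> c * (\<Sum>d\<in>addable \<mu>. trans_prob \<mu> d * ?x d ^ (a + b)))"
    by (simp add: sum_distrib_left sum_distrib_right distrib_left sum.distrib mult_ac)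
  also have "\<dots> = 2 * absmoment \<mu> (a + b)"
    by (simp add: trans_prob_sum[OF y] absmoment_def flip: sum_distrib_right)
  finally show ?thesis .
qed

lemma abs_moment_le: "\<bar>moment \<mu> j\<bar> \<le> absmoment \<mu> j"
proof -
  have "\<bar>moment \<mu> j\<bar> \<le> (\<Sum>c\<in>addable \<mu>. \<bar>trans_prob \<mu> c * real_of_int c ^ j\<bar>)" unfolding moment_def
      by (rule sum_abs)
  also have "\<dots> \<le> absmoment \<mu> j" unfolding absmoment_def
    by (intro sum_mono) (auto simp: abs_mult trans_prob_nonneg power_abs intro!: mult_left_mono
        power_mono)
  finally show ?thesis .
qed

lemma diffpow_bound: "\<bar>diffpow i x\<bar> \<le> real i * (1 + \<bar>x\<bar>) ^ (i - 1)"
proof -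
  have "(x + 1) ^ i - (x - 1) ^ i = 2 * (\<Sum>j<i. (x - 1) ^ (i - Suc j) * (x + 1) ^ j)"
    using power_diff_sumr2[of "x + 1" i "x - 1"] by simp
  hence "\<bar>diffpow i x\<bar> = \<bar>\<Sum>j<i. (x - 1) ^ (i - Suc j) * (x + 1) ^ j\<bar>" by (simp add: diffpow_def)
  also have "\<dots> \<le> (\<Sum>j<i. \<bar>(x - 1) ^ (i - Suc j) * (x + 1) ^ j\<bar>)" by (rule sum_abs)
  also have "\<dots> \<le> (\<Sum>j<i. (1 + \<bar>x\<bar>) ^ (i - 1))"
  proof (intro sum_mono)
    fix j assume j: "j \<in> {..<i}"
    have "\<bar>(x - 1) ^ (i - Suc j) * (x + 1) ^ j\<bar> = \<bar>x - 1\<bar> ^ (i - Suc j) * \<bar>x + 1\<bar> ^ j"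
      by (simp add: abs_mult power_abs)
    also have "\<dots> \<le> (1 + \<bar>x\<bar>) ^ (i - Suc j) * (1 + \<bar>x\<bar>) ^ j" by (intro mult_mono power_mono) auto
    also have "\<dots> = (1 + \<bar>x\<bar>) ^ (i - 1)" using j by (simp flip: power_add)
    finally show "\<bar>(x - 1) ^ (i - Suc j) * (x + 1) ^ j\<bar> \<le> (1 + \<bar>x\<bar>) ^ (i - 1)" .
  qed
  also have "\<dots> = real i * (1 + \<bar>x\<bar>) ^ (i - 1)" by simp
  finally show ?thesis .
qed

lemma absmoment_even_le:
  assumes y: "young_diagram \<mu>"
  shows "absmoment \<mu> (2 * k) \<le> 4 ^ k * (1 + moment \<mu> (2 * k))"
proof -
  have pw: "(1 + \<bar>x\<bar>) ^ (2 * k) \<le> 4 ^ k * (1 + x ^ (2 * k))" for x :: real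
  proof -
    have "(1 + \<bar>x\<bar>)\<^sup>2 \<le> 4 * max 1 (x\<^sup>2)"
    proof (cases "\<bar>x\<bar> \<le> 1")
      case True
      have "(1 + \<bar>x\<bar>)\<^sup>2 \<le> 2\<^sup>2" using True by (intro power_mono) auto
      thus ?thesis by simp
    next
      case False
      have "(1 + \<bar>x\<bar>)\<^sup>2 \<le> (2 * \<bar>x\<bar>)\<^sup>2" using False by (intro power_mono) auto
      thus ?thesis by (simp add: power_mult_distrib)
    qed
    hence "((1 + \<bar>x\<bar>)\<^sup>2) ^ k \<le> (4 * max 1 (x\<^sup>2)) ^ k" by (intro power_mono) auto
    also have "\<dots> = 4 ^ k * (max 1 (x\<^sup>2)) ^ k" by (simp add: power_mult_distrib)
    also have "(max 1 (x\<^sup>2)) ^ k \<le> 1 + (x\<^sup>2) ^ k" by (cases "1 \<le> x\<^sup>2") (auto simp: max_def)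
    finally show ?thesis by (simp add: power_mult)
  qed
  have "absmoment \<mu> (2 * k) \<le> (\<Sum>c\<in>addable \<mu>. trans_prob \<mu> c * (4 ^ k * (1 +
      real_of_int c ^ (2 * k))))"
    unfolding absmoment_def by (intro sum_mono mult_left_mono pw trans_prob_nonneg)
  also have "\<dots> = 4 ^ k * ((\<Sum>c\<in>addable \<mu>. trans_prob \<mu> c) + moment \<mu> (2 * k))"
    unfolding moment_def by (simp add: sum_distrib_left sum_distrib_right distrib_left sum.distrib
        mult_ac)
  finally show ?thesis by (simp add: trans_prob_sum[OF y])
qed

lemma drift_bound:
  assumes y: "young_diagram \<mu>"
  shows "\<bar>drift \<mu> m\<bar> \<le> 2 * real m ^ 2 * absmoment \<mu> (m - 2)"
proof -
  have "\<bar>drift \<mu> m\<bar> \<le> (\<Sum>i<m. \<bar>moment \<mu> (m - 1 - i) * (\<Sum>c\<in>addable \<mu>. trans_prob \<mu> c *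
      diffpow i (real_of_int c))\<bar>)"
    unfolding drift_def by (rule sum_abs)
  also have "\<dots> \<le> (\<Sum>i<m. 2 * real m * absmoment \<mu> (m - 2))"
  proof (intro sum_mono)
    fix i assume i: "i \<in> {..<m}"
    have "\<bar>\<Sum>c\<in>addable \<mu>. trans_prob \<mu> c * diffpow i (real_of_int c)\<bar> \<le>
        (\<Sum>c\<in>addable \<mu>. \<bar>trans_prob \<mu> c * diffpow i (real_of_int c)\<bar>)"
      by (rule sum_abs)
    also have "\<dots> \<le> (\<Sum>c\<in>addable \<mu>. trans_prob \<mu> c * (real i * (1 + \<bar>real_of_int c\<bar>) ^ (i - 1)))"
      unfolding abs_mult abs_of_nonneg[OF trans_prob_nonneg]
      by (intro sum_mono mult_left_mono diffpow_bound trans_prob_nonneg)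
    also have "\<dots> = real i * absmoment \<mu> (i - 1)" by (simp add: absmoment_def sum_distrib_left
        mult_ac)
    finally have S: "\<bar>\<Sum>c\<in>addable \<mu>. trans_prob \<mu> c * diffpow i (real_of_int c)\<bar> \<le>
        real i * absmoment \<mu> (i - 1)" .
    show "\<bar>moment \<mu> (m - 1 - i) * (\<Sum>c\<in>addable \<mu>. trans_prob \<mu> c * diffpow i (real_of_int c))\<bar> \<le>
        2 * real m * absmoment \<mu> (m - 2)"
    proof (cases "i = 0")
      case True thus ?thesis by (simp add: diffpow_def absmoment_nonneg)
    next
      case False
      have "\<bar>moment \<mu> (m - 1 - i) * (\<Sum>c\<in>addable \<mu>. trans_prob \<mu> c * diffpow i (real_of_int c))\<bar> \<le>
          absmoment \<mu> (m - 1 - i) * (real i * absmoment \<mu> (i - 1))"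
        unfolding abs_mult by (intro mult_mono abs_moment_le S absmoment_nonneg) auto
      also have "\<dots> = real i * (absmoment \<mu> (m - 1 - i) * absmoment \<mu> (i - 1))" by simp
      also have "\<dots> \<le> real m * (2 * absmoment \<mu> (m - 1 - i + (i - 1)))"
        using i by (intro mult_mono absmoment_mult[OF y] mult_nonneg_nonneg absmoment_nonneg) auto
      also have "m - 1 - i + (i - 1) = m - 2" using i False by auto
      finally show ?thesis by simp
    qed
  qed
  also have "\<dots> = 2 * real m ^ 2 * absmoment \<mu> (m - 2)" by (simp add: power2_eq_square)
  finally show ?thesis .
qed

text \<open>Each summand of the increment has total degree \<open>m - 2\<close>, so its square is controlled by one
  absolute moment of order \<open>2 * (m - 2)\<close>.\<close>

lemma moment_step_variance:
  assumes y: "young_diagram \<mu>"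
  shows "(\<Sum>c\<in>addable \<mu>. trans_prob \<mu> c * (moment (up \<mu> c) m - moment \<mu> m - drift \<mu> m)\<^sup>2) \<le>
      4 * real m ^ 4 * absmoment \<mu> (2 * (m - 2))"
proof -
  \<comment> \<open>The increment in question; \<open>drift\<close> is its mean, and centring only lowers the second moment.\<close>
  define \<Delta> where "\<Delta> c = (\<Sum>i<m. moment \<mu> (m - 1 - i) * diffpow i (real_of_int c))" for c
  have D: "moment (up \<mu> c) m - moment \<mu> m = \<Delta> c" if "c \<in> addable \<mu>" for c
    using moment_step[OF step_up[OF y that]] by (simp add: \<Delta>_def)
  have mean: "(\<Sum>c\<in>addable \<mu>. trans_prob \<mu> c * \<Delta> c) = drift \<mu> m"
    unfolding \<Delta>_def drift_def sum_distrib_left by (subst sum.swap) (simp add: mult_ac)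
  have "(\<Sum>c\<in>addable \<mu>. trans_prob \<mu> c * (moment (up \<mu> c) m - moment \<mu> m - drift \<mu> m)\<^sup>2) =
     (\<Sum>c\<in>addable \<mu>. trans_prob \<mu> c * (\<Delta> c)\<^sup>2 - 2 * drift \<mu> m * (trans_prob \<mu> c * \<Delta> c) +
         (drift \<mu> m)\<^sup>2 * trans_prob \<mu> c)"
    by (intro sum.cong refl) (simp add: D power2_eq_square algebra_simps)
  also have "\<dots> = (\<Sum>c\<in>addable \<mu>. trans_prob \<mu> c * (\<Delta> c)\<^sup>2) - (drift \<mu> m)\<^sup>2"
    by (simp add: sum.distrib sum_subtractf mean trans_prob_sum[OF y] power2_eq_square flip:
        sum_distrib_left)
  also have "\<dots> \<le> (\<Sum>c\<in>addable \<mu>. trans_prob \<mu> c * (\<Delta> c)\<^sup>2)" by simp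
  also have "\<dots> \<le> (\<Sum>c\<in>addable \<mu>. trans_prob \<mu> c * (real m * (\<Sum>i<m. (moment \<mu> (m - 1 -
      i) * diffpow i (real_of_int c))\<^sup>2)))"
  proof (intro sum_mono mult_left_mono trans_prob_nonneg)
    fix c
    show "(\<Delta> c)\<^sup>2 \<le> real m * (\<Sum>i<m. (moment \<mu> (m - 1 - i) * diffpow i (real_of_int c))\<^sup>2)"
      unfolding \<Delta>_def using sum_squared_le_sum_of_squares[of "\<lambda>i. moment \<mu> (m - 1 -
          i) * diffpow i (real_of_int c)" "{..<m}"]
      by (simp add: mult.commute)
  qed
  also have "\<dots> = real m * (\<Sum>i<m. \<Sum>c\<in>addable \<mu>. trans_prob \<mu> c * (moment \<mu> (m - 1 -
      i) * diffpow i (real_of_int c))\<^sup>2)"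
    by (subst sum.swap) (simp add: sum_distrib_left mult_ac)
  also have "\<dots> \<le> real m * (\<Sum>i<m. 4 * real m ^ 2 * absmoment \<mu> (2 * (m - 2)))"
  proof (intro mult_left_mono sum_mono)
    fix i assume i: "i \<in> {..<m}"
    show "(\<Sum>c\<in>addable \<mu>. trans_prob \<mu> c * (moment \<mu> (m - 1 - i) * diffpow i (real_of_int c))\<^sup>2) \<le>
        4 * real m ^ 2 * absmoment \<mu> (2 * (m - 2))"
    proof (cases "i = 0")
      case True thus ?thesis by (simp add: diffpow_def absmoment_nonneg)
    next
      case False
      have "(moment \<mu> (m - 1 - i))\<^sup>2 \<le> (absmoment \<mu> (m - 1 - i))\<^sup>2"
        using abs_moment_le[of \<mu> "m - 1 - i"] absmoment_nonneg
            by (simp add: abs_le_square_iff[symmetric])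
      also have "\<dots> \<le> 2 * absmoment \<mu> (2 * (m - 1 - i))"
        using absmoment_mult[OF y, of "m - 1 - i" "m - 1 - i"]
        unfolding power2_eq_square mult_2[where 'a = nat] .
      finally have M: "(moment \<mu> (m - 1 - i))\<^sup>2 \<le> 2 * absmoment \<mu> (2 * (m - 1 - i))" .
      have "(\<Sum>c\<in>addable \<mu>. trans_prob \<mu> c * (moment \<mu> (m - 1 - i) * diffpow i (real_of_int c))\<^sup>2) =
        (moment \<mu> (m - 1 - i))\<^sup>2 * (\<Sum>c\<in>addable \<mu>. trans_prob \<mu> c * (diffpow i (real_of_int c))\<^sup>2)"
        by (simp add: sum_distrib_left power_mult_distrib mult_ac)
      also have "\<dots> \<le> (2 * absmoment \<mu> (2 * (m - 1 - i))) * (\<Sum>c\<in>addable \<mu>. trans_prob \<mu> c * (real i *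
          (1 + \<bar>real_of_int c\<bar>) ^ (i - 1))\<^sup>2)"
      proof (intro mult_mono M sum_mono mult_left_mono trans_prob_nonneg)
        fix c
        show "(diffpow i (real_of_int c))\<^sup>2 \<le> (real i * (1 + \<bar>real_of_int c\<bar>) ^ (i - 1))\<^sup>2"
          using diffpow_bound[of i "real_of_int c"] by (simp add: abs_le_square_iff[symmetric])
      qed (auto intro!: sum_nonneg mult_nonneg_nonneg trans_prob_nonneg absmoment_nonneg)
      also have "(\<Sum>c\<in>addable \<mu>. trans_prob \<mu> c * (real i * (1 + \<bar>real_of_int c\<bar>) ^ (i - 1))\<^sup>2) =
          real i ^ 2 * absmoment \<mu> (2 * (i - 1))"
        by (simp add: absmoment_def sum_distrib_left power_mult_distrib mult_ac flip: power_mult)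
      also have "2 * absmoment \<mu> (2 * (m - 1 - i)) * (real i ^ 2 * absmoment \<mu> (2 * (i - 1))) =
        2 * real i ^ 2 * (absmoment \<mu> (2 * (m - 1 - i)) * absmoment \<mu> (2 * (i - 1)))" by simp
      also have "\<dots> \<le> 2 * real m ^ 2 * (2 * absmoment \<mu> (2 * (m - 1 - i) + 2 * (i - 1)))"
        using i by (intro mult_mono absmoment_mult[OF y] power_mono mult_nonneg_nonneg
            absmoment_nonneg) auto
      also have "2 * (m - 1 - i) + 2 * (i - 1) = 2 * (m - 2)" using i False by auto
      finally show ?thesis by simp
    qed
  qed simp
  also have "\<dots> = 4 * real m ^ 4 * absmoment \<mu> (2 * (m - 2))" by (simp add: power_numeral_reduce)
  finally show ?thesis .
qed

context plancherel_growth_process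
begin

lemma last_hist [simp]: "last (hist n \<omega>) = \<Lambda> n \<omega>" by (simp add: hist_def)

lemma butlast_hist: "butlast (hist (Suc n) \<omega>) = hist n \<omega>" by (simp add: hist_Suc)

lemma expectation_mono_paths:
  fixes f g :: "nat list list \<Rightarrow> real"
  assumes "\<And>h. h \<in> paths n \<Longrightarrow> f h \<le> g h"
  shows "expectation (\<lambda>\<omega>. f (hist n \<omega>)) \<le> expectation (\<lambda>\<omega>. g (hist n \<omega>))"
  unfolding expectation_hist(2)[where f = f and n = n] expectation_hist(2)[where f = g and n = n]
  by (intro sum_mono mult_left_mono assms hist_prob_nonneg)

lemma expectation_cong_paths:
  fixes f g :: "nat list list \<Rightarrow> real"
  assumes "\<And>h. h \<in> paths n \<Longrightarrow> f h = g h"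
  shows "expectation (\<lambda>\<omega>. f (hist n \<omega>)) = expectation (\<lambda>\<omega>. g (hist n \<omega>))"
  by (intro antisym expectation_mono_paths[where f = f and g = g] expectation_mono_paths[where f =
      g and g = f])
    (simp_all add: assms)

text \<open>The drift of the moment of order \<open>2 * Suc k\<close> is bounded by moments of order \<open>2 * k\<close>, whose
  sum over time gains one power of \<open>n\<close>.\<close>

lemma expectation_even_moment_bound:
  "\<exists>K\<ge>0. \<forall>n. expectation (\<lambda>\<omega>. moment (\<Lambda> n \<omega>) (2 * k)) \<le> K * (real n + 1) ^ k"
proof (induction k)
  case 0
  have "expectation (\<lambda>\<omega>. moment (\<Lambda> n \<omega>) 0) \<le> 1" for n
    using expectation_mono_paths[of n "\<lambda>h. moment (last h) 0" "\<lambda>_. 1"]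
        by (simp add: moment_0 paths_young prob_space)
  thus ?case by (intro exI[of _ 1]) auto
next
  case (Suc k)
  then obtain K where K: "K \<ge> 0" "\<And>n. expectation (\<lambda>\<omega>. moment (\<Lambda> n \<omega>) (2 * k)) \<le>
      K * (real n + 1) ^ k" by blast
  define m where "m = 2 * Suc k"
  define C where "C = 2 * real m ^ 2 * (4 ^ k * (1 + K))"
  define e where "e n = expectation (\<lambda>\<omega>. moment (\<Lambda> n \<omega>) m)" for n
  have C: "C \<ge> 0" using K by (simp add: C_def)
  have st: "e (Suc n) \<le> e n + C * (real n + 1) ^ k" for n
  proof -
    have "e (Suc n) = expectation (\<lambda>\<omega>. \<Sum>c\<in>addable (last (hist n \<omega>)). trans_prob (last (hist n \<omega>))
        c * moment (up (last (hist n \<omega>)) c) m)"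
      unfolding e_def using expectation_hist_Suc[of "\<lambda>h. moment (last h) m" n] by simp
    also have "\<dots> \<le> expectation (\<lambda>\<omega>. moment (last (hist n \<omega>)) m + 2 * real m ^ 2 * (4 ^ k * (1 +
        moment (last (hist n \<omega>)) (2 * k))))"
    proof (rule expectation_mono_paths)
      fix h assume h: "h \<in> paths n"
      note y = paths_young[OF h]
      have "(\<Sum>c\<in>addable (last h). trans_prob (last h) c * moment (up (last h) c) m) =
          moment (last h) m + drift (last h) m"
        by (rule mean_moment_step[OF y])
      also have "drift (last h) m \<le> 2 * real m ^ 2 * absmoment (last h) (m - 2)"
        using drift_bound[OF y, of m] by linarith
      also have "m - 2 = 2 * k" by (simp add: m_def)
      also have "2 * real m ^ 2 * absmoment (last h) (2 * k) \<le>
          2 * real m ^ 2 * (4 ^ k * (1 + moment (last h) (2 * k)))"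
        by (intro mult_left_mono absmoment_even_le[OF y]) auto
      finally show "(\<Sum>c\<in>addable (last h). trans_prob (last h) c * moment (up (last h) c) m) \<le>
        moment (last h) m + 2 * real m ^ 2 * (4 ^ k * (1 + moment (last h) (2 * k)))" by simp
    qed
    also have "\<dots> = e n + 2 * real m ^ 2 * (4 ^ k * (1 + expectation (\<lambda>\<omega>. moment (\<Lambda> n \<omega>) (2 * k))))"
    proof -
      have "integrable M (\<lambda>\<omega>. moment (\<Lambda> n \<omega>) q)" for q
        using expectation_hist(1)[of "\<lambda>h. moment (last h) q" n] by simp
      thus ?thesis by (simp add: e_def prob_space)
    qed
    also have "\<dots> \<le> e n + 2 * real m ^ 2 * (4 ^ k * ((real n + 1) ^ k + K * (real n + 1) ^ k))"
      by (intro add_left_mono mult_left_mono add_mono K one_le_power) auto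
    finally show ?thesis by (simp add: C_def algebra_simps)
  qed
  have "e n \<le> (\<bar>e 0\<bar> + C) * (real n + 1) ^ Suc k" for n
  proof (induction n)
    case 0 thus ?case using C by simp
  next
    case (Suc n)
    have "e (Suc n) \<le> (\<bar>e 0\<bar> + C) * (real n + 1) ^ Suc k + C * (real n + 1) ^ k"
      using st[of n] Suc by linarith
    also have "\<dots> \<le> (\<bar>e 0\<bar> + C) * (real n + 1) ^ Suc k + (\<bar>e 0\<bar> + C) * (real n + 1) ^ k"
      using C by (intro add_left_mono mult_right_mono) auto
    also have "\<dots> = (\<bar>e 0\<bar> + C) * ((real n + 2) * (real n + 1) ^ k)" by (simp add: algebra_simps)
    also have "\<dots> \<le> (\<bar>e 0\<bar> + C) * ((real n + 2) * (real n + 2) ^ k)"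
      using C by (intro mult_left_mono power_mono) auto
    finally show ?case by (simp add: add_ac)
  qed
  thus ?case using C unfolding e_def m_def by (intro exI[of _ "\<bar>expectation (\<lambda>\<omega>. moment (\<Lambda> 0 \<omega>) (2 *
      Suc k))\<bar> + C"]) auto
qed

lemma expectation_absmom_bound:
  "\<exists>K\<ge>0. \<forall>n. expectation (\<lambda>\<omega>. absmoment (\<Lambda> n \<omega>) (2 * k)) \<le> K * (real n + 1) ^ k"
proof -
  obtain K where K: "K \<ge> 0" "\<And>n. expectation (\<lambda>\<omega>. moment (\<Lambda> n \<omega>) (2 * k)) \<le> K * (real n + 1) ^ k"
    using expectation_even_moment_bound by blast
  have "expectation (\<lambda>\<omega>. absmoment (\<Lambda> n \<omega>) (2 * k)) \<le> (4 ^ k * (1 + K)) * (real n + 1) ^ k" for n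
  proof -
    have "expectation (\<lambda>\<omega>. absmoment (\<Lambda> n \<omega>) (2 * k)) \<le> expectation (\<lambda>\<omega>. 4 ^ k * (1 +
        moment (\<Lambda> n \<omega>) (2 * k)))"
      using expectation_mono_paths[of n "\<lambda>h. absmoment (last h) (2 * k)" "\<lambda>h. 4 ^ k * (1 +
          moment (last h) (2 * k))"]
      by (simp add: absmoment_even_le paths_young)
    also have "\<dots> = 4 ^ k * (1 + expectation (\<lambda>\<omega>. moment (\<Lambda> n \<omega>) (2 * k)))"
      using expectation_hist(1)[of "\<lambda>h. moment (last h) (2 * k)" n] by (simp add: prob_space)
    also have "\<dots> \<le> 4 ^ k * ((real n + 1) ^ k + K * (real n + 1) ^ k)"
      by (intro mult_left_mono add_mono K one_le_power) auto
    finally show ?thesis by (simp add: algebra_simps)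
  qed
  thus ?thesis using K(1) by (intro exI[of _ "4 ^ k * (1 + K)"]) auto
qed

text \<open>The increments divided by the normalising constant of the \<open>m\<close>-th moment; their sum
  converges, as Kronecker's lemma requires.\<close>

definition moment_noise :: "nat \<Rightarrow> nat \<Rightarrow> nat list list \<Rightarrow> real" where
  "moment_noise m j h = (moment (last h) m - moment (last (butlast h)) m -
      drift (last (butlast h)) m) / sqrt (real j) ^ m"

lemma moment_noise_martingale: "martingale_increments (moment_noise m)"
  unfolding martingale_increments_def
proof (intro allI ballI)
  fix n h assume h: "h \<in> paths n"
  note y = paths_young[OF h]
  have "(\<Sum>c\<in>addable (last h). trans_prob (last h) c * moment_noise m (Suc n) (h @ [up (last h)
      c])) =
    (\<Sum>c\<in>addable (last h). trans_prob (last h) c * moment (up (last h) c) m - (moment (last h) m +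
        drift (last h) m) * trans_prob (last h) c) / sqrt (real (Suc n)) ^ m"
    unfolding sum_divide_distrib moment_noise_def by (intro sum.cong refl) (simp add: algebra_simps)
  also have "\<dots> = 0"
    by (simp only: sum_subtractf mean_moment_step[OF y] trans_prob_sum[OF y]
        sum_distrib_left[symmetric]) simp
  finally show "(\<Sum>c\<in>addable (last h). trans_prob (last h) c *
      moment_noise m (Suc n) (h @ [up (last h) c])) = 0" .
qed

lemma moment_noise_summable:
  assumes m: "m \<ge> 2"
  shows "summable (\<lambda>n. expectation (\<lambda>\<omega>. (incr (moment_noise m) n \<omega>)\<^sup>2))"
proof -
  obtain K where K: "K \<ge> 0" "\<And>n. expectation (\<lambda>\<omega>. absmoment (\<Lambda> n \<omega>) (2 * (m - 2))) \<le>
      K * (real n + 1) ^ (m - 2)"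
    using expectation_absmom_bound by blast
  have b: "expectation (\<lambda>\<omega>. (incr (moment_noise m) n \<omega>)\<^sup>2) \<le>
      (4 * real m ^ 4 * K) * inverse (real (Suc n) ^ 2)" for n
  proof -
    have "expectation (\<lambda>\<omega>. (incr (moment_noise m) n \<omega>)\<^sup>2) =
      expectation (\<lambda>\<omega>. \<Sum>c\<in>addable (last (hist n \<omega>)). trans_prob (last (hist n \<omega>)) c *
          (moment_noise m (Suc n) (hist n \<omega> @ [up (last (hist n \<omega>)) c]))\<^sup>2)"
      unfolding incr_def by (rule expectation_hist_Suc)
    also have "\<dots> \<le> expectation (\<lambda>\<omega>. 4 * real m ^ 4 * absmoment (last (hist n \<omega>)) (2 * (m -
        2)) / real (Suc n) ^ m)"
    proof (rule expectation_mono_paths)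
      fix h assume h: "h \<in> paths n"
      note y = paths_young[OF h]
      have "(sqrt (real (Suc n)) ^ m)\<^sup>2 = real (Suc n) ^ m"
        by (simp only: power_mult[symmetric] mult.commute[of m] power_mult real_sqrt_pow2[OF
            of_nat_0_le_iff])
      hence "(\<Sum>c\<in>addable (last h). trans_prob (last h) c *
          (moment_noise m (Suc n) (h @ [up (last h) c]))\<^sup>2) =
         (\<Sum>c\<in>addable (last h). trans_prob (last h) c * (moment (up (last h) c) m -
             moment (last h) m - drift (last h) m)\<^sup>2) / real (Suc n) ^ m"
        unfolding moment_noise_def sum_divide_distrib by (intro sum.cong refl) (simp add:
            power_divide)
      also have "\<dots> \<le> 4 * real m ^ 4 * absmoment (last h) (2 * (m - 2)) / real (Suc n) ^ m"
        by (intro divide_right_mono moment_step_variance[OF y]) auto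
      finally show "(\<Sum>c\<in>addable (last h). trans_prob (last h) c *
          (moment_noise m (Suc n) (h @ [up (last h) c]))\<^sup>2) \<le>
        4 * real m ^ 4 * absmoment (last h) (2 * (m - 2)) / real (Suc n) ^ m" .
    qed
    also have "\<dots> = 4 * real m ^ 4 * expectation (\<lambda>\<omega>. absmoment (\<Lambda> n \<omega>) (2 * (m -
        2))) / real (Suc n) ^ m"
      by simp
    also have "\<dots> \<le> 4 * real m ^ 4 * (K * (real n + 1) ^ (m - 2)) / real (Suc n) ^ m"
      by (intro divide_right_mono mult_left_mono K) auto
    also have "\<dots> = (4 * real m ^ 4 * K) * inverse (real (Suc n) ^ 2)"
    proof -
      have "real (Suc n) ^ m = real (Suc n) ^ (m - 2) * real (Suc n) ^ 2"
          by (metis le_add_diff_inverse2 m power_add)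
      moreover have r: "real n + 1 = real (Suc n)" by simp
      ultimately show ?thesis unfolding r by (simp add: divide_simps del: of_nat_Suc)
    qed
    finally show ?thesis .
  qed
  have "summable (\<lambda>n. inverse (real n ^ 2))" by (rule inverse_power_summable) simp
  hence "summable (\<lambda>n. inverse (real (Suc n) ^ 2))" by (subst summable_Suc_iff)
  hence s: "summable (\<lambda>n. (4 * real m ^ 4 * K) * inverse (real (Suc n) ^ 2))"
      by (rule summable_mult)
  show ?thesis
    by (rule summable_comparison_test'[OF s, of 0]) (use b in \<open>auto\<close>)
qed

text \<open>By induction on the order: once the lower moments converge, \<open>moment_limit\<close> applies, because
  the normalised noise is almost surely summable.\<close>

theorem AE_moments:
  "AE \<omega> in M. \<forall>m. (\<lambda>n. moment (\<Lambda> n \<omega>) m / sqrt (real n) ^ m) \<longlonglongrightarrow> catalan_moment m"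
proof -
  have "AE \<omega> in M. \<forall>m. m \<ge> 2 \<longrightarrow> convergent (\<lambda>n. \<Sum>k<n. incr (moment_noise m) k \<omega>)"
    unfolding AE_all_countable
  proof
    fix m :: nat
    show "AE \<omega> in M. m \<ge> 2 \<longrightarrow> convergent (\<lambda>n. \<Sum>k<n. incr (moment_noise m) k \<omega>)"
    proof (cases "m \<ge> 2")
      case True
      thus ?thesis using martingale_convergence[OF moment_noise_martingale
          moment_noise_summable[OF True]] by simp
    qed simp
  qed
  thus ?thesis using AE_paths
  proof eventually_elim
    case (elim \<omega>)
    have y: "young_diagram (\<Lambda> n \<omega>)" for n using paths_young[of "hist n \<omega>" n] elim by simp
    have st: "\<exists>c. step (\<Lambda> n \<omega>) c (\<Lambda> (Suc n) \<omega>)" for n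
    proof -
      have "hist (Suc n) \<omega> ! n \<nearrow> hist (Suc n) \<omega> ! Suc n"
        using elim(2)[rule_format, of "Suc n"] unfolding paths_def by blast
      thus ?thesis using adds_box_iff_step by simp
    qed
    show ?case
    proof
      fix m show "(\<lambda>n. moment (\<Lambda> n \<omega>) m / sqrt (real n) ^ m) \<longlonglongrightarrow> catalan_moment m"
      proof (induction m rule: less_induct)
        case (less m)
        consider "m = 0" | "m = 1" | "m \<ge> 2" by linarith
        thus ?case
        proof cases
          case 1 thus ?thesis by (simp add: moment_0 y)
        next
          case 2
          have const: "moment (\<Lambda> n \<omega>) 1 = moment (\<Lambda> 0 \<omega>) 1" for n
          proof (induction n)
            case (Suc n)
            obtain c where "step (\<Lambda> n \<omega>) c (\<Lambda> (Suc n) \<omega>)" using st by blast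
            from moment_step[OF this, of 1] Suc show ?case by (simp add: diffpow_def)
          qed simp
          have "(\<lambda>n. moment (\<Lambda> n \<omega>) 1 / sqrt (real n)) = (\<lambda>n. moment (\<Lambda> 0 \<omega>) 1 / sqrt (real n))"
            by (rule ext) (metis const)
          moreover have "(\<lambda>n. moment (\<Lambda> 0 \<omega>) 1 / sqrt (real n)) \<longlonglongrightarrow> 0"
            by (intro real_tendsto_divide_at_top[OF tendsto_const] filterlim_compose[OF
                sqrt_at_top] filterlim_real_sequentially)
          ultimately have "(\<lambda>n. moment (\<Lambda> n \<omega>) 1 / sqrt (real n)) \<longlonglongrightarrow> 0" by argo
          thus ?thesis using 2 by simp
        next
          case 3
          show ?thesis
          proof (rule moment_limit[OF 3 less])
            have "convergent (\<lambda>n. \<Sum>k<n. incr (moment_noise m) k \<omega>)" using elim(1) 3 by blast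
            thus "convergent (\<lambda>n. \<Sum>k<n. (moment (\<Lambda> (Suc k) \<omega>) m - moment (\<Lambda> k \<omega>) m -
                drift (\<Lambda> k \<omega>) m) / sqrt (real (Suc k)) ^ m)"
              by (simp add: incr_def moment_noise_def butlast_hist)
          qed
        qed
      qed
    qed
  qed
qed

end


section \<open>The semicircle law and the method of moments\<close>

text \<open>The generating function \<open>G\<close> satisfies \<open>G = 1 + X^2 G^2\<close>, a quadratic equation whose solution
  satisfies a linear differential equation. The resulting two-term recursion is the one obtained
  by partial integration from the density.\<close>

lemma catalan_moment_recursion: "real (k + 4) * catalan_moment (k + 2) =
    4 * real (k + 1) * catalan_moment k"
proof -
  define G where "G = Abs_fps catalan_moment"
  \<comment> \<open>\<open>B\<close> is the square root of \<open>1 - 4 X^2\<close>, and its differential equation gives the recursion.\<close>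
  define B where "B = 1 - fps_const 2 * fps_X ^ 2 * G"
  have G: "G = 1 + fps_X ^ 2 * (G * G)"
  proof (rule fps_ext)
    fix n show "fps_nth G n = fps_nth (1 + fps_X ^ 2 * (G * G)) n"
    proof (cases n rule: catalan_moment.cases)
      case (3 k)
      have "fps_nth (G * G) k = catalan_moment (k + 2)" by (simp add: G_def fps_mult_nth
          atLeast0AtMost)
      thus ?thesis using 3 by (simp add: G_def fps_X_power_mult_nth)
    qed (simp_all add: G_def fps_X_power_mult_nth)
  qed
  have two: "fps_const 2 = (2 :: real fps)" "fps_const 4 = (4 :: real fps)" "fps_const 8 =
      (8 :: real fps)"
    by (simp_all add: fps_numeral_fps_const)
  have "B * B = 1 - 4 * fps_X ^ 2 * G + 4 * fps_X ^ 2 * (fps_X ^ 2 * (G * G))"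
    unfolding B_def two by (simp add: algebra_simps)
  also have "fps_X ^ 2 * (G * G) = G - 1" by (metis G add_diff_cancel_left')
  finally have BB: "B * B = 1 - 4 * fps_X ^ 2" by (simp add: algebra_simps)
  have "fps_deriv (B * B) = fps_deriv (1 - fps_const 4 * fps_X ^ 2)" unfolding BB two ..
  hence "2 * (B * fps_deriv B) = - 8 * fps_X"
    by (simp add: fps_deriv_power two power2_eq_square algebra_simps)
  hence "2 * (B * fps_deriv B) = 2 * (- 4 * fps_X)" by simp
  hence "B * fps_deriv B = - 4 * fps_X" by (subst (asm) mult_cancel_left) simp
  hence "B * (B * fps_deriv B) = B * (- 4 * fps_X)" by simp
  hence "(1 - 4 * fps_X ^ 2) * fps_deriv B = - 4 * (fps_X * B)" unfolding BB[symmetric]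
      by (simp add: mult_ac)
  hence e: "fps_deriv B = fps_const 4 * (fps_X ^ 2 * fps_deriv B) - fps_const 4 * (fps_X * B)"
    unfolding two by (simp add: algebra_simps)
  have b: "fps_nth B (j + 2) = - 2 * catalan_moment j" for j
    by (simp add: B_def G_def mult.assoc fps_X_power_mult_nth)
  have "fps_nth (fps_deriv B) (k + 3) = 4 * fps_nth (fps_deriv B) (k + 1) - 4 * fps_nth B (k + 2)"
    by (subst e) (simp add: fps_X_power_mult_nth del: fps_deriv_nth)
  hence "real (k + 4) * fps_nth B (k + 4) = 4 * (real (k + 2) * fps_nth B (k +
      2)) - 4 * fps_nth B (k + 2)"
    by (simp add: eval_nat_numeral)
  moreover have "fps_nth B (k + 4) = - 2 * catalan_moment (k + 2)" using b[of "k + 2"]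
      by (simp add: eval_nat_numeral)
  ultimately show ?thesis using b[of k] by (simp add: algebra_simps)
qed

lemma catalan_moment_nonneg: "catalan_moment k \<ge> 0"
  by (induction k rule: catalan_moment.induct) (auto intro!: sum_nonneg)

lemma catalan_moment_even_le: "catalan_moment (2 * k) \<le> 4 ^ k"
proof (induction k)
  case (Suc k)
  define x where "x = catalan_moment (2 * k + 2)"
  have "real (2 * k + 4) * x = 4 * real (2 * k + 1) * catalan_moment (2 * k)" unfolding x_def
      by (rule catalan_moment_recursion)
  also have "\<dots> \<le> 4 * real (2 * k + 4) * catalan_moment (2 * k)"
      by (intro mult_right_mono catalan_moment_nonneg) auto
  finally have "real (2 * k + 4) * x \<le> real (2 * k + 4) * (4 * catalan_moment (2 * k))"
      by (simp only: mult_ac)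
  hence "x \<le> 4 * catalan_moment (2 * k)" by (rule mult_left_le_imp_le) simp
  also have "\<dots> \<le> 4 * 4 ^ k" using Suc by simp
  finally show ?case by (simp add: x_def del: catalan_moment.simps)
qed simp

definition semicircle_law :: "real measure" where
  "semicircle_law = density lborel (\<lambda>w. ennreal (semicircle_density w))"

lemma semicircle_density_altdef:
  "semicircle_density w = indicator {-2..2} w * (sqrt (4 - w\<^sup>2) / (2 * pi))"
  by (auto simp: semicircle_density_def indicator_def abs_le_iff)

lemma four_minus_sq: "x \<in> {-2<..<2} \<Longrightarrow> 4 - x\<^sup>2 > (0::real)"
proof -
  assume "x \<in> {-2<..<2}"
  hence "0 < (2 - x) * (2 + x)" by (intro mult_pos_pos) auto
  thus ?thesis by (simp add: power2_eq_square algebra_simps)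
qed

lemma semicircle_density_nonneg: "semicircle_density w \<ge> 0"
proof (cases "\<bar>w\<bar> \<le> 2")
  case True
  hence "w\<^sup>2 \<le> 2\<^sup>2" by (subst abs_le_square_iff[symmetric]) simp
  thus ?thesis using True by (simp add: semicircle_density_def)
qed (simp add: semicircle_density_def)

lemma semicircle_density_pos: "x \<in> {-2<..<2} \<Longrightarrow> semicircle_density x > 0"
  using four_minus_sq[of x] by (auto simp: semicircle_density_def)

lemma semicircle_density_measurable [measurable]: "semicircle_density \<in> borel_measurable borel"
  unfolding semicircle_density_def[abs_def] by measurable

lemma sets_semicircle_law [simp, measurable_cong]: "sets semicircle_law =
    sets borel" and space_semicircle_law [simp]: "space semicircle_law = UNIV"
  by (simp_all add: semicircle_law_def)

text \<open>The moments of the density without the factor \<open>1 / (2 * pi)\<close>.\<close>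

definition semicircle_integral :: "nat \<Rightarrow> real" where
  "semicircle_integral k = integral {-2..2} (\<lambda>x. x ^ k * sqrt (4 - x\<^sup>2))"

lemma semicircle_law_cont: "continuous_on {-2..2} (\<lambda>x::real. x ^ k * sqrt (4 - x\<^sup>2))"
  by (intro continuous_intros)

lemma sqrt_derivative:
  fixes x :: real assumes x: "x \<in> {-2<..<2}"
  shows "((\<lambda>x. sqrt (4 - x\<^sup>2)) has_real_derivative (- x / sqrt (4 - x\<^sup>2))) (at x)"
proof -
  have p: "4 - x\<^sup>2 > 0" by (rule four_minus_sq[OF x])
  have "((\<lambda>x. 4 - x\<^sup>2) has_real_derivative (- (2 * x))) (at x)"
    by (auto intro!: derivative_eq_intros)
  from DERIV_chain2[OF DERIV_real_sqrt[OF p] this] show ?thesis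
    by (rule DERIV_cong) (simp add: field_simps)
qed

lemma semicircle_integral_0: "semicircle_integral 0 = 2 * pi"
proof -
  have "((\<lambda>x. x ^ 0 * sqrt (4 - x\<^sup>2)) has_integral
     ((2 / 2 * sqrt (4 - 2\<^sup>2) + 2 * arcsin (2 / 2)) - ((-2) / 2 * sqrt (4 - (-2)\<^sup>2) +
         2 * arcsin ((-2) / 2)))) {-2..2::real}"
  proof (rule fundamental_theorem_of_calculus_interior[where f =
      "\<lambda>x. x / 2 * sqrt (4 - x\<^sup>2) + 2 * arcsin (x / 2)"])
    show "continuous_on {-2..2} (\<lambda>x::real. x / 2 * sqrt (4 - x\<^sup>2) + 2 * arcsin (x / 2))"
      by (intro continuous_intros) auto
    fix x :: real assume x: "x \<in> {-2<..<2}"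
    have p: "4 - x\<^sup>2 > 0" by (rule four_minus_sq[OF x])
    define s where "s = sqrt (4 - x\<^sup>2)"
    have s: "s > 0" "s\<^sup>2 = 4 - x\<^sup>2" using p by (simp_all add: s_def)
    have s2: "sqrt (1 - (x / 2)\<^sup>2) = s / 2"
    proof -
      have "1 - (x / 2)\<^sup>2 = (s / 2)\<^sup>2" using s by (simp add: power_divide field_simps)
      thus ?thesis using s by simp
    qed
    have "- 1 < x / 2" "x / 2 < 1" using x by auto
    note as = DERIV_arcsin[OF this]
    have "((\<lambda>x. x / 2) has_real_derivative 1 / 2) (at x)" by (auto intro!: derivative_eq_intros)
    note half = this
    have "((\<lambda>x. x / 2 * sqrt (4 - x\<^sup>2) + 2 * arcsin (x / 2)) has_real_derivative
        (1 / 2 * s + (- x / s) * (x / 2) + 2 * (inverse (s / 2) * (1 / 2)))) (at x)"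
      using DERIV_add[OF DERIV_mult[OF half sqrt_derivative[OF x]] DERIV_cmult[OF DERIV_chain2[OF
          as half], of 2]]
      unfolding s2 s_def[symmetric] .
    also have "1 / 2 * s + (- x / s) * (x / 2) + 2 * (inverse (s / 2) * (1 / 2)) = x ^ 0 * s"
      using s by (simp add: field_simps power2_eq_square)
    finally show "((\<lambda>x. x / 2 * sqrt (4 - x\<^sup>2) + 2 * arcsin (x / 2)) has_vector_derivative x ^ 0 *
        sqrt (4 - x\<^sup>2)) (at x)"
      by (simp add: s_def has_real_derivative_iff_has_vector_derivative)
  qed simp
  thus ?thesis unfolding semicircle_integral_def by (simp add: integral_unique arcsin_minus)
qed

lemma sqrt_cubed_derivative:
  fixes x :: real assumes x: "x \<in> {-2<..<2}"
  shows "((\<lambda>x. x ^ j * sqrt (4 - x\<^sup>2) ^ 3) has_real_derivative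
     (real j * x ^ (j - 1) * (4 - x\<^sup>2) * sqrt (4 - x\<^sup>2) - 3 * (x ^ (j +
         1) * sqrt (4 - x\<^sup>2)))) (at x)"
proof -
  have p: "4 - x\<^sup>2 > 0" by (rule four_minus_sq[OF x])
  define s where "s = sqrt (4 - x\<^sup>2)"
  have s: "s > 0" "s\<^sup>2 = 4 - x\<^sup>2" using p by (simp_all add: s_def)
  have "((\<lambda>x. x ^ j * sqrt (4 - x\<^sup>2) ^ 3) has_real_derivative
     (real j * x ^ (j - Suc 0)) * s ^ 3 + (of_nat 3 * ((- x / s) * s ^ (3 -
         Suc 0))) * x ^ j) (at x)"
    using DERIV_mult[OF DERIV_pow[of j x] DERIV_power[OF sqrt_derivative[OF x], of 3]]
        unfolding s_def[symmetric] .
  also have "s ^ 3 = (4 - x\<^sup>2) * s" using s by (simp add: power3_eq_cube power2_eq_square)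
  also have "of_nat 3 * ((- x / s) * s ^ (3 - Suc 0)) = - 3 * (x * s)"
    using s(1) by (simp add: power2_eq_square numeral_eq_Suc)
  finally show ?thesis by (simp add: s_def algebra_simps)
qed

lemma semicircle_integral_1: "semicircle_integral 1 = 0"
proof -
  have "((\<lambda>x. - 3 * (x ^ 1 * sqrt (4 - x\<^sup>2))) has_integral
     (2 ^ 0 * sqrt (4 - 2\<^sup>2) ^ 3 - (-2) ^ 0 * sqrt (4 - (-2)\<^sup>2) ^ 3)) {-2..2::real}"
    by (rule fundamental_theorem_of_calculus_interior[where f = "\<lambda>x. x ^ 0 * sqrt (4 - x\<^sup>2) ^ 3"])
      (use sqrt_cubed_derivative[of _ 0] in \<open>auto intro!: continuous_intros simp:
          has_real_derivative_iff_has_vector_derivative[symmetric]\<close>)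
  from integral_unique[OF this] have "- 3 * semicircle_integral 1 = 0"
    unfolding integral_mult_right semicircle_integral_def by simp
  thus ?thesis by simp
qed

text \<open>Integrate the derivative of \<open>x ^ (k + 1) * sqrt (4 - x^2) ^ 3\<close>, which vanishes at both ends.\<close>

lemma semicircle_integral_rec: "real (k + 4) * semicircle_integral (k + 2) =
    4 * real (k + 1) * semicircle_integral k"
proof -
  have "((\<lambda>x. 4 * real (k + 1) * (x ^ k * sqrt (4 - x\<^sup>2)) - real (k + 4) * (x ^ (k +
      2) * sqrt (4 - x\<^sup>2))) has_integral
     (2 ^ (k + 1) * sqrt (4 - 2\<^sup>2) ^ 3 - (-2) ^ (k + 1) * sqrt (4 - (-2)\<^sup>2) ^ 3)) {-2..2::real}"
  proof (rule fundamental_theorem_of_calculus_interior[where f =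
      "\<lambda>x. x ^ (k + 1) * sqrt (4 - x\<^sup>2) ^ 3"])
    fix x :: real assume x: "x \<in> {-2<..<2}"
    have "4 * real (k + 1) * (x ^ k * s) - real (k + 4) * (x ^ (k + 2) * s) =
      real (k + 1) * x ^ (k + 1 - 1) * (4 - x\<^sup>2) * s - 3 * (x ^ (k + 1 + 1) * s)" for s
      by (simp add: algebra_simps power2_eq_square)
    thus "((\<lambda>x. x ^ (k + 1) * sqrt (4 - x\<^sup>2) ^ 3) has_vector_derivative
       4 * real (k + 1) * (x ^ k * sqrt (4 - x\<^sup>2)) - real (k + 4) * (x ^ (k +
           2) * sqrt (4 - x\<^sup>2))) (at x)"
      using sqrt_cubed_derivative[OF x, of "k + 1"]
      unfolding has_real_derivative_iff_has_vector_derivative[symmetric] by metis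
  qed (auto intro!: continuous_intros)
  hence "integral {-2..2} (\<lambda>x::real. 4 * real (k + 1) * (x ^ k * sqrt (4 - x\<^sup>2)) - real (k +
      4) * (x ^ (k + 2) * sqrt (4 - x\<^sup>2))) = 0"
    by (simp add: integral_unique)
  also have "integral {-2..2} (\<lambda>x::real. 4 * real (k + 1) * (x ^ k * sqrt (4 - x\<^sup>2)) - real (k +
      4) * (x ^ (k + 2) * sqrt (4 - x\<^sup>2))) =
    4 * real (k + 1) * semicircle_integral k - real (k + 4) * semicircle_integral (k + 2)"
    unfolding semicircle_integral_def
    by (subst Henstock_Kurzweil_Integration.integral_diff)
      (auto intro!: integrable_continuous_interval continuous_intros simp del: of_nat_add)
  finally show ?thesis by simp
qed

lemma semicircle_integral_eq: "semicircle_integral k = 2 * pi * catalan_moment k"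
proof (induction k rule: catalan_moment.induct)
  case (3 k)
  have IH: "semicircle_integral k = 2 * pi * catalan_moment k" using 3(1)[of k] by simp
  have "real (k + 4) * semicircle_integral (k + 2) = real (k + 4) * (2 * pi * catalan_moment (k +
      2))"
    unfolding semicircle_integral_rec IH using catalan_moment_recursion[of k] by (simp add: mult_ac)
  hence "semicircle_integral (k + 2) = 2 * pi * catalan_moment (k + 2)"
      by (subst (asm) mult_cancel_left) simp
  thus ?case by simp
qed (use semicircle_integral_0 semicircle_integral_1 in simp_all)

lemma semicircle_law_moment_lborel:
  "integrable lborel (\<lambda>x. semicircle_density x * x ^ k)"
  "integral\<^sup>L lborel (\<lambda>x. semicircle_density x * x ^ k) = catalan_moment k"
proof -
  have si: "set_integrable lborel {-2..2} (\<lambda>x::real. x ^ k * sqrt (4 - x\<^sup>2))"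
    by (intro borel_integrable_atLeastAtMost' semicircle_law_cont)
  have e: "(\<lambda>x. semicircle_density x * x ^ k) = (\<lambda>x. (1 / (2 * pi)) *
      (indicator {-2..2} x *\<^sub>R (x ^ k * sqrt (4 - x\<^sup>2))))"
    by (auto simp: fun_eq_iff semicircle_density_altdef)
  show "integrable lborel (\<lambda>x. semicircle_density x * x ^ k)"
    unfolding e using si unfolding set_integrable_def by (rule integrable_mult_right)
  have "integral\<^sup>L lborel (\<lambda>x. semicircle_density x * x ^ k) =
      (1 / (2 * pi)) * (LINT x:{-2..2}|lborel. x ^ k * sqrt (4 - x\<^sup>2))"
    unfolding e set_lebesgue_integral_def by (rule integral_mult_right_zero)
  also have "\<dots> = catalan_moment k" using set_borel_integral_eq_integral(2)[OF si]
      semicircle_integral_eq[of k] by (simp add: semicircle_integral_def)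
  finally show "integral\<^sup>L lborel (\<lambda>x. semicircle_density x * x ^ k) = catalan_moment k" .
qed

lemma semicircle_law_moments: "integrable semicircle_law (\<lambda>x. x ^ k)" "integral\<^sup>L semicircle_law
    (\<lambda>x. x ^ k) = catalan_moment k"
  unfolding semicircle_law_def using semicircle_law_moment_lborel[of k]
  by (simp_all add: integrable_density integral_density semicircle_density_nonneg)

lemma real_distribution_semicircle_law: "real_distribution semicircle_law"
proof -
  have "emeasure semicircle_law (space semicircle_law) = (\<integral>\<^sup>+ x. ennreal (semicircle_density x)
      \<partial>lborel)"
    unfolding semicircle_law_def by (subst emeasure_density) auto
  also have "\<dots> = ennreal (integral\<^sup>L lborel semicircle_density)"
    using semicircle_law_moment_lborel(1)[of 0] by (intro nn_integral_eq_integral) (auto simp: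
        semicircle_density_nonneg)
  also have "\<dots> = 1" using semicircle_law_moment_lborel(2)[of 0] by simp
  finally have "prob_space semicircle_law" by (rule prob_spaceI)
  thus ?thesis by (simp add: real_distribution_def real_distribution_axioms_def)
qed

interpretation sc: real_distribution semicircle_law by (rule real_distribution_semicircle_law)

lemma semicircle_law_measure_0: "measure semicircle_law {x} = 0"
proof -
  have "emeasure semicircle_law {x} = (\<integral>\<^sup>+ y. ennreal (semicircle_density y) *
      indicator {x} y \<partial>lborel)"
    unfolding semicircle_law_def by (subst emeasure_density) auto
  also have "\<dots> = 0" by (subst nn_integral_0_iff_AE) (auto intro!: AE_I[of _ _ "{x}"] simp:
      indicator_def)
  finally show ?thesis by (simp add: measure_def)
qed

lemma isCont_semicircle_law: "isCont (cdf semicircle_law) x"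
  using sc.isCont_cdf semicircle_law_measure_0 by simp

lemma semicircle_law_interval_pos:
  assumes "-2 \<le> a" "a < b" "b \<le> 2" shows "cdf semicircle_law a < cdf semicircle_law b"
proof -
  have "measure semicircle_law {a<..b} \<noteq> 0"
  proof
    assume "measure semicircle_law {a<..b} = 0"
    hence "emeasure semicircle_law {a<..b} = 0" by (simp add: sc.emeasure_eq_measure)
    hence "(\<integral>\<^sup>+ y. ennreal (semicircle_density y) * indicator {a<..b} y \<partial>lborel) = 0"
      unfolding semicircle_law_def by (subst (asm) emeasure_density) auto
    hence "AE y in lborel. ennreal (semicircle_density y) * indicator {a<..b} y = 0"
      by (subst (asm) nn_integral_0_iff_AE) auto
    hence "AE y in lborel. y \<notin> {a<..<b}"
    proof eventually_elim
      case (elim y)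
      show ?case
      proof
        assume y: "y \<in> {a<..<b}"
        have "semicircle_density y > 0" by (rule semicircle_density_pos) (use y assms in auto)
        thus False using elim y by (auto simp: indicator_def ennreal_eq_0_iff)
      qed
    qed
    hence "{a<..<b} \<in> null_sets lborel" by (subst AE_iff_null_sets) auto
    hence "emeasure lborel {a<..<b} = 0" by (rule null_setsD1)
    thus False using assms by simp
  qed
  hence "measure semicircle_law {a<..b} > 0" by (simp add: zero_less_measure_iff)
  thus ?thesis using sc.cdf_diff_eq[OF assms(2)] by simp
qed

lemma semicircle_law_outside: "measure semicircle_law {..-2} = 0" "measure semicircle_law {2<..} =
    0"
proof -
  have o: "measure semicircle_law A = 0" if "A \<in> sets borel" "\<And>y. y \<in> A \<Longrightarrow> semicircle_density y =
      0" for A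
  proof -
    have "emeasure semicircle_law A = (\<integral>\<^sup>+ y. ennreal (semicircle_density y) *
        indicator A y \<partial>lborel)"
      unfolding semicircle_law_def using that(1) by (subst emeasure_density) auto
    also have "(\<lambda>y. ennreal (semicircle_density y) * indicator A y) = (\<lambda>y. 0)"
      using that(2) by (auto simp: fun_eq_iff indicator_def)
    finally show ?thesis by (simp add: measure_def)
  qed
  show "measure semicircle_law {..-2} = 0"
  proof (rule o)
    fix y :: real assume "y \<in> {..-2}"
    hence "y = -2 \<or> y < -2" by auto
    thus "semicircle_density y = 0" by (auto simp: semicircle_density_def)
  qed simp
  show "measure semicircle_law {2<..} = 0" by (rule o) (auto simp: semicircle_density_def)
qed

lemma cdf_semicircle_law_ends: "cdf semicircle_law (-2) = 0" "cdf semicircle_law 2 = 1"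
proof -
  show "cdf semicircle_law (-2) = 0" using semicircle_law_outside(1) by (simp add: cdf_def)
  have "measure semicircle_law (UNIV - {2<..}) = 1 - measure semicircle_law {2<..}"
      using sc.prob_compl[of "{2<..}"] by simp
  moreover have "UNIV - {2<..} = {..2::real}" by auto
  ultimately show "cdf semicircle_law 2 = 1" using semicircle_law_outside(2) by (simp add: cdf_def)
qed

text \<open>The distribution function is continuous and strictly increasing on the support.\<close>

lemma quantile_semicircle_law:
  assumes "0 < u" "u < 1"
  shows "\<exists>w. (\<forall>y<w. cdf semicircle_law y < u) \<and> (\<forall>y>w. u < cdf semicircle_law y)"
proof -
  have "\<exists>w\<ge>-2. w \<le> 2 \<and> cdf semicircle_law w = u"
    by (rule IVT) (use assms cdf_semicircle_law_ends isCont_semicircle_law in auto)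
  then obtain w where w: "-2 \<le> w" "w \<le> 2" "cdf semicircle_law w = u" by blast
  have ne: "w \<noteq> -2" "w \<noteq> 2" using w assms cdf_semicircle_law_ends by auto
  have "cdf semicircle_law y < u" if "y < w" for y
  proof -
    have "cdf semicircle_law y \<le> cdf semicircle_law (max y (-2))"
        by (rule sc.cdf_nondecreasing) simp
    also have "\<dots> < cdf semicircle_law w" using that w ne by (intro semicircle_law_interval_pos) auto
    finally show ?thesis using w by simp
  qed
  moreover have "u < cdf semicircle_law y" if "y > w" for y
  proof -
    have "cdf semicircle_law w < cdf semicircle_law (min y 2)" using that w ne
        by (intro semicircle_law_interval_pos) auto
    also have "\<dots> \<le> cdf semicircle_law y" by (rule sc.cdf_nondecreasing) simp
    finally show ?thesis using w by simp
  qed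
  ultimately show ?thesis by blast
qed

text \<open>The moments of the semicircle law grow only exponentially, so the Taylor expansions of the
  characteristic functions converge, and Levy's continuity theorem applies.\<close>

lemma method_of_moments:
  fixes P :: "nat \<Rightarrow> real measure"
  assumes P: "\<And>n. real_distribution (P n)" and int: "\<And>n k. integrable (P n) (\<lambda>x. x ^ k)"
    and lim: "\<And>k. (\<lambda>n. integral\<^sup>L (P n) (\<lambda>x. x ^ k)) \<longlonglongrightarrow> catalan_moment k"
  shows "weak_conv_m P semicircle_law"
proof (rule levy_continuity[OF P real_distribution_semicircle_law])
  fix t :: real
  \<comment> \<open>Taylor expansion of both characteristic functions up to order \<open>2 k\<close>; the remainders are small
    for large \<open>k\<close>.\<close>
  define err where "err k = 2 * \<bar>t\<bar> ^ (2 * k) / fact (2 * k)" for k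
  define T where "T n k = (\<Sum>j\<le>2 * k. ((\<i> * t) ^ j / fact j) * integral\<^sup>L (P n) (\<lambda>x. x ^ j))" for n k
  define S where "S k = (\<Sum>j\<le>2 * k. ((\<i> * t) ^ j / fact j) *
      complex_of_real (catalan_moment j))" for k
  have errn: "err k \<ge> 0" for k by (simp add: err_def)
  have e1: "cmod (char (P n) t - T n k) \<le> err k * integral\<^sup>L (P n) (\<lambda>x. x ^ (2 * k))" for n k
    using real_distribution.char_approx1[OF P[of n] int, where n = "2 * k" and t =
        t] by (simp add: T_def err_def power_even_abs)
  have e2: "cmod (char semicircle_law t - S k) \<le> err k * catalan_moment (2 * k)" for k
    using sc.char_approx1[where n = "2 * k" and t = t, OF semicircle_law_moments(1)]
        by (simp add: S_def err_def power_even_abs semicircle_law_moments(2))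
  have TS: "(\<lambda>n. T n k) \<longlonglongrightarrow> S k" for k
    unfolding T_def S_def by (intro tendsto_intros tendsto_of_real lim)
  have err0: "(\<lambda>k. err k * 4 ^ k) \<longlonglongrightarrow> 0"
  proof -
    have "(\<lambda>n. inverse (fact n) * (2 * \<bar>t\<bar>) ^ n) \<longlonglongrightarrow> 0"
      using summable_exp[of "2 * \<bar>t\<bar>"] by (rule summable_LIMSEQ_zero)
    from LIMSEQ_subseq_LIMSEQ[OF this, of "\<lambda>k. 2 * k"]
    have "(\<lambda>k. inverse (fact (2 * k)) * (2 * \<bar>t\<bar>) ^ (2 * k)) \<longlonglongrightarrow> 0"
      by (simp add: o_def strict_mono_def)
    hence "(\<lambda>k. 2 * (inverse (fact (2 * k)) * (2 * \<bar>t\<bar>) ^ (2 * k))) \<longlonglongrightarrow> 2 * 0"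
      by (intro tendsto_mult tendsto_const)
    moreover have "2 * (inverse (fact (2 * k)) * (2 * \<bar>t\<bar>) ^ (2 * k)) = err k * 4 ^ k" for k
    proof -
      have "(4::real) ^ k = 2 ^ (2 * k)" by (simp add: power_mult)
      thus ?thesis unfolding err_def by (simp only: power_mult_distrib divide_inverse mult_ac)
    qed
    ultimately show ?thesis by (simp only: mult_zero_right)
  qed
  show "(\<lambda>n. char (P n) t) \<longlonglongrightarrow> char semicircle_law t"
  proof (rule LIMSEQ_I)
    fix r :: real assume r: "r > 0"
    obtain k where "norm (err k * 4 ^ k - 0) < r / 4"
      using LIMSEQ_D[OF err0, of "r / 4"] r by auto
    hence k: "err k * 4 ^ k < r / 4" by simp
    have kc: "err k * catalan_moment (2 * k) < r / 4"
      using k mult_left_mono[OF catalan_moment_even_le errn, of k k] by linarith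
    have "(\<lambda>n. err k * integral\<^sup>L (P n) (\<lambda>x. x ^ (2 * k))) \<longlonglongrightarrow> err k * catalan_moment (2 * k)"
      by (intro tendsto_intros lim)
    hence "eventually (\<lambda>n. err k * integral\<^sup>L (P n) (\<lambda>x. x ^ (2 * k)) < r / 4) sequentially"
      using kc by (rule order_tendstoD)
    moreover have "eventually (\<lambda>n. dist (T n k) (S k) < r / 4) sequentially"
      using TS r by (intro tendstoD) auto
    ultimately have "eventually (\<lambda>n. norm (char (P n) t - char semicircle_law t) < r) sequentially"
    proof eventually_elim
      case (elim n)
      have "norm (char (P n) t - char semicircle_law t) \<le> cmod (char (P n) t - T n k) +
          cmod (T n k - S k) + cmod (S k - char semicircle_law t)"
        by (smt (verit) norm_diff_triangle_ineq norm_triangle_ineq diff_add_cancel add_diff_eq)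
      also have "cmod (S k - char semicircle_law t) = cmod (char semicircle_law t - S k)"
          by (rule norm_minus_commute)
      finally show ?case using e1[of n k] e2[of k] elim kc r unfolding dist_norm by linarith
    qed
    thus "\<exists>no. \<forall>n\<ge>no. norm (char (P n) t - char semicircle_law t) <
        r" by (simp add: eventually_sequentially)
  qed
qed

definition transition_law :: "nat list \<Rightarrow> real \<Rightarrow> real measure" where
  "transition_law \<mu> s = distr (point_measure (addable \<mu>) (\<lambda>c. ennreal (trans_prob \<mu> c))) borel
      (\<lambda>c. real_of_int c / s)"

lemma transition_law:
  assumes y: "young_diagram \<mu>"
  shows "real_distribution (transition_law \<mu> s)"
    and "integrable (transition_law \<mu> s) (\<lambda>x. x ^ k)"
    and "integral\<^sup>L (transition_law \<mu> s) (\<lambda>x. x ^ k) = moment \<mu> k / s ^ k"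
    and "cdf (transition_law \<mu> s) x = (\<Sum>c\<in>addable \<mu>. trans_prob \<mu> c * of_bool (real_of_int c / s \<le>
        x))"
proof -
  let ?N = "point_measure (addable \<mu>) (\<lambda>c. ennreal (trans_prob \<mu> c))"
  interpret N: prob_space ?N
    by (rule prob_space_point_measure) (auto simp: finite_addable trans_prob_nonneg
        trans_prob_sum[OF y])
  have meas: "(\<lambda>c. real_of_int c / s) \<in> measurable ?N borel" by simp
  show "real_distribution (transition_law \<mu> s)" unfolding transition_law_def using meas
      by (rule N.real_distribution_distr)
  have i: "integrable ?N g" for g :: "int \<Rightarrow> real"
    by (rule integrable_point_measure_finite) (rule finite_addable)
  show "integrable (transition_law \<mu> s) (\<lambda>x. x ^ k)"
    unfolding transition_law_def by (subst integrable_distr_eq[OF meas]) (auto intro: i)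
  show "integral\<^sup>L (transition_law \<mu> s) (\<lambda>x. x ^ k) = moment \<mu> k / s ^ k"
    unfolding transition_law_def
    by (subst integral_distr[OF meas])
      (auto simp: lebesgue_integral_point_measure_finite finite_addable trans_prob_nonneg
          moment_def power_divide sum_divide_distrib)
  have "cdf (transition_law \<mu> s) x = measure ?N {c \<in> addable \<mu>. real_of_int c / s \<le> x}"
    unfolding cdf_def transition_law_def
    by (subst measure_distr[OF meas]) (auto simp: space_point_measure intro!: arg_cong[where f =
        "measure ?N"])
  also have "\<dots> = (\<Sum>c\<in>{c \<in> addable \<mu>. real_of_int c / s \<le> x}. trans_prob \<mu> c)"
    by (subst measure_point_measure_finite_if) (auto simp: finite_addable trans_prob_nonneg)
  also have "\<dots> = (\<Sum>c\<in>addable \<mu>. trans_prob \<mu> c * of_bool (real_of_int c / s \<le> x))"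
    by (simp add: sum.inter_filter[OF finite_addable] of_bool_def if_distrib cong: if_cong)
  finally show "cdf (transition_law \<mu> s) x = (\<Sum>c\<in>addable \<mu>. trans_prob \<mu> c *
      of_bool (real_of_int c / s \<le> x))" .
qed

lemma transition_law_weak_conv:
  assumes y: "\<And>n. young_diagram (l n)"
    and m: "\<And>m. (\<lambda>n. moment (l n) m / sqrt (real n) ^ m) \<longlonglongrightarrow> catalan_moment m"
  shows "(\<lambda>n. cdf (transition_law (l n) (sqrt (real n))) x) \<longlonglongrightarrow> cdf semicircle_law x"
proof -
  have "weak_conv_m (\<lambda>n. transition_law (l n) (sqrt (real n))) semicircle_law"
    by (rule method_of_moments) (simp_all add: transition_law y m)
  thus ?thesis using isCont_semicircle_law by (simp add: weak_conv_m_def weak_conv_def)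
qed


section \<open>The law of the second-class particle and its martingale\<close>

definition diagrams :: "nat \<Rightarrow> nat list set" where
  "diagrams N = {\<mu>. young_diagram \<mu> \<and> sum_list \<mu> = N}"

lemma diagrams_0: "diagrams 0 = {[]}"
  using young_sum_0 young_Nil by (auto simp: diagrams_def)

lemma bij_up_down:
  "bij_betw (\<lambda>(\<mu>, b). (up \<mu> b, b)) (SIGMA \<mu>:diagrams N. addable \<mu>) (SIGMA \<nu>:diagrams (Suc N).
      removable \<nu>)"
proof (rule bij_betw_byWitness[where f' = "\<lambda>(\<nu>, b). (down \<nu> b, b)"])
  have u: "up \<mu> b \<in> diagrams (Suc N) \<and> b \<in> removable (up \<mu> b) \<and> down (up \<mu> b) b = \<mu>"
    if "\<mu> \<in> diagrams N" "b \<in> addable \<mu>" for \<mu> b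
  proof -
    have s: "step \<mu> b (up \<mu> b)" using that step_up by (simp add: diagrams_def)
    hence "young_diagram (up \<mu> b)" "b \<in> removable (up \<mu> b)" "\<mu> = down (up \<mu> b) b"
      using step_iff_down by blast+
    thus ?thesis using step_sum[OF s] that by (simp add: diagrams_def)
  qed
  have d: "down \<nu> b \<in> diagrams N \<and> b \<in> addable (down \<nu> b) \<and> up (down \<nu> b) b = \<nu>"
    if "\<nu> \<in> diagrams (Suc N)" "b \<in> removable \<nu>" for \<nu> b
  proof -
    have s: "step (down \<nu> b) b \<nu>" using that step_down by (simp add: diagrams_def)
    hence "young_diagram (down \<nu> b)" "b \<in> addable (down \<nu> b)" "\<nu> = up (down \<nu> b) b"
      using step_iff_up by blast+
    thus ?thesis using step_sum[OF s] that by (simp add: diagrams_def)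
  qed
  show "\<forall>a\<in>(SIGMA \<mu>:diagrams N. addable \<mu>). (\<lambda>(\<nu>, b). (down \<nu> b, b)) ((\<lambda>(\<mu>, b). (up \<mu> b, b)) a) = a"
    using u by auto
  show "\<forall>a\<in>(SIGMA \<nu>:diagrams (Suc N). removable \<nu>). (\<lambda>(\<mu>, b). (up \<mu> b, b)) ((\<lambda>(\<nu>, b). (down \<nu> b,
      b)) a) = a"
    using d by auto
  show "(\<lambda>(\<mu>, b). (up \<mu> b, b)) ` (SIGMA \<mu>:diagrams N. addable \<mu>) \<subseteq> (SIGMA \<nu>:diagrams (Suc N).
      removable \<nu>)"
    using u by auto
  show "(\<lambda>(\<nu>, b). (down \<nu> b, b)) ` (SIGMA \<nu>:diagrams (Suc N). removable \<nu>) \<subseteq> (SIGMA \<mu>:diagrams N.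
      addable \<mu>)"
    using d by auto
qed

lemma removable_nonempty:
  assumes "\<nu> \<in> diagrams (Suc N)" shows "removable \<nu> \<noteq> {}"
proof
  assume "removable \<nu> = {}"
  hence "num_tableaux \<nu> = 0" using num_tableaux_branching[of \<nu>] assms by (simp add: diagrams_def)
  thus False using num_tableaux_pos[of \<nu>] assms by (simp add: diagrams_def)
qed

lemma finite_diagrams: "finite (diagrams N)"
proof (induction N)
  case (Suc N)
  hence "finite (SIGMA \<mu>:diagrams N. addable \<mu>)" by (intro finite_SigmaI finite_addable)
  hence "finite (SIGMA \<nu>:diagrams (Suc N). removable \<nu>)" using bij_betw_finite[OF bij_up_down]
      by blast
  hence "finite (fst ` (SIGMA \<nu>:diagrams (Suc N). removable \<nu>))" by (rule finite_imageI)
  moreover have "diagrams (Suc N) \<subseteq> fst ` (SIGMA \<nu>:diagrams (Suc N). removable \<nu>)"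
    using removable_nonempty by force
  ultimately show ?case by (rule finite_subset[rotated])
qed (simp add: diagrams_0)

text \<open>Adding a box and removing it are mutually inverse.\<close>

lemma sum_up_down:
  "(\<Sum>\<mu>\<in>diagrams N. \<Sum>b\<in>addable \<mu>. G \<mu> b (up \<mu> b)) =
   (\<Sum>\<nu>\<in>diagrams (Suc N). \<Sum>b\<in>removable \<nu>. G (down \<nu> b) b \<nu> :: real)"
proof -
  have "(\<Sum>\<mu>\<in>diagrams N. \<Sum>b\<in>addable \<mu>. G \<mu> b (up \<mu> b)) = (\<Sum>(\<mu>, b)\<in>(SIGMA \<mu>:diagrams N. addable \<mu>).
      G \<mu> b (up \<mu> b))"
    by (rule sum.Sigma) (auto simp: finite_diagrams finite_addable)
  also have "\<dots> = (\<Sum>(\<mu>, b)\<in>(SIGMA \<mu>:diagrams N. addable \<mu>). (\<lambda>(\<nu>, b). G (down \<nu> b) b \<nu>) (up \<mu> b, b))"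
  proof (intro sum.cong refl)
    fix x assume "x \<in> (SIGMA \<mu>:diagrams N. addable \<mu>)"
    then obtain \<mu> b where x: "x = (\<mu>, b)" "young_diagram \<mu>" "b \<in> addable \<mu>"
        by (auto simp: diagrams_def)
    hence "step \<mu> b (up \<mu> b)" by (intro step_up)
    hence "\<mu> = down (up \<mu> b) b" using step_iff_down by blast
    thus "(case x of (\<mu>, b) \<Rightarrow> G \<mu> b (up \<mu> b)) =
      (case x of (\<mu>, b) \<Rightarrow> (\<lambda>(\<nu>, b). G (down \<nu> b) b \<nu>) (up \<mu> b, b))" by (simp add: x(1))
  qed
  also have "\<dots> = (\<Sum>(\<nu>, b)\<in>(SIGMA \<nu>:diagrams (Suc N). removable \<nu>). G (down \<nu> b) b \<nu>)"
    using sum.reindex_bij_betw[OF bij_up_down, of "\<lambda>(\<nu>, b). G (down \<nu> b) b \<nu>" N]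
        by (simp add: case_prod_beta')
  also have "\<dots> = (\<Sum>\<nu>\<in>diagrams (Suc N). \<Sum>b\<in>removable \<nu>. G (down \<nu> b) b \<nu>)"
    by (rule sum.Sigma[symmetric]) (auto simp: finite_diagrams finite_removable)
  finally show ?thesis .
qed

lemma trans_prob_up:
  assumes "\<mu> \<in> diagrams N" "b \<in> addable \<mu>"
  shows "real (num_tableaux \<mu>) * trans_prob \<mu> b = real (num_tableaux (up \<mu> b)) / real (Suc N)"
proof -
  have y: "young_diagram \<mu>" "sum_list \<mu> = N" using assms by (auto simp: diagrams_def)
  show ?thesis unfolding trans_prob_step[OF step_up[OF y(1) assms(2)]]
      using num_tableaux_pos[OF y(1)] y(2)
    by simp
qed

text \<open>The second-class particle as a function of a history, which ends with the diagram at time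
  \<open>length h - 2\<close>.\<close>

definition pathpos :: "nat list list \<Rightarrow> int" where
  "pathpos h = second_class_particle (\<lambda>k. h ! k) (length h - 2)"

lemma pathpos_Suc:
  assumes h: "h \<in> paths (Suc m)" and c: "c \<in> addable (last h)"
  shows "pathpos (h @ [up (last h) c]) = move (pathpos h) c"
proof -
  let ?p = "\<lambda>k. (h @ [up (last h) c]) ! k"
  have len: "length h = Suc (Suc m)" using h by (simp add: paths_def)
  have "step (?p (Suc m)) c (?p (Suc (Suc m)))"
    using step_up[OF paths_young[OF h] c] len paths_last[OF h] by (simp add: nth_append)
  from second_class_particle_Suc[OF this] have "pathpos (h @ [up (last h) c]) =
      move (second_class_particle ?p m) c"
    using len by (simp add: pathpos_def)
  also have "second_class_particle ?p m = second_class_particle (\<lambda>k. h ! k) m"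
      by (rule second_class_particle_cong) (use len in \<open>simp add: nth_append\<close>)
  finally show ?thesis using len by (simp add: pathpos_def)
qed

lemma pathpos_removable:
  assumes h: "h \<in> paths (Suc m)" shows "pathpos h \<in> removable (last h)"
proof -
  have "second_class_particle (\<lambda>k. h ! k) m \<in> removable (h ! Suc m)"
    by (rule second_class_particle_removable) (use h in \<open>auto simp: paths_def\<close>)
  thus ?thesis using h paths_last[OF h] by (simp add: pathpos_def paths_def)
qed

lemma right_mass_bounds:
  assumes "young_diagram \<mu>" shows "0 \<le> right_mass \<mu> X" "right_mass \<mu> X \<le> 1"
proof -
  show "0 \<le> right_mass \<mu> X" unfolding right_mass_def by (intro sum_nonneg mult_nonneg_nonneg
      trans_prob_nonneg) auto
  have "right_mass \<mu> X \<le> (\<Sum>c\<in>addable \<mu>. trans_prob \<mu> c)"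
    unfolding right_mass_def by (intro sum_mono) (simp add: trans_prob_nonneg)
  thus "right_mass \<mu> X \<le> 1" by (simp add: trans_prob_sum[OF assms])
qed

lemma right_mass_cdf:
  assumes y: "young_diagram \<mu>" and s: "s > 0"
  shows "1 - right_mass \<mu> X = cdf (transition_law \<mu> s) (real_of_int X / s)"
proof -
  have "cdf (transition_law \<mu> s) (real_of_int X / s) + right_mass \<mu> X =
      (\<Sum>c\<in>addable \<mu>. trans_prob \<mu> c)"
    unfolding transition_law(4)[OF y] right_mass_def sum.distrib[symmetric]
    using s by (intro sum.cong refl) (auto simp: divide_le_cancel)
  thus ?thesis by (simp add: trans_prob_sum[OF y])
qed

lemma addable_Nil: "addable [] = {0}"
  by (auto simp: addable_def maya_Nil)

context plancherel_growth_process
begin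

definition X :: "nat \<Rightarrow> 'a \<Rightarrow> int" where
  "X n \<omega> = second_class_particle (\<lambda>k. \<Lambda> k \<omega>) n"

lemma X_pathpos: "X n \<omega> = pathpos (hist (Suc n) \<omega>)"
  unfolding X_def pathpos_def by (simp, rule second_class_particle_cong) (simp add: le_Suc_eq)

lemma X_measurable [measurable]: "(\<lambda>\<omega>. real_of_int (X n \<omega>)) \<in> borel_measurable M"
  unfolding X_pathpos by (rule borel_hist)

lemma expectation_X_Suc:
  fixes F :: "nat list \<Rightarrow> int \<Rightarrow> real"
  shows "expectation (\<lambda>\<omega>. F (\<Lambda> (Suc (Suc n)) \<omega>) (X (Suc n) \<omega>)) = expectation (\<lambda>\<omega>.
    \<Sum>b\<in>addable (\<Lambda> (Suc n) \<omega>). trans_prob (\<Lambda> (Suc n) \<omega>) b * F (up (\<Lambda> (Suc n) \<omega>) b) (move (X n \<omega>) b))"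
proof -
  let ?G = "\<lambda>h Y. \<Sum>b\<in>addable (last h). trans_prob (last h) b * F (up (last h) b) (Y b)"
  have "expectation (\<lambda>\<omega>. F (\<Lambda> (Suc (Suc n)) \<omega>) (X (Suc n) \<omega>)) =
      expectation (\<lambda>\<omega>. ?G (hist (Suc n) \<omega>) (\<lambda>b. pathpos (hist (Suc n) \<omega> @ [up (last (hist (Suc n)
          \<omega>)) b])))"
    using expectation_hist_Suc[of "\<lambda>h. F (last h) (pathpos h)" "Suc n"] by (simp add: X_pathpos)
  also have "\<dots> = expectation (\<lambda>\<omega>. ?G (hist (Suc n) \<omega>) (move (pathpos (hist (Suc n) \<omega>))))"
    by (rule expectation_cong_paths[where f = "\<lambda>h. ?G h (\<lambda>b. pathpos (h @ [up (last h) b]))"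
          and g = "\<lambda>h. ?G h (move (pathpos h))"]) (simp add: pathpos_Suc)
  finally show ?thesis by (simp add: X_pathpos)
qed

text \<open>By induction on \<open>n\<close>. Expanding one step and summing over the pairs that lead to the same
  corner \<open>d\<close>, \<open>slide_preimages\<close> and the branching rule give the number of tableaux of the diagram
  without \<open>d\<close>.\<close>

theorem X_joint_law:
  fixes F :: "nat list \<Rightarrow> int \<Rightarrow> real"
  shows "expectation (\<lambda>\<omega>. F (\<Lambda> (Suc n) \<omega>) (X n \<omega>)) = (\<Sum>\<nu>\<in>diagrams (Suc n). \<Sum>c\<in>removable \<nu>.
    real (num_tableaux (down \<nu> c)) * (real (num_tableaux \<nu>) / fact (Suc n)) * F \<nu> c)"
proof (induction n arbitrary: F)
  case 0
  have tp0: "trans_prob [] 0 = 1" using trans_prob_sum[OF young_Nil] by (simp add: addable_Nil)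
  have "expectation (\<lambda>\<omega>. F (\<Lambda> (Suc 0) \<omega>) (X 0 \<omega>)) = expectation (\<lambda>\<omega>.
      \<Sum>b\<in>addable (\<Lambda> 0 \<omega>). trans_prob (\<Lambda> 0 \<omega>) b * F (up (\<Lambda> 0 \<omega>) b) 0)"
    using expectation_hist_Suc[of "\<lambda>h. F (last h) 0" 0] by (simp add: X_def)
  also have "\<dots> = expectation (\<lambda>\<omega>. F (up [] 0) 0)"
    using expectation_cong_paths[of 0 "\<lambda>h. \<Sum>b\<in>addable (last h). trans_prob (last h) b *
        F (up (last h) b) 0" "\<lambda>h. F (up [] 0) 0"]
    by (simp add: paths_0 addable_Nil tp0)
  also have "\<dots> = real (num_tableaux (up [] 0)) * F (up [] 0) 0"
    using trans_prob_up[of "[]" 0 0] tp0 by (simp add: diagrams_0 addable_Nil num_tableaux_Nil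
        prob_space)
  also have "\<dots> = (\<Sum>\<nu>\<in>diagrams (Suc 0). \<Sum>c\<in>removable \<nu>.
      real (num_tableaux (down \<nu> c)) * (real (num_tableaux \<nu>) / fact (Suc 0)) * F \<nu> c)"
    unfolding sum_up_down[symmetric, of "\<lambda>\<mu> c \<nu>. real (num_tableaux \<mu>) *
        (real (num_tableaux \<nu>) / fact (Suc 0)) * F \<nu> c"]
    by (simp add: diagrams_0 addable_Nil num_tableaux_Nil)
  finally show ?case .
next
  case (Suc n)
  let ?f = "\<lambda>\<mu>. real (num_tableaux \<mu>)"
  define w where "w \<kappa> = ?f \<kappa> / fact (Suc (Suc n))" for \<kappa>
  have w: "?f \<nu> / fact (Suc n) * trans_prob \<nu> b = w (up \<nu> b)"
      if "\<nu> \<in> diagrams (Suc n)" "b \<in> addable \<nu>" for \<nu> b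
    unfolding times_divide_eq_left trans_prob_up[OF that] w_def fact_Suc[of "Suc n"] by simp
  have "expectation (\<lambda>\<omega>. F (\<Lambda> (Suc (Suc n)) \<omega>) (X (Suc n) \<omega>)) =
      (\<Sum>\<nu>\<in>diagrams (Suc n). \<Sum>c\<in>removable \<nu>. ?f (down \<nu> c) * (?f \<nu> / fact (Suc n)) *
        (\<Sum>b\<in>addable \<nu>. trans_prob \<nu> b * F (up \<nu> b) (move c b)))"
    unfolding expectation_X_Suc by (rule Suc.IH[of "\<lambda>\<nu> c. \<Sum>b\<in>addable \<nu>. trans_prob \<nu> b *
        F (up \<nu> b) (move c b)"])
  also have "\<dots> = (\<Sum>\<nu>\<in>diagrams (Suc n). \<Sum>b\<in>addable \<nu>. \<Sum>c\<in>removable \<nu>.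
      ?f (down \<nu> c) * ((?f \<nu> / fact (Suc n) * trans_prob \<nu> b) * F (up \<nu> b) (move c b)))"
    unfolding sum_distrib_left by (subst (2) sum.swap) (simp only: mult_ac)
  also have "\<dots> = (\<Sum>\<nu>\<in>diagrams (Suc n). \<Sum>b\<in>addable \<nu>. \<Sum>c\<in>removable \<nu>.
      ?f (down \<nu> c) * (w (up \<nu> b) * F (up \<nu> b) (move c b)))"
    by (intro sum.cong refl) (simp only: w)
  also have "\<dots> = (\<Sum>\<kappa>\<in>diagrams (Suc (Suc n)). \<Sum>b\<in>removable \<kappa>. \<Sum>c\<in>removable (down \<kappa> b).
      ?f (down (down \<kappa> b) c) * (w \<kappa> * F \<kappa> (move c b)))"
    by (rule sum_up_down[of "\<lambda>\<nu> b \<kappa>. \<Sum>c\<in>removable \<nu>. ?f (down \<nu> c) * (w \<kappa> * F \<kappa> (move c b))"])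
  also have "\<dots> = (\<Sum>\<kappa>\<in>diagrams (Suc (Suc n)). \<Sum>d\<in>removable \<kappa>. ?f (down \<kappa> d) * w \<kappa> * F \<kappa> d)"
  proof (rule sum.cong[OF refl])
    fix \<kappa> assume \<kappa>: "\<kappa> \<in> diagrams (Suc (Suc n))"
    hence y: "young_diagram \<kappa>" by (simp add: diagrams_def)
    define S where "S = (SIGMA b:removable \<kappa>. removable (down \<kappa> b))"
    have mv: "(\<lambda>(b, c). move c b) ` S \<subseteq> removable \<kappa>"
    proof safe
      fix b c assume "(b, c) \<in> S"
      hence "b \<in> removable \<kappa>" "c \<in> removable (down \<kappa> b)" by (auto simp: S_def)
      thus "move c b \<in> removable \<kappa>" using move_removable step_down[OF y] by blast
    qed
    have "(\<Sum>b\<in>removable \<kappa>. \<Sum>c\<in>removable (down \<kappa> b). ?f (down (down \<kappa> b) c) * (w \<kappa> *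
        F \<kappa> (move c b))) =
        (\<Sum>(b, c)\<in>S. ?f (down (down \<kappa> b) c) * (w \<kappa> * F \<kappa> (move c b)))"
      unfolding S_def by (rule sum.Sigma) (auto simp: finite_removable)
    also have "\<dots> = (\<Sum>d\<in>removable \<kappa>. \<Sum>(b, c)\<in>{x \<in> S. (\<lambda>(b, c). move c b) x = d}.
        ?f (down (down \<kappa> b) c) * (w \<kappa> * F \<kappa> (move c b)))"
      by (rule sum.group[OF _ finite_removable mv, symmetric]) (auto simp: S_def finite_removable)
    also have "\<dots> = (\<Sum>d\<in>removable \<kappa>. ?f (down \<kappa> d) * w \<kappa> * F \<kappa> d)"
    proof (intro sum.cong refl)
      fix d assume d: "d \<in> removable \<kappa>"
      note s = step_down[OF y d]
      have pos: "sum_list (down \<kappa> d) > 0" using step_sum[OF s] \<kappa> by (simp add: diagrams_def)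
      have "{x \<in> S. (\<lambda>(b, c). move c b) x = d} =
          {(b, X). b \<in> removable \<kappa> \<and> X \<in> removable (down \<kappa> b) \<and> move X b = d}" (is "?S = _")
        by (auto simp: S_def)
      hence sl: "(\<Sum>(b, c)\<in>?S. ?f (down (down \<kappa> b) c)) = ?f (down \<kappa> d)"
        using slide_preimages[OF y d, of ?f] num_tableaux_branching[OF step_youngD(1)[OF s] pos]
            by simp
      have "(\<Sum>(b, c)\<in>?S. ?f (down (down \<kappa> b) c) * (w \<kappa> * F \<kappa> (move c b))) =
          (\<Sum>(b, c)\<in>?S. ?f (down (down \<kappa> b) c)) * (w \<kappa> * F \<kappa> d)"
        unfolding sum_distrib_right by (intro sum.cong refl) auto
      thus "(\<Sum>(b, c)\<in>?S. ?f (down (down \<kappa> b) c) * (w \<kappa> * F \<kappa> (move c b))) =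
          ?f (down \<kappa> d) * w \<kappa> * F \<kappa> d"
        unfolding sl by (simp only: mult.assoc)
    qed
    finally show "(\<Sum>b\<in>removable \<kappa>. \<Sum>c\<in>removable (down \<kappa> b). ?f (down (down \<kappa> b) c) * (w \<kappa> *
        F \<kappa> (move c b))) =
        (\<Sum>d\<in>removable \<kappa>. ?f (down \<kappa> d) * w \<kappa> * F \<kappa> d)" .
  qed
  finally show ?case by (simp only: w_def)
qed

text \<open>Summing the joint law over the corner, by the branching rule.\<close>

corollary plancherel_marginal:
  fixes F :: "nat list \<Rightarrow> real"
  shows "expectation (\<lambda>\<omega>. F (\<Lambda> N \<omega>)) = (\<Sum>\<mu>\<in>diagrams N. real (num_tableaux \<mu>) *
      (real (num_tableaux \<mu>) / fact N) * F \<mu>)"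
proof (cases N)
  case 0
  thus ?thesis using expectation_cong_paths[of 0 "\<lambda>h. F (last h)" "\<lambda>h. F []"]
    by (simp add: paths_0 diagrams_0 num_tableaux_Nil prob_space)
next
  case (Suc n)
  have "expectation (\<lambda>\<omega>. F (\<Lambda> N \<omega>)) = (\<Sum>\<nu>\<in>diagrams N. \<Sum>c\<in>removable \<nu>.
      real (num_tableaux (down \<nu> c)) * (real (num_tableaux \<nu>) / fact N) * F \<nu>)"
    unfolding Suc by (rule X_joint_law)
  also have "\<dots> = (\<Sum>\<nu>\<in>diagrams N. (\<Sum>c\<in>removable \<nu>. real (num_tableaux (down \<nu> c))) *
      (real (num_tableaux \<nu>) / fact N) * F \<nu>)" by (simp only: sum_distrib_right)
  also have "\<dots> = (\<Sum>\<nu>\<in>diagrams N. real (num_tableaux \<nu>) * (real (num_tableaux \<nu>) / fact N) * F \<nu>)"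
    using Suc by (intro sum.cong refl) (simp add: diagrams_def num_tableaux_branching)
  finally show ?thesis .
qed

text \<open>The joint law of the diagram and the corner of the second-class particle is the one of the
  diagram and the box added last.\<close>

corollary X_law:
  "prob {\<omega> \<in> space M. real_of_int (X n \<omega>) / s \<le> z} = expectation (\<lambda>\<omega>. cdf (transition_law (\<Lambda> n \<omega>)
      s) z)"
proof -
  let ?f = "\<lambda>\<mu>. real (num_tableaux \<mu>)" and ?i = "\<lambda>c. of_bool (real_of_int c / s \<le> z) :: real"
  have "prob {\<omega> \<in> space M. real_of_int (X n \<omega>) / s \<le> z} = expectation (indicator {\<omega> \<in> space M.
      real_of_int (X n \<omega>) / s \<le> z})"
    by (subst Bochner_Integration.integral_indicator) (auto simp: Int_def conj_commute)
  also have "\<dots> = expectation (\<lambda>\<omega>. ?i (X n \<omega>))"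
    by (intro Bochner_Integration.integral_cong refl) (auto simp: indicator_def)
  also have "\<dots> = (\<Sum>\<mu>\<in>diagrams n. \<Sum>c\<in>addable \<mu>. ?f \<mu> * (?f (up \<mu> c) / fact (Suc n)) * ?i c)"
    unfolding X_joint_law[of "\<lambda>_. ?i"] by (rule sum_up_down[symmetric, of "\<lambda>\<mu> c \<nu>. ?f \<mu> *
        (?f \<nu> / fact (Suc n)) * ?i c"])
  also have "\<dots> = (\<Sum>\<mu>\<in>diagrams n. ?f \<mu> * (?f \<mu> / fact n) * (\<Sum>c\<in>addable \<mu>. trans_prob \<mu> c * ?i c))"
    unfolding sum_distrib_left
  proof (intro sum.cong refl)
    fix \<mu> c assume a: "\<mu> \<in> diagrams n" "c \<in> addable \<mu>"
    have "?f \<mu> / fact n * trans_prob \<mu> c = ?f (up \<mu> c) / fact (Suc n)" 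
      unfolding times_divide_eq_left trans_prob_up[OF a] by simp
    thus "?f \<mu> * (?f (up \<mu> c) / fact (Suc n)) * ?i c = ?f \<mu> * (?f \<mu> / fact n) * (trans_prob \<mu> c *
        ?i c)"
      by (metis mult.assoc)
  qed
  also have "\<dots> = expectation (\<lambda>\<omega>. \<Sum>c\<in>addable (\<Lambda> n \<omega>). trans_prob (\<Lambda> n \<omega>) c * ?i c)"
    by (rule plancherel_marginal[symmetric])
  also have "\<dots> = expectation (\<lambda>\<omega>. cdf (transition_law (\<Lambda> n \<omega>) s) z)"
    using expectation_cong_paths[of n "\<lambda>h. \<Sum>c\<in>addable (last h). trans_prob (last h) c *
        ?i c" "\<lambda>h. cdf (transition_law (last h) s) z"]
    unfolding last_hist by (simp only: transition_law(4) paths_young)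
  finally show ?thesis .
qed

text \<open>The diagram of size one is the one at time \<open>0\<close>, where the martingale starts, so there is no
  increment up to it.\<close>

definition right_mass_incr :: "nat \<Rightarrow> nat list list \<Rightarrow> real" where
  "right_mass_incr j h = (if j \<le> 1 then 0 else right_mass (last h) (pathpos h) -
      right_mass (last (butlast h)) (pathpos (butlast h)))"

lemma right_mass_martingale: "martingale_increments right_mass_incr"
  unfolding martingale_increments_def
proof (intro allI ballI)
  fix n h assume h: "h \<in> paths n"
  show "(\<Sum>c\<in>addable (last h). trans_prob (last h) c * right_mass_incr (Suc n) (h @ [up (last h)
      c])) = 0"
  proof (cases n)
    case 0 thus ?thesis by (simp add: right_mass_incr_def)
  next
    case (Suc m)
    hence h': "h \<in> paths (Suc m)" using h by simp
    note y = paths_young[OF h]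
    have "(\<Sum>c\<in>addable (last h). trans_prob (last h) c * right_mass_incr (Suc n) (h @ [up (last h)
        c])) =
      (\<Sum>c\<in>addable (last h). trans_prob (last h) c * right_mass (up (last h) c) (move (pathpos h)
          c) - right_mass (last h) (pathpos h) * trans_prob (last h) c)"
      using Suc by (intro sum.cong refl) (simp add: right_mass_incr_def pathpos_Suc[OF h']
          algebra_simps)
    also have "\<dots> = 0"
      by (simp only: sum_subtractf right_mass_harmonic[OF y pathpos_removable[OF h']]
          sum_distrib_left[symmetric] trans_prob_sum[OF y] mult_1_right diff_self)
    finally show ?thesis .
  qed
qed

lemma sum_right_mass_incr:
  "(\<Sum>k<Suc n. incr right_mass_incr k \<omega>) = right_mass (\<Lambda> (Suc n) \<omega>) (X n \<omega>) -
      right_mass (\<Lambda> 1 \<omega>) (X 0 \<omega>)"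
proof (induction n)
  case 0 thus ?case by (simp add: incr_def right_mass_incr_def)
next
  case (Suc n)
  have "incr right_mass_incr (Suc n) \<omega> = right_mass (\<Lambda> (Suc (Suc n)) \<omega>) (X (Suc n) \<omega>) -
      right_mass (\<Lambda> (Suc n) \<omega>) (X n \<omega>)"
    by (simp add: incr_def right_mass_incr_def butlast_hist X_pathpos)
  thus ?case using Suc by simp
qed

text \<open>The second moments of a bounded martingale are bounded, so the variances of its increments
  are summable.\<close>

lemma right_mass_convergent: "AE \<omega> in M. convergent (\<lambda>n. right_mass (\<Lambda> (Suc n) \<omega>) (X n \<omega>))"
proof -
  define R where "R h = right_mass (last h) (pathpos h)" for h
  define v where "v k = expectation (\<lambda>\<omega>. (incr right_mass_incr k \<omega>)\<^sup>2)" for k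
  define e where "e k = expectation (\<lambda>\<omega>. (R (hist (Suc k) \<omega>))\<^sup>2)" for k
  have v: "v (Suc k) = e (Suc k) - e k" for k
  proof -
    have i: "integrable M (\<lambda>\<omega>. (R (hist (Suc j) \<omega>))\<^sup>2)" for j
      by (rule expectation_hist(1)[of "\<lambda>h. (R h)\<^sup>2"])
    have i2: "integrable M (\<lambda>\<omega>. 2 * R (hist (Suc k) \<omega>) * right_mass_incr (Suc (Suc k)) (hist (Suc
        (Suc k)) \<omega>))"
      using expectation_hist(1)[of "\<lambda>h. 2 * R (butlast h) *
          right_mass_incr (Suc (Suc k)) h" "Suc (Suc k)"]
      by (simp add: butlast_hist)
    have "(incr right_mass_incr (Suc k) \<omega>)\<^sup>2 = (R (hist (Suc (Suc k)) \<omega>))\<^sup>2 - (R (hist (Suc k) \<omega>))\<^sup>2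
        - 2 * R (hist (Suc k) \<omega>) * right_mass_incr (Suc (Suc k)) (hist (Suc (Suc k)) \<omega>)" for \<omega>
      by (simp add: incr_def right_mass_incr_def R_def butlast_hist power2_eq_square algebra_simps)
    hence "v (Suc k) = expectation (\<lambda>\<omega>. (R (hist (Suc (Suc k)) \<omega>))\<^sup>2 - (R (hist (Suc k) \<omega>))\<^sup>2
        - 2 * R (hist (Suc k) \<omega>) * right_mass_incr (Suc (Suc k)) (hist (Suc (Suc k)) \<omega>))"
      unfolding v_def by presburger
    also have "\<dots> = e (Suc k) - e k - expectation (\<lambda>\<omega>. 2 * R (hist (Suc k) \<omega>) *
        right_mass_incr (Suc (Suc k)) (hist (Suc (Suc k)) \<omega>))"
      unfolding e_def using i i2 by (simp del: Bochner_Integration.integral_mult_right_zero)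
    also have "expectation (\<lambda>\<omega>. 2 * R (hist (Suc k) \<omega>) * right_mass_incr (Suc (Suc k)) (hist (Suc
        (Suc k)) \<omega>)) = 0"
      by (rule martingale_orthogonal[OF right_mass_martingale, of "\<lambda>h. 2 * R h"])
    finally show ?thesis by simp
  qed
  have v0: "v 0 = 0" by (simp add: v_def incr_def right_mass_incr_def)
  have e: "0 \<le> e k" "e k \<le> 1" for k
  proof -
    show "0 \<le> e k" by (simp add: e_def)
    have "e k \<le> expectation (\<lambda>\<omega>. 1)" unfolding e_def
    proof (rule expectation_mono_paths[of _ "\<lambda>h. (R h)\<^sup>2" "\<lambda>h. 1"])
      fix h assume "h \<in> paths (Suc k)"
      thus "(R h)\<^sup>2 \<le> 1" using right_mass_bounds[OF paths_young] by (simp add: R_def power_le_one)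
    qed
    thus "e k \<le> 1" by (simp add: prob_space)
  qed
  have "summable v"
  proof (rule summableI_nonneg_bounded[of _ 1])
    show "0 \<le> v k" for k by (simp add: v_def)
    have S: "(\<Sum>k<Suc n. v k) = e n - e 0" for n by (induction n) (simp_all add: v v0)
    show "(\<Sum>k<n. v k) \<le> 1" for n
    proof (cases n)
      case (Suc k) thus ?thesis unfolding Suc S using e(2)[of k] e(1)[of 0] by linarith
    qed simp
  qed
  hence "AE \<omega> in M. convergent (\<lambda>n. \<Sum>k<n. incr right_mass_incr k \<omega>)"
    unfolding v_def by (rule martingale_convergence[OF right_mass_martingale])
  thus ?thesis
  proof eventually_elim
    case (elim \<omega>)
    then obtain L where "(\<lambda>n. \<Sum>k<n. incr right_mass_incr k \<omega>) \<longlonglongrightarrow> L" by (auto simp: convergent_def)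
    hence "(\<lambda>n. right_mass (\<Lambda> (Suc n) \<omega>) (X n \<omega>) - right_mass (\<Lambda> 1 \<omega>) (X 0 \<omega>)) \<longlonglongrightarrow> L"
      unfolding sum_right_mass_incr[symmetric] by (rule LIMSEQ_Suc)
    from tendsto_add[OF this tendsto_const[of "right_mass (\<Lambda> 1 \<omega>) (X 0 \<omega>)"]]
    show ?case by (auto simp: convergent_def)
  qed
qed

end


section \<open>Convergence\<close>

text \<open>By monotonicity, \<open>Fn n y < Fn n (x n)\<close> forces \<open>y < x n\<close>, and both sides converge.\<close>

lemma quantile_convergence:
  fixes Fn :: "nat \<Rightarrow> real \<Rightarrow> real" and F :: "real \<Rightarrow> real" and x :: "nat \<Rightarrow> real"
  assumes mono: "\<And>n. mono (Fn n)" and lim: "\<And>y. (\<lambda>n. Fn n y) \<longlonglongrightarrow> F y"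
    and u: "(\<lambda>n. Fn n (x n)) \<longlonglongrightarrow> u"
  shows "F y < u \<Longrightarrow> eventually (\<lambda>n. y < x n) sequentially"
    and "u < F y \<Longrightarrow> eventually (\<lambda>n. x n < y) sequentially"
proof -
  show "eventually (\<lambda>n. y < x n) sequentially" if "F y < u"
  proof -
    have "(\<lambda>n. Fn n (x n) - Fn n y) \<longlonglongrightarrow> u - F y" by (intro tendsto_diff u lim)
    hence "eventually (\<lambda>n. 0 < Fn n (x n) - Fn n y) sequentially" using that
        by (intro order_tendstoD(1)) auto
    thus ?thesis by eventually_elim (use mono in \<open>auto simp: mono_def not_le[symmetric]\<close>)
  qed
  show "eventually (\<lambda>n. x n < y) sequentially" if "u < F y"
  proof -
    have "(\<lambda>n. Fn n y - Fn n (x n)) \<longlonglongrightarrow> F y - u" by (intro tendsto_diff u lim)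
    hence "eventually (\<lambda>n. 0 < Fn n y - Fn n (x n)) sequentially" using that
        by (intro order_tendstoD(1)) auto
    thus ?thesis by eventually_elim (use mono in \<open>auto simp: mono_def not_le[symmetric]\<close>)
  qed
qed

text \<open>Fatou's inequality for the events with a fixed index \<open>q\<close>, and then \<open>q\<close> tends to infinity.\<close>

lemma (in prob_space) AE_not_all_eventually:
  assumes A: "\<And>q n. A q n \<in> sets M" and lim: "\<And>q. (\<lambda>n. prob (A q n)) \<longlonglongrightarrow> r q"
    and r: "r \<longlonglongrightarrow> (0 :: real)"
  shows "AE \<omega> in M. \<not> (\<forall>q :: nat. eventually (\<lambda>n. \<omega> \<in> A q n) sequentially)"
proof -
  define B where "B q m = (\<Inter>n\<in>{m..}. A q n)" for q m :: nat
  define L where "L q = (\<Union>m. B q m)" for q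
  have Bs: "B q m \<in> sets M" for q m unfolding B_def using A by (intro sets.countable_INT') auto
  have Ls: "L q \<in> sets M" for q unfolding L_def using Bs by auto
  have Lr: "prob (L q) \<le> r q" for q
  proof (rule LIMSEQ_le_const2)
    show "(\<lambda>m. prob (B q m)) \<longlonglongrightarrow> prob (L q)"
      unfolding L_def using Bs by (intro finite_Lim_measure_incseq) (auto simp: incseq_def B_def)
    have "prob (B q m) \<le> r q" for m
    proof (rule LIMSEQ_le_const[OF lim])
      have "prob (B q m) \<le> prob (A q n)" if "n \<ge> m" for n
        using that A by (intro finite_measure_mono) (auto simp: B_def)
      thus "\<exists>N. \<forall>n\<ge>N. prob (B q m) \<le> prob (A q n)" by blast
    qed
    thus "\<exists>N. \<forall>n\<ge>N. prob (B q n) \<le> r q" by blast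
  qed
  have Is: "(\<Inter>q. L q) \<in> sets M" using Ls by auto
  have "prob (\<Inter>q. L q) \<le> 0"
  proof (rule LIMSEQ_le_const[OF r])
    have "prob (\<Inter>q. L q) \<le> r q" for q
    proof -
      have "prob (\<Inter>q. L q) \<le> prob (L q)" by (rule finite_measure_mono[OF _ Ls]) blast
      thus ?thesis using Lr[of q] by linarith
    qed
    thus "\<exists>N. \<forall>q\<ge>N. prob (\<Inter>q. L q) \<le> r q" by blast
  qed
  hence "prob (\<Inter>q. L q) = 0" by (simp add: measure_le_0_iff)
  hence "AE \<omega> in M. \<omega> \<notin> (\<Inter>q. L q)"
    using Is by (intro AE_not_in) (auto simp: null_sets_def emeasure_eq_measure)
  thus ?thesis
  proof eventually_elim
    case (elim \<omega>)
    then obtain q where q: "\<And>m. \<omega> \<notin> B q m" by (auto simp: L_def)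
    have "\<exists>n\<ge>N. \<omega> \<notin> A q n" for N using q[of N] by (auto simp: B_def)
    thus ?case by (auto simp: eventually_sequentially)
  qed
qed

context plancherel_growth_process
begin

lemma AE_young: "AE \<omega> in M. \<forall>n. young_diagram (\<Lambda> n \<omega>)"
  using AE_paths by eventually_elim (metis paths_young last_hist)

lemma AE_transition_cdf:
  "AE \<omega> in M. \<forall>x. (\<lambda>n. cdf (transition_law (\<Lambda> n \<omega>) (sqrt (real n))) x) \<longlonglongrightarrow> cdf semicircle_law x"
  using AE_moments AE_young by eventually_elim (auto intro: transition_law_weak_conv)

text \<open>Dominated convergence applied to \<open>X_law\<close>.\<close>

lemma X_cdf_limit:
  "(\<lambda>n. prob {\<omega> \<in> space M. real_of_int (X n \<omega>) / sqrt (real n) \<le> y}) \<longlonglongrightarrow> cdf semicircle_law y"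
proof -
  have "(\<lambda>n. expectation (\<lambda>\<omega>. cdf (transition_law (\<Lambda> n \<omega>) (sqrt (real n))) y)) \<longlonglongrightarrow>
      expectation (\<lambda>\<omega>. cdf semicircle_law y)"
  proof (rule integral_dominated_convergence[where w = "\<lambda>_. 1"])
    show "(\<lambda>\<omega>. cdf (transition_law (\<Lambda> n \<omega>) (sqrt (real n))) y) \<in> borel_measurable M" for n
      using borel_hist[of "\<lambda>h. cdf (transition_law (last h) (sqrt (real n))) y" n]
          unfolding last_hist .
    show "AE \<omega> in M. (\<lambda>n. cdf (transition_law (\<Lambda> n \<omega>) (sqrt (real n))) y) \<longlonglongrightarrow> cdf semicircle_law y"
      using AE_transition_cdf by eventually_elim blast
    show "AE \<omega> in M. norm (cdf (transition_law (\<Lambda> n \<omega>) (sqrt (real n))) y) \<le> 1" for n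
      using AE_young
    proof eventually_elim
      case (elim \<omega>)
      interpret T: real_distribution "transition_law (\<Lambda> n \<omega>) (sqrt (real n))"
        by (rule transition_law(1)) (use elim in blast)
      show ?case unfolding cdf_def using T.prob_le_1 by simp
    qed
  qed auto
  thus ?thesis unfolding X_law by (simp add: prob_space)
qed

text \<open>The martingale of \<open>right_mass_convergent\<close> is one minus the distribution function of the
  transition law at the second-class particle, so \<open>quantile_convergence\<close> applies. A limit \<open>u\<close>
  equal to \<open>0\<close> or \<open>1\<close> would push the particle to an end of the support, which has probability zero
  by \<open>X_cdf_limit\<close>.\<close>

theorem X_converges:
  "AE \<omega> in M. convergent (\<lambda>n. real_of_int (X n \<omega>) / sqrt (real n))"
proof -
  interpret sc: real_distribution semicircle_law by (rule real_distribution_semicircle_law)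
  \<comment> \<open>Points of \<open>(0, 2)\<close> tending to the end of the support.\<close>
  define y where "y q = 2 - 1 / real (Suc q)" for q :: nat
  have y2: "y \<longlonglongrightarrow> 2"
  proof -
    have "(\<lambda>q. 2 - 1 / real (Suc q)) \<longlonglongrightarrow> 2 - 0"
      by (intro tendsto_diff tendsto_const) (rule LIMSEQ_Suc[OF lim_1_over_n])
    thus ?thesis by (simp add: y_def[abs_def])
  qed
  have y: "0 < y q" "y q < 2" for q by (auto simp: y_def field_simps)
  have right: "AE \<omega> in M. \<not> (\<forall>q. eventually (\<lambda>n. \<omega> \<in> {\<omega> \<in> space M. \<not> real_of_int (X n \<omega>) / sqrt
      (real n) \<le> y q}) sequentially)"
  proof (rule AE_not_all_eventually)
    show "{\<omega> \<in> space M. \<not> real_of_int (X n \<omega>) / sqrt (real n) \<le> y q} \<in> sets M" for q n by measurable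
    show "(\<lambda>n. prob {\<omega> \<in> space M. \<not> real_of_int (X n \<omega>) / sqrt (real n) \<le> y q}) \<longlonglongrightarrow>
        1 - cdf semicircle_law (y q)" for q
    proof -
      have "prob {\<omega> \<in> space M. \<not> real_of_int (X n \<omega>) / sqrt (real n) \<le> y q} =
        1 - prob {\<omega> \<in> space M. real_of_int (X n \<omega>) / sqrt (real n) \<le> y q}" for n
        by (rule prob_neg) measurable
      thus ?thesis by (simp only:) (intro tendsto_diff tendsto_const X_cdf_limit)
    qed
    have "(\<lambda>q. 1 - cdf semicircle_law (y q)) \<longlonglongrightarrow> 1 - cdf semicircle_law 2"
      by (intro tendsto_diff tendsto_const isCont_tendsto_compose[OF isCont_semicircle_law y2])
    thus "(\<lambda>q. 1 - cdf semicircle_law (y q)) \<longlonglongrightarrow> 0" by (simp add: cdf_semicircle_law_ends)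
  qed
  have left: "AE \<omega> in M. \<not> (\<forall>q. eventually (\<lambda>n. \<omega> \<in> {\<omega> \<in> space M. real_of_int (X n \<omega>) / sqrt (real
      n) \<le> - y q}) sequentially)"
  proof (rule AE_not_all_eventually)
    show "{\<omega> \<in> space M. real_of_int (X n \<omega>) / sqrt (real n) \<le> - y q} \<in> sets M" for q n by measurable
    show "(\<lambda>n. prob {\<omega> \<in> space M. real_of_int (X n \<omega>) / sqrt (real n) \<le> - y q}) \<longlonglongrightarrow>
        cdf semicircle_law (- y q)" for q
      by (rule X_cdf_limit)
    have "(\<lambda>q. cdf semicircle_law (- y q)) \<longlonglongrightarrow> cdf semicircle_law (- 2)"
      by (intro isCont_tendsto_compose[OF isCont_semicircle_law] tendsto_minus y2)
    thus "(\<lambda>q. cdf semicircle_law (- y q)) \<longlonglongrightarrow> 0" by (simp add: cdf_semicircle_law_ends)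
  qed
  show ?thesis using AE_transition_cdf AE_young right_mass_convergent right left AE_space
  proof eventually_elim
    case (elim \<omega>)
    \<comment> \<open>At time \<open>n\<close> the diagram has \<open>n + 1\<close> boxes, which is the natural scale for its transition
      law.\<close>
    define x where "x n = real_of_int (X n \<omega>) / sqrt (real (Suc n))" for n
    define Fn where "Fn n = cdf (transition_law (\<Lambda> (Suc n) \<omega>) (sqrt (real (Suc n))))" for n
    have mono: "mono (Fn n)" for n
    proof -
      interpret T: real_distribution "transition_law (\<Lambda> (Suc n) \<omega>) (sqrt (real (Suc n)))"
        by (rule transition_law(1)) (use elim in blast)
      show ?thesis unfolding Fn_def mono_def using T.cdf_nondecreasing by blast
    qed
    have lim: "(\<lambda>n. Fn n z) \<longlonglongrightarrow> cdf semicircle_law z" for z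
      unfolding Fn_def using elim(1)[rule_format, of z] by (rule LIMSEQ_Suc)
    obtain L where L: "(\<lambda>n. right_mass (\<Lambda> (Suc n) \<omega>) (X n \<omega>)) \<longlonglongrightarrow>
        L" using elim(3) unfolding convergent_def by blast
    define u where "u = 1 - L"
    have Fx: "Fn n (x n) = 1 - right_mass (\<Lambda> (Suc n) \<omega>) (X n \<omega>)" for n
      unfolding Fn_def x_def by (rule right_mass_cdf[symmetric]) (use elim in auto)
    have u: "(\<lambda>n. Fn n (x n)) \<longlonglongrightarrow> u" unfolding Fx u_def by (intro tendsto_diff tendsto_const L)
    have ub: "0 \<le> u" "u \<le> 1"
    proof -
      have "0 \<le> Fn n (x n)" "Fn n (x n) \<le> 1" for n
        unfolding Fx using right_mass_bounds[of "\<Lambda> (Suc n) \<omega>" "X n \<omega>"] elim(2) by auto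
      thus "0 \<le> u" "u \<le> 1" using LIMSEQ_le_const[OF u] LIMSEQ_le_const2[OF u] by blast+
    qed
    note qc = quantile_convergence[OF mono lim u]
    have shrink1: "x n \<le> real_of_int (X n \<omega>) / sqrt (real n)" if "n > 0" "X n \<omega> > 0" for n
      unfolding x_def by (rule divide_left_mono) (use that in auto)
    have shrink2: "real_of_int (X n \<omega>) / sqrt (real n) \<le> x n" if "n > 0" "X n \<omega> < 0" for n
      unfolding x_def by (rule divide_left_mono_neg) (use that in auto)
    have "u \<noteq> 1"
    proof
      assume u1: "u = 1"
      have "eventually (\<lambda>n. \<omega> \<in> {\<omega> \<in> space M. \<not> real_of_int (X n \<omega>) / sqrt (real n) \<le>
          y q}) sequentially" for q
      proof -
        have "cdf semicircle_law (y q) < cdf semicircle_law 2" using y[of q]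
            by (intro semicircle_law_interval_pos) auto
        hence "eventually (\<lambda>n. y q < x n) sequentially" using u1 cdf_semicircle_law_ends
            by (intro qc(1)) simp
        thus ?thesis using eventually_gt_at_top[of 0]
        proof eventually_elim
          case (elim n)
          have "0 < x n" using elim y(1)[of q] by linarith
          hence "X n \<omega> > 0" by (simp add: x_def zero_less_divide_iff)
          thus ?case using shrink1[of n] elim \<open>\<omega> \<in> space M\<close> by auto
        qed
      qed
      thus False using elim(4) by blast
    qed
    moreover have "u \<noteq> 0"
    proof
      assume u0: "u = 0"
      have "eventually (\<lambda>n. \<omega> \<in> {\<omega> \<in> space M. real_of_int (X n \<omega>) / sqrt (real n) \<le>
          - y q}) sequentially" for q
      proof -
        have "cdf semicircle_law (-2) < cdf semicircle_law (- y q)" using y[of q]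
            by (intro semicircle_law_interval_pos) auto
        hence "eventually (\<lambda>n. x n < - y q) sequentially" using u0 cdf_semicircle_law_ends
            by (intro qc(2)) simp
        thus ?thesis using eventually_gt_at_top[of 0]
        proof eventually_elim
          case (elim n)
          have "x n < 0" using elim y(1)[of q] by linarith
          hence "X n \<omega> < 0" by (simp add: x_def divide_less_0_iff)
          thus ?case using shrink2[of n] elim \<open>\<omega> \<in> space M\<close> by auto
        qed
      qed
      thus False using elim(5) by blast
    qed
    ultimately have "0 < u" "u < 1" using ub by auto
    then obtain w where w: "\<And>z. z < w \<Longrightarrow> cdf semicircle_law z < u" "\<And>z. w < z \<Longrightarrow> u <
        cdf semicircle_law z"
      using quantile_semicircle_law by blast
    have "x \<longlonglongrightarrow> w"
      by (rule order_tendstoI) (use qc w in blast)+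
    moreover have "(\<lambda>n. sqrt (real (Suc n) / real n)) \<longlonglongrightarrow> sqrt 1"
      by (intro tendsto_intros LIMSEQ_Suc_n_over_n)
    ultimately have l: "(\<lambda>n. x n * sqrt (real (Suc n) / real n)) \<longlonglongrightarrow>
        w * sqrt 1" by (rule tendsto_mult)
    have "x n * sqrt (real (Suc n) / real n) = real_of_int (X n \<omega>) / sqrt (real n)" for n
      by (simp add: x_def real_sqrt_divide del: of_nat_Suc)
    with l show ?case unfolding convergent_def by auto
  qed
qed

text \<open>The characteristic function of \<open>W\<close> is the limit of those of \<open>X n / sqrt n\<close>.\<close>

lemma limit_semicircle:
  assumes meas: "W \<in> borel_measurable M"
    and lim: "AE \<omega> in M. (\<lambda>n. real_of_int (X n \<omega>) / sqrt (real n)) \<longlonglongrightarrow> W \<omega>"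
  shows "distr M borel W = semicircle_law"
proof -
  define x where "x n \<omega> = real_of_int (X n \<omega>) / sqrt (real n)" for n \<omega>
  have xm [measurable]: "x n \<in> borel_measurable M" for n unfolding x_def[abs_def] by measurable
  note meas [measurable]
  have rd: "real_distribution (distr M borel (x n))" for n by simp
  have wc: "weak_conv_m (\<lambda>n. distr M borel (x n)) semicircle_law"
    unfolding weak_conv_m_def weak_conv_def
  proof (intro allI impI)
    fix y
    have "cdf (distr M borel (x n)) y = prob {\<omega> \<in> space M. x n \<omega> \<le> y}" for n
      unfolding cdf_def by (subst measure_distr) (auto intro!: arg_cong[where f = prob])
    thus "(\<lambda>n. cdf (distr M borel (x n)) y) \<longlonglongrightarrow> cdf semicircle_law y" using X_cdf_limit[of y]
        by (simp add: x_def)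
  qed
  have "char (distr M borel W) = char semicircle_law"
  proof
    fix t
    have "(\<lambda>n. char (distr M borel (x n)) t) \<longlonglongrightarrow> char semicircle_law t"
      by (rule levy_continuity1[OF rd real_distribution_semicircle_law wc])
    moreover have "(\<lambda>n. char (distr M borel (x n)) t) \<longlonglongrightarrow> char (distr M borel W) t"
    proof -
      have e: "char (distr M borel f) t = (CLINT \<omega>|M. iexp (t *
          f \<omega>))" if [measurable]: "f \<in> borel_measurable M" for f
        unfolding char_def by (subst integral_distr) auto
      show ?thesis unfolding e[OF xm] e[OF meas]
      proof (rule integral_dominated_convergence[where w = "\<lambda>_. 1"])
        show "AE \<omega> in M. (\<lambda>n. iexp (t * x n \<omega>)) \<longlonglongrightarrow> iexp (t * W \<omega>)"
          using lim
        proof eventually_elim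
          case (elim \<omega>)
          thus ?case unfolding x_def by (intro tendsto_intros)
        qed
      qed auto
    qed
    ultimately show "char (distr M borel W) t = char semicircle_law t"
        by (rule LIMSEQ_unique[symmetric])
  qed
  thus ?thesis using meas by (intro Levy_uniqueness real_distribution_semicircle_law) auto
qed

end

theorem theorem1p2:
  fixes M :: "'a measure" and \<Lambda> :: "nat \<Rightarrow> 'a \<Rightarrow> nat list"
  assumes "plancherel_growth_process M \<Lambda>"
  shows "\<exists>W :: 'a \<Rightarrow> real.
    (AE \<omega> in M. (\<lambda>n. real_of_int (second_class_particle (\<lambda>k. \<Lambda> k \<omega>) n) / sqrt (real n))
                  \<longlonglongrightarrow> W \<omega>) \<and>
    distributed M lborel W (\<lambda>w. ennreal (semicircle_density w))"
proof -
  interpret plancherel_growth_process M \<Lambda> by (rule assms)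
  define W where "W \<omega> = lim (\<lambda>n. real_of_int (X n \<omega>) / sqrt (real n))" for \<omega>
  have meas: "W \<in> borel_measurable M"
    unfolding W_def[abs_def] by (rule borel_measurable_lim_metric) measurable
  have lim: "AE \<omega> in M. (\<lambda>n. real_of_int (X n \<omega>) / sqrt (real n)) \<longlonglongrightarrow> W \<omega>"
    using X_converges by eventually_elim (simp add: W_def convergent_LIMSEQ_iff)
  have "distr M lborel W = distr M borel W" by (rule distr_cong) auto
  also have "\<dots> = density lborel (\<lambda>w. ennreal (semicircle_density w))"
    unfolding limit_semicircle[OF meas lim] semicircle_law_def ..
  finally have "distributed M lborel W (\<lambda>w. ennreal (semicircle_density w))"
    unfolding distributed_def using meas by simp
  thus ?thesis using lim unfolding X_def by blast
qed


end
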